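(* Let $n\ge1$. Consider the Riemann--Hilbert problem of finding $A_n:\mathbb{C}\setminus\Sigma\to\mathcal{M}_D(\mathbb{C})$ such that: (1) $A_n$ is analytic on $\mathbb{C}\setminus\Sigma$; (2) $A_n$ has non-tangential boundary values $A_n^{+}$ (from the left) and $A_n^-$ (from the right) on $\Sigma\setminus\{0\}$, which are continuous functions on $\Sigma\setminus\{0\}$ and satisfy $$A_n^+(x)=A_n^-(x)\begin{pmatrix}1&e^{-V(x)}\chi_{\mathbb{R}}(x)&\boldsymbol{\omega}(x)\\0&1&\mathbf{0}\\ \mathbf{0}&\mathbf{0}&\mathbb{I}_{D-2}\end{pmatrix},\qquad x\in\Sigma\setminus\{0\};$$ (3) $A_n$ is bounded in a neighbourhood of $0$; (4) $A_n(z)=\big(\mathbb{I}+\mathcal{O}(z^{-1})\big)\operatorname{diag}\big(z^{n+D-2},z^{-n},z^{-1},\dots,z^{-1}\big)$ as $z\to\infty$. The unique solution of this Riemann--Hilbert problem is $$A_n=\begin{pmatrix}\Psi_n & C_{\mathbb{R}}\big(e^{-V}\Psi_n\big)& C_\Sigma\big(\Psi_n\boldsymbol{\omega}\big)\\[2pt] -\frac{2\pi i\lambda}{\nu_{n-1}h_{n-1}}\Psi_{n-1}&-\frac{2\pi i\lambda}{\nu_{n-1}h_{n-1}}C_{\mathbb{R}}\big(e^{-V}\Psi_{n-1}\big)&-\frac{2\pi i\lambda}{\nu_{n-1}h_{n-1}}C_\Sigma\big(\Psi_{n-1}\boldsymbol{\omega}\big)\\[2pt] \boldsymbol{R}_n&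 C_{\mathbb{R}}\big(e^{-V}\boldsymbol{R}_n\big)&C_\Sigma\big(\boldsymbol{R}_n\boldsymbol{\omega}\big)\end{pmatrix}.$$
   Context: Standing assumptions: $D\ge 4$ is an even integer, $\lambda>0$, and $V$ is a real polynomial with $V(x)=\gamma x^D+\mathcal{O}(x^{D-1})$, $\gamma>0$. $\mathcal{M}_D(\mathbb{C})$ is the space of complex $D\times D$ matrices; $\chi_A$ is the indicator function of $A$. Sobolev orthogonal polynomials: $\langle P,Q\rangle_S=\int_{\mathbb{R}}P(x)Q(x)e^{-V(x)}dx+\lambda\int_{\mathbb{R}}P'(x)Q'(x)e^{-V(x)}dx$ on real polynomials. $P_n$ ($n\ge0$) is the unique monic polynomial of degree $n$ such that $\langle P_n,P_m\rangle_S=0$ for all $n\ne m$; $h_n=\langle P_n,P_n\rangle_S$. The dual polynomial is $\Psi_n=\nu_n\big(V'P_n'-P_n''+\lambda^{-1}P_n\big)$, where $\nu_n=\frac{1}{nD\gamma}$ for $n\ge1$ and $\nu_0=\lambda$. Sibuya solutions: let $\varphi(z)=(\gamma^{-1}V(z))^{1/D}$ on a neighbourhood of infinity, with the branch such that $\varphi(z)=z(1+\mathcal{O}(z^{-1}))$ as $z\to\infty$, and let $\varphi^{-1}$ be its inverse near infinity. Fix $\varrho>0$ sufficiently large that $\varphi$ and $\varphi^{-1}$ are both injective on $\{|z|>\frac12\varrho\}$, $\frac12|z|\le|\varphi(z)|\le 2|z|$ for $|z|\ge\varrho$, and $\frac{(D-1)\varrho^{-D}}{\gamma D}\le\frac12$.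 For $k\in\{0,\dots,2D-1\}$ put $\Omega_k=\varphi^{-1}\big(\{w\in\mathbb{C}:|w|\ge\varrho,\ \pi\frac{k-1}{D}\le\arg w\le\pi\frac{k+1}{D}\}\big)$ (arguments modulo $2\pi$). $F_k$ is the unique entire function with $(-1)^kV'F_k'-F_k''+\lambda^{-1}F_k=0$ on $\mathbb{C}$ and $F_k(z)=1+\mathcal{O}(|z|^{2-D})$ as $|z|\to\infty$, $z\in\Omega_k$. Define $Y_k(z)=i^k e^{-i\pi/4}e^{-\frac12V(z)}F_k(z)$ for $k$ even and $Y_k(z)=i^ke^{-i\pi/4}\lambda\,e^{\frac12V(z)}F_k'(z)$ for $k$ odd. Wronskians: $W[f,g]=fg'-f'g$. The Wronskians $W[Y_k,Y_j]$ are constants and $W[Y_0,Y_D]\ne0$. For $j\in\{1,\dots,D-1\}\setminus\{D/2\}$: $\beta_j=-\frac{W[Y_D,Y_{2j}]}{W[Y_0,Y_D]}$ and $\kappa_j=\frac{W[Y_0,Y_{2j}]}{W[Y_0,Y_D]}$. Integrals $\int_0^{\infty_k}$ are along the ray from $0$ to $\infty_k:=e^{i\pi k/D}\infty$. Contours: $\Sigma_k=e^{2\pi ik/D}[0,+\infty)$ for $0\le k\le D-1$ and $\Sigma=\bigcup_{k=0}^{D-1}\Sigma_k$. All rays are oriented away from the origin, except $\Sigma_{D/2}=(-\infty,0]$, which is oriented towards the origin. "Left" and "right" are relative to the orientation. Weights: for $j\in\{1,\dots,D-1\}\setminus\{D/2\}$ and $z\in\Sigma$, $\omega_j(z)=Y_{2j}(z)e^{-\frac12V(z)}\chi_{\Sigma_j}(z)-\beta_jY_0(z)e^{-\frac12V(z)}\chi_{\Sigma_0}(z)+\kappa_jY_D(z)e^{-\frac12V(z)}\chi_{\Sigma_{D/2}}(z)$,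 and $\boldsymbol{\omega}=(\omega_1,\dots,\omega_{D/2-1},\omega_{D/2+1},\dots,\omega_{D-1})$ (row vector of length $D-2$). Polynomials $R_n^{(s)}$: for a complex polynomial $Q$ let $\Xi_k[Q]=\int_{\mathbb{R}}Q(x)x^ke^{-V(x)}dx$ and $\Theta_j[Q]=\frac{1}{2\pi i}\Big(-\int_0^{\infty_{2j}}Y_{2j}e^{-\frac12V}Q\,dz+\beta_j\int_0^{\infty_0}Y_0e^{-\frac12V}Q\,dz+\kappa_j\int_0^{\infty_D}Y_De^{-\frac12V}Q\,dz\Big)$. For $n\ge1$ and $s\in\{1,\dots,D-1\}\setminus\{D/2\}$, $R_n^{(s)}$ is the unique complex polynomial of degree $\le n+D-3$ with $\Xi_k[R_n^{(s)}]=0$ for $0\le k\le n-1$ and $\Theta_j[R_n^{(s)}]=\delta_{sj}$ for all $j\in\{1,\dots,D-1\}\setminus\{D/2\}$. $\boldsymbol{R}_n=(R_n^{(1)},\dots,R_n^{(D/2-1)},R_n^{(D/2+1)},\dots,R_n^{(D-1)})^{\mathsf T}$ (column vector). Cauchy transform: $C_\Gamma(f)(z)=\frac{1}{2\pi i}\int_\Gamma\frac{f(x)}{x-z}dx$ for $z\in\mathbb{C}\setminus\Gamma$, applied entrywise to vectors and matrices ($\mathbb{R}=\Sigma_{D/2}\cup\Sigma_0$ is oriented left to right).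
   Formalization: The non-tangential boundary values on Σ∖{0} are required to be attained uniformly for x in compact subsets of each ray without 0; with merely pointwise non-tangential limits uniqueness fails (left-multiply by I+G(1/(z−1))E₁₂ for a suitable entire G vanishing at 0). *)

theory Defs
  imports
    "HOL-Complex_Analysis.Complex_Analysis"
    "HOL-Library.Landau_Symbols"
    "Jordan_Normal_Form.Matrix"
begin

section \<open>Sobolev orthogonal polynomials and their duals\<close>

abbreviation cpoly :: "real poly \<Rightarrow> complex \<Rightarrow> complex" where
  "cpoly p z \<equiv> poly (map_poly complex_of_real p) z"

definition sobolev_ip :: "real poly \<Rightarrow> real \<Rightarrow> real poly \<Rightarrow> real poly \<Rightarrow> real" where
  "sobolev_ip V lam p q =
     (LBINT x. poly p x * poly q x * exp (- poly V x))
     + lam * (LBINT x. poly (pderiv p) x * poly (pderiv q) x * exp (- poly V x))"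

definition is_monic_sobolev_op :: "real poly \<Rightarrow> real \<Rightarrow> (nat \<Rightarrow> real poly) \<Rightarrow> bool" where
  "is_monic_sobolev_op V lam P \<longleftrightarrow>
     (\<forall>n. degree (P n) = n \<and> lead_coeff (P n) = 1) \<and>
     (\<forall>n m. n \<noteq> m \<longrightarrow> sobolev_ip V lam (P n) (P m) = 0)"

definition sobolev_h :: "real poly \<Rightarrow> real \<Rightarrow> (nat \<Rightarrow> real poly) \<Rightarrow> nat \<Rightarrow> real" where
  "sobolev_h V lam P n = sobolev_ip V lam (P n) (P n)"

definition nu :: "nat \<Rightarrow> real \<Rightarrow> real \<Rightarrow> nat \<Rightarrow> real" where
  "nu D g lam n = (if n = 0 then lam else 1 / (real n * real D * g))"

definition dual_Psi ::
  "nat \<Rightarrow> real \<Rightarrow> real poly \<Rightarrow> real \<Rightarrow> (nat \<Rightarrow> real poly) \<Rightarrow> nat \<Rightarrow> real poly" where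
  "dual_Psi D g V lam P n =
     Polynomial.smult (nu D g lam n)
       (pderiv V * pderiv (P n) - pderiv (pderiv (P n)) + Polynomial.smult (inverse lam) (P n))"

section \<open>Sibuya solutions\<close>

text \<open>
  Here \<open>phi\<close> is the branch of the \<open>D\<close>-th root of \<open>V / g\<close> asymptotic to the identity and
  \<open>psi\<close> is its inverse near infinity. Both live on the exterior of the disc of
  radius \<open>rho / 2\<close>; their values elsewhere are irrelevant. \<open>psi\<close> is the analytic function on
  that exterior which inverts \<open>phi\<close> for large arguments; that the two cancel on the whole
  exterior is not required, since neither need map the exterior into itself.
\<close>

definition sibuya_chart ::
  "nat \<Rightarrow> real \<Rightarrow> real poly \<Rightarrow> real \<Rightarrow> (complex \<Rightarrow> complex) \<Rightarrow> (complex \<Rightarrow> complex) \<Rightarrow> bool" where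
  "sibuya_chart D g V rho phi psi \<longleftrightarrow>
     rho > 0 \<and>
     phi holomorphic_on {z. cmod z > rho / 2} \<and>
     (\<forall>z. cmod z > rho / 2 \<longrightarrow> phi z ^ D = cpoly V z / of_real g) \<and>
     (\<lambda>z. phi z / z - 1) \<in> O[at_infinity](\<lambda>z. 1 / z) \<and>
     psi holomorphic_on {w. cmod w > rho / 2} \<and>
     eventually (\<lambda>z. psi (phi z) = z) at_infinity \<and>
     eventually (\<lambda>w. phi (psi w) = w) at_infinity \<and>
     inj_on phi {z. cmod z > rho / 2} \<and>
     inj_on psi {w. cmod w > rho / 2} \<and>
     (\<forall>z. cmod z \<ge> rho \<longrightarrow> cmod z / 2 \<le> cmod (phi z) \<and> cmod (phi z) \<le> 2 * cmod z) \<and>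
     (real D - 1) / (g * real D * rho ^ D) \<le> 1 / 2"

definition Omega :: "nat \<Rightarrow> real \<Rightarrow> (complex \<Rightarrow> complex) \<Rightarrow> nat \<Rightarrow> complex set" where
  "Omega D rho psi k =
     psi ` {w. cmod w \<ge> rho \<and>
               (\<exists>t. pi * (real k - 1) / real D \<le> t \<and> t \<le> pi * (real k + 1) / real D \<and>
                    w = of_real (cmod w) * cis t)}"

definition is_sibuya_solution ::
  "nat \<Rightarrow> real poly \<Rightarrow> real \<Rightarrow> real \<Rightarrow> (complex \<Rightarrow> complex) \<Rightarrow> nat \<Rightarrow> (complex \<Rightarrow> complex) \<Rightarrow> bool" where
  "is_sibuya_solution D V lam rho psi k f \<longleftrightarrow>
     f holomorphic_on UNIV \<and>
     (\<forall>z. (-1) ^ k * cpoly (pderiv V) z * deriv f z - deriv (deriv f) z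
            + inverse (of_real lam) * f z = 0) \<and>
     (\<lambda>z. f z - 1) \<in> O[inf at_infinity (principal (Omega D rho psi k))](\<lambda>z. of_real (cmod z powi (2 - int D)))"

definition Yfun ::
  "real poly \<Rightarrow> real \<Rightarrow> (nat \<Rightarrow> complex \<Rightarrow> complex) \<Rightarrow> nat \<Rightarrow> complex \<Rightarrow> complex" where
  "Yfun V lam F k z =
     (if even k
      then \<i> ^ k * exp (- \<i> * of_real pi / 4) * exp (- (cpoly V z / 2)) * F k z
      else \<i> ^ k * exp (- \<i> * of_real pi / 4) * of_real lam * exp (cpoly V z / 2) * deriv (F k) z)"

definition wronskian :: "(complex \<Rightarrow> complex) \<Rightarrow> (complex \<Rightarrow> complex) \<Rightarrow> complex \<Rightarrow> complex" where
  "wronskian f g z = f z * deriv g z - deriv f z * g z"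

text \<open>
  All \<open>Yfun V lam F k\<close> solve the same second-order equation without first-order term, so
  their Wronskians are constant; evaluating them at \<open>0\<close> is an arbitrary choice.
\<close>

definition beta ::
  "nat \<Rightarrow> real poly \<Rightarrow> real \<Rightarrow> (nat \<Rightarrow> complex \<Rightarrow> complex) \<Rightarrow> nat \<Rightarrow> complex" where
  "beta D V lam F j =
     - wronskian (Yfun V lam F D) (Yfun V lam F (2 * j)) 0
       / wronskian (Yfun V lam F 0) (Yfun V lam F D) 0"

definition kappa ::
  "nat \<Rightarrow> real poly \<Rightarrow> real \<Rightarrow> (nat \<Rightarrow> complex \<Rightarrow> complex) \<Rightarrow> nat \<Rightarrow> complex" where
  "kappa D V lam F j =
     wronskian (Yfun V lam F 0) (Yfun V lam F (2 * j)) 0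
       / wronskian (Yfun V lam F 0) (Yfun V lam F D) 0"

section \<open>Contours, weights and Cauchy transforms\<close>

definition ray_dir :: "nat \<Rightarrow> nat \<Rightarrow> complex" where
  "ray_dir D k = cis (pi * real k / real D)"

text \<open>The integral from \<open>0\<close> to infinity in the direction \<open>ray_dir D k\<close>.\<close>

definition ray_integral :: "nat \<Rightarrow> nat \<Rightarrow> (complex \<Rightarrow> complex) \<Rightarrow> complex" where
  "ray_integral D k f = ray_dir D k * (LBINT t:{0..}. f (of_real t * ray_dir D k))"

definition Sigma_ray :: "nat \<Rightarrow> nat \<Rightarrow> complex set" where
  "Sigma_ray D k = {of_real t * ray_dir D (2 * k) |t. t \<ge> 0}"

definition Sigma_all :: "nat \<Rightarrow> complex set" where
  "Sigma_all D = (\<Union>k<D. Sigma_ray D k)"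

text \<open>
  The sign is \<open>1\<close> for rays oriented away from the origin and \<open>-1\<close> for the negative real axis,
  the only ray oriented towards it.
\<close>

definition orient :: "nat \<Rightarrow> nat \<Rightarrow> complex" where
  "orient D k = (if k = D div 2 then -1 else 1)"

definition Sigma_integral :: "nat \<Rightarrow> (complex \<Rightarrow> complex) \<Rightarrow> complex" where
  "Sigma_integral D f = (\<Sum>k<D. orient D k * ray_integral D (2 * k) f)"

definition cauchy_Sigma :: "nat \<Rightarrow> (complex \<Rightarrow> complex) \<Rightarrow> complex \<Rightarrow> complex" where
  "cauchy_Sigma D f z = 1 / (2 * of_real pi * \<i>) * Sigma_integral D (\<lambda>x. f x / (x - z))"

definition cauchy_real :: "(complex \<Rightarrow> complex) \<Rightarrow> complex \<Rightarrow> complex" where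
  "cauchy_real f z = 1 / (2 * of_real pi * \<i>) * (LBINT x. f (of_real x) / (of_real x - z))"

definition weight_indices :: "nat \<Rightarrow> nat set" where
  "weight_indices D = {1..D - 1} - {D div 2}"

definition omega ::
  "nat \<Rightarrow> real poly \<Rightarrow> real \<Rightarrow> (nat \<Rightarrow> complex \<Rightarrow> complex) \<Rightarrow> nat \<Rightarrow> complex \<Rightarrow> complex" where
  "omega D V lam F j z =
     Yfun V lam F (2 * j) z * exp (- (cpoly V z / 2)) * indicator (Sigma_ray D j) z
     - beta D V lam F j * Yfun V lam F 0 z * exp (- (cpoly V z / 2)) * indicator (Sigma_ray D 0) z
     + kappa D V lam F j * Yfun V lam F D z * exp (- (cpoly V z / 2))
         * indicator (Sigma_ray D (D div 2)) z"

section \<open>The polynomials of the lower block row\<close>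

definition Xi :: "real poly \<Rightarrow> nat \<Rightarrow> complex poly \<Rightarrow> complex" where
  "Xi V k Q = (LBINT x. poly Q (of_real x) * of_real x ^ k * of_real (exp (- poly V x)))"

definition Theta ::
  "nat \<Rightarrow> real poly \<Rightarrow> real \<Rightarrow> (nat \<Rightarrow> complex \<Rightarrow> complex) \<Rightarrow> nat \<Rightarrow> complex poly \<Rightarrow> complex" where
  "Theta D V lam F j Q =
     1 / (2 * of_real pi * \<i>) *
       (- ray_integral D (2 * j) (\<lambda>z. Yfun V lam F (2 * j) z * exp (- (cpoly V z / 2)) * poly Q z)
        + beta D V lam F j
            * ray_integral D 0 (\<lambda>z. Yfun V lam F 0 z * exp (- (cpoly V z / 2)) * poly Q z)
        + kappa D V lam F j
            * ray_integral D D (\<lambda>z. Yfun V lam F D z * exp (- (cpoly V z / 2)) * poly Q z))"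

definition is_R_poly ::
  "nat \<Rightarrow> real poly \<Rightarrow> real \<Rightarrow> (nat \<Rightarrow> complex \<Rightarrow> complex) \<Rightarrow> nat \<Rightarrow> nat \<Rightarrow> complex poly \<Rightarrow> bool" where
  "is_R_poly D V lam F n s Q \<longleftrightarrow>
     degree Q \<le> n + D - 3 \<and>
     (\<forall>k<n. Xi V k Q = 0) \<and>
     (\<forall>j\<in>weight_indices D. Theta D V lam F j Q = (if j = s then 1 else 0))"

section \<open>The Riemann--Hilbert problem\<close>

text \<open>
  Matrices are indexed from \<open>0\<close>. \<open>slot D\<close> is the increasing bijection from the row and column
  indices \<open>2, \<dots>, D - 1\<close> of the last block onto \<open>weight_indices D\<close>.
\<close>

definition slot :: "nat \<Rightarrow> nat \<Rightarrow> nat" where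
  "slot D i = (if i \<le> D div 2 then i - 1 else i)"

definition jump_matrix ::
  "nat \<Rightarrow> real poly \<Rightarrow> real \<Rightarrow> (nat \<Rightarrow> complex \<Rightarrow> complex) \<Rightarrow> complex \<Rightarrow> complex mat" where
  "jump_matrix D V lam F x = Matrix.mat D D (\<lambda>(i, j).
     if i = j then 1
     else if i = 0 \<and> j = 1 then exp (- cpoly V x) * indicator \<real> x
     else if i = 0 then omega D V lam F (slot D j) x
     else 0)"

definition growth_matrix :: "nat \<Rightarrow> nat \<Rightarrow> complex \<Rightarrow> complex mat" where
  "growth_matrix D n z = Matrix.mat D D (\<lambda>(i, j).
     if i \<noteq> j then 0
     else if i = 0 then z ^ (n + D - 2)
     else if i = 1 then z powi (- int n)
     else z powi (-1))"

text \<open>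
  Non-tangential limits at the points of the \<open>k\<close>-th ray, from the left for \<open>s = 1\<close> and from the
  right for \<open>s = -1\<close>; \<open>tau\<close> is the oriented unit tangent, so \<open>z\<close> lies to the left of the
  line of the ray through \<open>x\<close> iff \<open>Im ((z - x) / tau) > 0\<close>, and \<open>c\<close> is the aperture of the cone
  of approach (a smaller \<open>c\<close> is a wider cone). The limits are required to be uniform for \<open>x\<close>
  in compact subsets of the ray without the origin. Limits that are merely pointwise in \<open>x\<close>
  would be compatible with essential singularities at points of the contour: if \<open>G\<close> is entire,
  vanishes at \<open>0\<close>, and tends to \<open>0\<close> at infinity outside a horizontal half-strip below the real
  axis, then \<open>G (1 / (z - 1))\<close> has non-tangential limits on the real line that are
  continuous and agree from both sides, and solutions of the jump problem would not be unique.
\<close>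

definition has_nontangential_values ::
  "nat \<Rightarrow> nat \<Rightarrow> real \<Rightarrow> (complex \<Rightarrow> complex) \<Rightarrow> (complex \<Rightarrow> complex) \<Rightarrow> bool" where
  "has_nontangential_values D k s f b \<longleftrightarrow>
     (let tau = orient D k * ray_dir D (2 * k) in
      \<forall>c K e. 0 < c \<and> c < 1 \<and> compact K \<and> K \<subseteq> Sigma_ray D k - {0} \<and> 0 < e \<longrightarrow>
        (\<exists>d>0. \<forall>x\<in>K. \<forall>z. 0 < cmod (z - x) \<and> cmod (z - x) < d \<and>
                          s * Im ((z - x) / tau) \<ge> c * cmod (z - x)
               \<longrightarrow> cmod (f z - b x) < e))"

definition solves_RHP ::
  "nat \<Rightarrow> real poly \<Rightarrow> real \<Rightarrow> (nat \<Rightarrow> complex \<Rightarrow> complex) \<Rightarrow> nat \<Rightarrow> (complex \<Rightarrow> complex mat) \<Rightarrow> bool" where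
  "solves_RHP D V lam F n A \<longleftrightarrow>
     (\<forall>z\<in>- Sigma_all D. A z \<in> carrier_mat D D) \<and>
     \<comment> \<open>analyticity\<close>
     (\<forall>i<D. \<forall>j<D. (\<lambda>z. A z $$ (i, j)) holomorphic_on - Sigma_all D) \<and>
     \<comment> \<open>continuous boundary values and jump\<close>
     (\<exists>Ap Am.
        (\<forall>x\<in>Sigma_all D - {0}. Ap x \<in> carrier_mat D D \<and> Am x \<in> carrier_mat D D) \<and>
        (\<forall>i<D. \<forall>j<D.
           continuous_on (Sigma_all D - {0}) (\<lambda>x. Ap x $$ (i, j)) \<and>
           continuous_on (Sigma_all D - {0}) (\<lambda>x. Am x $$ (i, j)) \<and>
           (\<forall>k<D.
              has_nontangential_values D k 1 (\<lambda>z. A z $$ (i, j)) (\<lambda>x. Ap x $$ (i, j)) \<and>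
              has_nontangential_values D k (-1) (\<lambda>z. A z $$ (i, j)) (\<lambda>x. Am x $$ (i, j)))) \<and>
        (\<forall>x\<in>Sigma_all D - {0}. Ap x = Am x * jump_matrix D V lam F x)) \<and>
     \<comment> \<open>boundedness near the origin\<close>
     (\<exists>d>0. \<exists>M. \<forall>z\<in>ball 0 d - Sigma_all D. \<forall>i<D. \<forall>j<D. cmod (A z $$ (i, j)) \<le> M) \<and>
     \<comment> \<open>normalisation at infinity\<close>
     (\<exists>E. (\<forall>i<D. \<forall>j<D. (\<lambda>z. E z $$ (i, j))
              \<in> O[inf at_infinity (principal (- Sigma_all D))](\<lambda>z. 1 / z)) \<and>
          (\<forall>\<^sub>F z in inf at_infinity (principal (- Sigma_all D)).
              E z \<in> carrier_mat D D \<and> A z = (1\<^sub>m D + E z) * growth_matrix D n z))"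

text \<open>
  Each row of the solution consists of a function \<open>q\<close>, the Cauchy transform over the real line of
  \<open>q\<close> times \<open>exp (- V)\<close>, and the Cauchy transforms over \<open>Sigma_all D\<close> of \<open>q\<close> times the weights.
\<close>

definition RHP_row ::
  "nat \<Rightarrow> real poly \<Rightarrow> real \<Rightarrow> (nat \<Rightarrow> complex \<Rightarrow> complex) \<Rightarrow> (complex \<Rightarrow> complex) \<Rightarrow> nat \<Rightarrow> complex \<Rightarrow> complex" where
  "RHP_row D V lam F q j z =
     (if j = 0 then q z
      else if j = 1 then cauchy_real (\<lambda>x. exp (- cpoly V x) * q x) z
      else cauchy_Sigma D (\<lambda>x. q x * omega D V lam F (slot D j) x) z)"

definition RHP_solution ::
  "nat \<Rightarrow> real \<Rightarrow> real poly \<Rightarrow> real \<Rightarrow> (nat \<Rightarrow> real poly) \<Rightarrow> (nat \<Rightarrow> complex \<Rightarrow> complex)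
     \<Rightarrow> (nat \<Rightarrow> complex poly) \<Rightarrow> nat \<Rightarrow> complex \<Rightarrow> complex mat" where
  "RHP_solution D g V lam P F R n z = Matrix.mat D D (\<lambda>(i, j).
     if i = 0 then RHP_row D V lam F (cpoly (dual_Psi D g V lam P n)) j z
     else if i = 1 then
       - (2 * of_real pi * \<i> * of_real lam)
           / of_real (nu D g lam (n - 1) * sobolev_h V lam P (n - 1))
         * RHP_row D V lam F (cpoly (dual_Psi D g V lam P (n - 1))) j z
     else RHP_row D V lam F (poly (R (slot D i))) j z)"

end

theory Submission
  imports Defs "HOL-Real_Asymp.Real_Asymp" "Jordan_Normal_Form.Determinant"
begin

text \<open>
  The jump matrix differs from the identity only in its first row, so the problem decouples into
  one problem for each row (lemma \<open>solves_RHP_imp_row\<close> and its converse). The first entry of a row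
  has no jump; with the growth condition it is a polynomial \<open>q\<close>. Every other entry has the jump
  \<open>q\<close> times a weight and vanishes at infinity, so it is the Cauchy transform of \<open>q\<close> times that
  weight. The normalisation at infinity then becomes a set of conditions on \<open>q\<close>: expanding
  \<open>1 / (x - z)\<close> in powers of \<open>1 / z\<close>, it bounds the degree of \<open>q\<close> by \<open>n + D - 2\<close>, fixes its
  coefficient of that degree, and prescribes the moments \<open>\<Xi>\<^sub>k(q)\<close> for \<open>k < n\<close> and the numbers \<open>\<Theta>\<^sub>j(q)\<close>.

  For existence, write \<open>L f = V' f' - f'' + f / \<lambda>\<close>. On a ray of the contour the weight is,
  up to a constant, \<open>exp (-V) F\<close> with \<open>L F = 0\<close>, and \<open>exp (-V) F L p\<close> is an exact derivative for every polynomial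
  \<open>p\<close>. Hence the ray integrals of the weight against \<open>\<Psi>\<^sub>n = \<nu>\<^sub>n L P\<^sub>n\<close> are boundary terms at the
  origin, bilinear in the Cauchy data of \<open>p\<close> and of the \<open>Y\<^sub>2\<^sub>j\<close>. The numbers \<open>\<beta>\<^sub>j\<close> and \<open>\<kappa>\<^sub>j\<close> are the
  coefficients in \<open>Y\<^sub>2\<^sub>j = \<beta>\<^sub>j Y\<^sub>0 + \<kappa>\<^sub>j Y\<^sub>D\<close>, so the three boundary terms in \<open>\<Theta>\<^sub>j(\<Psi>\<^sub>n)\<close> cancel
  (lemma \<open>Theta_dual\<close>); the same relation makes the densities on the three rays balance at the
  origin, where the Cauchy transforms therefore have no logarithm. Integration by parts on the real
  line turns the moments of \<open>\<Psi>\<^sub>n\<close> into Sobolev inner products with \<open>P\<^sub>n\<close> (lemma \<open>Xi_dual\<close>), which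
  gives the conditions for the first two rows. The remaining rows satisfy theirs by the definition
  of the polynomials \<open>R\<^sub>n\<close>.

  That \<open>W[Y\<^sub>0, Y\<^sub>D]\<close> does not vanish comes from the identity
  \<open>(exp (-V) F' F\<^sup>*)' = exp (-V) (|F|\<^sup>2 / \<lambda> + |F'|\<^sup>2)\<close> on the real line, \<open>F\<^sup>*\<close> being the complex
  conjugate: the real part of \<open>exp (-V) F' F\<^sup>*\<close> increases, and it tends to \<open>0\<close> at \<open>+\<infinity>\<close> for
  \<open>F = F\<^sub>0\<close> and at \<open>-\<infinity>\<close> for \<open>F = F\<^sub>D\<close>. So the logarithmic derivatives of \<open>F\<^sub>0\<close> and \<open>F\<^sub>D\<close> at
  the origin have real parts of opposite sign, and the two solutions are not proportional.

  For uniqueness, a row of the difference of two solutions comes from a polynomial of degree at most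
  \<open>n + D - 3\<close> annihilated by \<open>n + D - 2\<close> functionals. On \<open>\<Psi>\<^sub>0, \<dots>, \<Psi>\<^sub>n\<^sub>-\<^sub>1\<close> and the \<open>R\<^sub>n\<close> these
  functionals form a triangular matrix with nonzero diagonal, so the polynomial is \<open>0\<close>
  (lemma \<open>moments_determine_polynomial\<close>).

  The analytic part concerns Cauchy integrals over a ray of a density that is entire and, together
  with its derivative, decays rapidly along that ray. Entire densities make the boundary values
  explicit: near the ray such an integral is a continuous function plus the density times a
  logarithm.
\<close>

section \<open>Entire functions that decay along a ray\<close>

text \<open>Decay faster than every power of \<open>t\<close> is asked for only on the ray through \<open>d\<close>: solutions of the
  differential equation may grow in other directions.\<close>

definition decays :: "complex \<Rightarrow> (complex \<Rightarrow> complex) \<Rightarrow> bool" where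
  "decays d f \<longleftrightarrow> (\<forall>m. \<exists>M. \<forall>t\<ge>0. t ^ m * cmod (f (of_real t * d)) \<le> M)"

lemma decaysE:
  assumes "decays d f"
  obtains M where "M \<ge> 0" "\<And>t. t \<ge> 0 \<Longrightarrow> t ^ m * cmod (f (of_real t * d)) \<le> M"
proof -
  obtain M where M: "\<And>t. t \<ge> 0 \<Longrightarrow> t ^ m * cmod (f (of_real t * d)) \<le> M"
    using assms unfolding decays_def by blast
  have "M \<ge> 0" using M[of 0] by (rule order_trans[rotated]) auto
  then show ?thesis using that M by blast
qed

lemma decays_zero: "decays d (\<lambda>z. 0)"
  unfolding decays_def by auto

lemma decays_add:
  assumes "decays d f" "decays d g" shows "decays d (\<lambda>z. f z + g z)"
  unfolding decays_def
proof
  fix m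
  obtain M where M: "M \<ge> 0" "\<And>t. t \<ge> 0 \<Longrightarrow> t ^ m * cmod (f (of_real t * d)) \<le> M" using decaysE[OF assms(1)] by metis
  obtain N where N: "N \<ge> 0" "\<And>t. t \<ge> 0 \<Longrightarrow> t ^ m * cmod (g (of_real t * d)) \<le> N" using decaysE[OF assms(2)] by metis
  have "t ^ m * cmod (f (of_real t * d) + g (of_real t * d)) \<le> M + N" if t: "t \<ge> 0" for t
  proof -
    have "t ^ m * cmod (f (of_real t * d) + g (of_real t * d))
      \<le> t ^ m * (cmod (f (of_real t * d)) + cmod (g (of_real t * d)))"
      using t by (intro mult_left_mono norm_triangle_ineq) auto
    also have "\<dots> \<le> M + N" using M(2)[OF t] N(2)[OF t] by (simp add: distrib_left)
    finally show ?thesis .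
  qed
  then show "\<exists>M. \<forall>t\<ge>0. t ^ m * cmod (f (of_real t * d) + g (of_real t * d)) \<le> M" by blast
qed

lemma decays_bounded_mult:
  assumes "decays d f" "\<And>t. t \<ge> 0 \<Longrightarrow> cmod (u (of_real t * d)) \<le> C"
  shows "decays d (\<lambda>z. u z * f z)"
  unfolding decays_def
proof
  fix m
  obtain M where M: "M \<ge> 0" "\<And>t. t \<ge> 0 \<Longrightarrow> t ^ m * cmod (f (of_real t * d)) \<le> M" using decaysE[OF assms(1)] by metis
  have "t ^ m * cmod (u (of_real t * d) * f (of_real t * d)) \<le> C * M" if t: "t \<ge> 0" for t
  proof -
    have "t ^ m * cmod (u (of_real t * d) * f (of_real t * d)) = cmod (u (of_real t * d)) * (t ^ m * cmod (f (of_real t * d)))"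
      by (simp add: norm_mult)
    also have "\<dots> \<le> C * M"
      using assms(2)[OF t] M(2)[OF t] t order_trans[OF norm_ge_zero assms(2)[OF t]] by (intro mult_mono) auto
    finally show ?thesis .
  qed
  then show "\<exists>M. \<forall>t\<ge>0. t ^ m * cmod (u (of_real t * d) * f (of_real t * d)) \<le> M" by blast
qed

lemma decays_cmult: "decays d f \<Longrightarrow> decays d (\<lambda>z. c * f z)"
  by (rule decays_bounded_mult[of d f "\<lambda>_. c"]) auto

lemma decays_times_z:
  assumes "decays d f" shows "decays d (\<lambda>z. z * f z)"
  unfolding decays_def
proof
  fix m
  obtain M where M: "M \<ge> 0" "\<And>t. t \<ge> 0 \<Longrightarrow> t ^ Suc m * cmod (f (of_real t * d)) \<le> M" using decaysE[OF assms(1)] by metis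
  have "t ^ m * cmod (of_real t * d * f (of_real t * d)) \<le> cmod d * M" if t: "t \<ge> 0" for t
    using mult_left_mono[OF M(2)[OF t], of "cmod d"] t by (simp add: norm_mult mult_ac)
  then show "\<exists>M. \<forall>t\<ge>0. t ^ m * cmod (of_real t * d * f (of_real t * d)) \<le> M" by blast
qed

lemma decays_poly:
  assumes "decays d f" shows "decays d (\<lambda>z. poly p z * f z)"
proof (induction p)
  case 0 show ?case by (simp add: decays_zero)
next
  case (pCons a p)
  have "decays d (\<lambda>z. a * f z + z * (poly p z * f z))"
    by (intro decays_add decays_cmult decays_times_z assms pCons)
  then show ?case by (simp add: algebra_simps)
qed

text \<open>The derivative is controlled on the ray as well because Cauchy integrals are bounded up to the
  contour by means of a Lipschitz bound for the density.\<close>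

definition rapid :: "complex \<Rightarrow> (complex \<Rightarrow> complex) \<Rightarrow> bool" where
  "rapid d f \<longleftrightarrow> f holomorphic_on UNIV \<and> decays d f \<and> decays d (deriv f)"

lemma rapidI:
  assumes "\<And>z. (f has_field_derivative f' z) (at z)" "decays d f" "decays d f'"
  shows "rapid d f"
proof -
  have "deriv f = f'" using assms(1) DERIV_imp_deriv by blast
  then show ?thesis unfolding rapid_def using assms
    by (auto simp: holomorphic_on_def field_differentiable_def intro: has_field_derivative_at_within)
qed

lemma rapid_holo: "rapid d f \<Longrightarrow> f holomorphic_on S"
  unfolding rapid_def using holomorphic_on_subset by blast

lemma rapid_DERIV: "rapid d f \<Longrightarrow> (f has_field_derivative deriv f z) (at z)"
  using rapid_holo[of d f UNIV] holomorphic_derivI[of f UNIV z] by auto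

lemma rapid_decays: "rapid d f \<Longrightarrow> decays d f" "rapid d f \<Longrightarrow> decays d (deriv f)"
  by (auto simp: rapid_def)

lemma rapid_zero: "rapid d (\<lambda>z. 0)"
  by (rule rapidI[of _ "\<lambda>z. 0"]) (auto simp: decays_zero)

lemma rapid_cmult:
  assumes "rapid d f" shows "rapid d (\<lambda>z. c * f z)"
  by (rule rapidI[of _ "\<lambda>z. c * deriv f z"])
     (intro DERIV_cmult rapid_DERIV[OF assms] decays_cmult rapid_decays assms)+

lemma rapid_poly:
  assumes "rapid d f" shows "rapid d (\<lambda>z. poly p z * f z)"
proof (rule rapidI)
  show "((\<lambda>z. poly p z * f z) has_field_derivative poly (pderiv p) z * f z + poly p z * deriv f z) (at z)" for z
    using DERIV_mult[OF poly_DERIV[of p z] rapid_DERIV[OF assms, of z]] by (simp add: mult.commute)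
qed (intro decays_add decays_poly rapid_decays assms)+

lemma rapid_times_z:
  assumes "rapid d f" shows "rapid d (\<lambda>z. z * f z)"
  using rapid_poly[OF assms, of "[:0, 1:]"] by simp

lemma decays_rotate: "decays d f \<Longrightarrow> decays 1 (\<lambda>z. f (d * z))"
  by (simp add: decays_def mult.commute)

text \<open>Reduces a ray in any direction to the half-line \<open>[0, \<infinity>)\<close>.\<close>

lemma rapid_rotate:
  assumes "rapid d f" shows "rapid 1 (\<lambda>z. f (d * z))"
proof (rule rapidI)
  show "((\<lambda>z. f (d * z)) has_field_derivative d * deriv f (d * z)) (at z)" for z
    using DERIV_chain2[OF rapid_DERIV[OF assms, of "d * z"] DERIV_cmult_Id[of d]] by (simp add: mult.commute)
qed (intro decays_cmult decays_rotate rapid_decays assms)+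

lemma rapid_dominated:
  assumes "rapid 1 h"
  obtains M where "M > 0" "\<And>t. t \<ge> 0 \<Longrightarrow> cmod (h (of_real t)) \<le> M / (1 + t)\<^sup>2"
    "\<And>t. t \<ge> 0 \<Longrightarrow> cmod (h (of_real t)) \<le> M"
    "\<And>t. t \<ge> 0 \<Longrightarrow> cmod (deriv h (of_real t)) \<le> M"
proof -
  obtain A where A: "A \<ge> 0" "\<And>t. t \<ge> 0 \<Longrightarrow> cmod (h (of_real t)) \<le> A"
    using decaysE[OF rapid_decays(1)[OF assms], of 0] by auto
  obtain A' where A': "A' \<ge> 0" "\<And>t. t \<ge> 0 \<Longrightarrow> cmod (deriv h (of_real t)) \<le> A'"
    using decaysE[OF rapid_decays(2)[OF assms], of 0] by auto
  obtain B where B: "B \<ge> 0" "\<And>t. t \<ge> 0 \<Longrightarrow> t^1 * cmod (h (of_real t)) \<le> B"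
    using decaysE[OF rapid_decays(1)[OF assms], of 1] by (metis mult.right_neutral)
  obtain C where C: "C \<ge> 0" "\<And>t. t \<ge> 0 \<Longrightarrow> t^2 * cmod (h (of_real t)) \<le> C"
    using decaysE[OF rapid_decays(1)[OF assms], of 2] by (metis mult.right_neutral)
  let ?M = "A + A' + 2 * B + C + 1"
  show ?thesis
  proof
    show "?M > 0" using A A' B C by linarith
    fix t :: real assume t: "t \<ge> 0"
    have "(1 + t)\<^sup>2 * cmod (h (of_real t)) = cmod (h (of_real t)) + 2 * (t^1 * cmod (h (of_real t))) + t^2 * cmod (h (of_real t))"
      by (simp add: power2_eq_square algebra_simps)
    also have "\<dots> \<le> ?M" using A(2)[OF t] A'(1) B(2)[OF t] C(2)[OF t] by linarith
    finally show "cmod (h (of_real t)) \<le> ?M / (1 + t)\<^sup>2"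
      using t by (simp add: pos_le_divide_eq mult.commute)
    show "cmod (h (of_real t)) \<le> ?M" "cmod (deriv h (of_real t)) \<le> ?M"
      using A(1) A(2)[OF t] A'(1) A'(2)[OF t] B(1) C(1) by linarith+
  qed
qed

lemma set_integrable_inverse_square: "set_integrable lborel {0..} (\<lambda>t::real. M / (1 + t)\<^sup>2)"
proof -
  have "set_integrable lborel (einterval 0 \<infinity>) (\<lambda>t::real. 1 / (1 + t)\<^sup>2)"
  proof (rule interval_integral_FTC_nonneg)
    show "((\<lambda>t. - (1 / (1 + t))) has_real_derivative 1 / (1 + x)\<^sup>2) (at x)" if "0 < ereal x" "ereal x < \<infinity>" for x
      using that by (auto intro!: derivative_eq_intros simp: power2_eq_square zero_ereal_def)
    show "isCont (\<lambda>t. 1 / (1 + t)\<^sup>2) x" if "0 < ereal x" "ereal x < \<infinity>" for x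
      using that by (auto intro!: continuous_intros simp: zero_ereal_def)
    show "(((\<lambda>t::real. - (1 / (1 + t))) \<circ> real_of_ereal) \<longlongrightarrow> -1) (at_right 0)"
      unfolding zero_ereal_def ereal_tendsto_simps by (auto intro!: tendsto_eq_intros)
    show "(((\<lambda>t::real. - (1 / (1 + t))) \<circ> real_of_ereal) \<longlongrightarrow> 0) (at_left \<infinity>)"
      unfolding ereal_tendsto_simps by real_asymp
  qed auto
  then have "set_integrable lborel {0<..} (\<lambda>t::real. 1 / (1 + t)\<^sup>2)"
    by (simp add: zero_ereal_def einterval_eq)
  then have *: "set_integrable lborel {0<..} (\<lambda>t::real. M * (1 / (1 + t)\<^sup>2))"
    by (rule set_integrable_mult_right)
  have "integrable lborel (\<lambda>t::real. indicator {0..} t *\<^sub>R (M * (1 / (1 + t)\<^sup>2)))"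
    using *[unfolded set_integrable_def]
  proof (rule integrable_cong_AE_imp)
    show "AE t in lborel. indicator {0<..} t *\<^sub>R (M * (1 / (1 + t)\<^sup>2)) =
        indicator {0..} t *\<^sub>R (M * (1 / (1 + t)\<^sup>2))"
      using AE_lborel_singleton[of "0::real"] by eventually_elim (auto simp: indicator_def)
  qed measurable
  then show ?thesis by (simp add: set_integrable_def)
qed

section \<open>Cauchy integrals over a half-line\<close>

text \<open>The factor \<open>1 / (2 \<pi> i)\<close> is left to \<open>contour_cauchy\<close>.\<close>

definition cauchy_on :: "real set \<Rightarrow> (complex \<Rightarrow> complex) \<Rightarrow> complex \<Rightarrow> complex" where
  "cauchy_on A h z = (LBINT t:A. h (of_real t) / (of_real t - z))"

definition decay_mass :: real where
  "decay_mass = (LBINT t:{0..}. 1 / (1 + t)\<^sup>2)"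

text \<open>\<open>1 / (1 + t)\<^sup>2\<close> is the common majorant of all integrands over the half-line.\<close>

lemma set_integral_dominated:
  fixes f :: "real \<Rightarrow> complex"
  assumes A: "A \<in> sets borel" "A \<subseteq> {0..}" and f: "f \<in> borel_measurable borel"
    and bd: "\<And>t. t \<in> A \<Longrightarrow> cmod (f t) \<le> C / (1 + t)\<^sup>2"
  shows "set_integrable lborel A f" "cmod (LBINT t:A. f t) \<le> \<bar>C\<bar> * decay_mass"
proof -
  have C: "set_integrable lborel A (\<lambda>t::real. C / (1 + t)\<^sup>2)" for C
    by (rule set_integrable_subset[OF set_integrable_inverse_square]) (use A in auto)
  show I: "set_integrable lborel A f"
  proof (rule set_integrable_bound[OF C[of C]])
    show "set_borel_measurable lborel A f"
      unfolding set_borel_measurable_def using A(1) f by measurable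
    show "AE t\<in>A in lborel. cmod (f t) \<le> norm (C / (1 + t)\<^sup>2)"
      using bd by (intro AE_I2) (metis abs_ge_self order_trans real_norm_def)
  qed
  have "cmod (LBINT t:A. f t) \<le> (LBINT t:A. cmod (f t))"
    by (rule set_integral_norm_bound[OF I])
  also have "\<dots> \<le> (LBINT t:A. \<bar>C\<bar> / (1 + t)\<^sup>2)"
  proof (rule set_integral_mono)
    show "set_integrable lborel A (\<lambda>t. cmod (f t))" using I by (rule set_integrable_norm)
    show "cmod (f t) \<le> \<bar>C\<bar> / (1 + t)\<^sup>2" if "t \<in> A" for t
      using bd[OF that] by (rule order_trans) (auto intro!: divide_right_mono)
  qed (rule C)
  also have "\<dots> \<le> (LBINT t:{0..}. \<bar>C\<bar> / (1 + t)\<^sup>2)"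
    unfolding set_lebesgue_integral_def
    by (rule integral_mono[OF C[unfolded set_integrable_def] set_integrable_inverse_square[unfolded set_integrable_def]])
       (use A(2) in \<open>auto simp: indicator_def\<close>)
  also have "\<dots> = (LBINT t:{0..}. \<bar>C\<bar> * (1 / (1 + t)\<^sup>2))" by simp
  also have "\<dots> = \<bar>C\<bar> * decay_mass" unfolding decay_mass_def by (rule set_integral_mult_right)
  finally show "cmod (LBINT t:A. f t) \<le> \<bar>C\<bar> * decay_mass" .
qed

lemma rapid_measurable:
  assumes "rapid d h" shows "(\<lambda>t::real. h (of_real t * e)) \<in> borel_measurable borel"
proof -
  have "continuous_on UNIV (\<lambda>t::real. h (of_real t * e))"
    by (rule continuous_on_compose2[OF holomorphic_on_imp_continuous_on[OF rapid_holo[OF assms]]])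
       (auto intro!: continuous_intros)
  then show ?thesis by (rule borel_measurable_continuous_onI)
qed

lemma rapid_measurable1: "rapid d h \<Longrightarrow> (\<lambda>t::real. h (of_real t)) \<in> borel_measurable borel"
  using rapid_measurable[of d h 1] by simp

lemma cauchy_on_integrable:
  assumes h: "rapid 1 h" and A: "A \<in> sets borel" "A \<subseteq> {0..}"
    and \<delta>: "\<delta> > 0" "\<And>t. t \<in> A \<Longrightarrow> cmod (of_real t - z) \<ge> \<delta>"
  shows "set_integrable lborel A (\<lambda>t. h (of_real t) / (of_real t - z))"
proof -
  obtain M where M: "M > 0" "\<And>t. t \<ge> 0 \<Longrightarrow> cmod (h (of_real t)) \<le> M / (1 + t)\<^sup>2"
    using rapid_dominated[OF h] by metis
  show ?thesis
  proof (rule set_integral_dominated(1)[OF A, where C = "M / \<delta>"])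
    show "(\<lambda>t::real. h (of_real t) / (of_real t - z)) \<in> borel_measurable borel"
      using rapid_measurable1[OF h] by measurable
    fix t assume t: "t \<in> A"
    have "cmod (h (of_real t)) / cmod (of_real t - z) \<le> (M / (1 + t)\<^sup>2) / \<delta>"
      using M t A(2) \<delta> by (intro frac_le) auto
    then show "cmod (h (of_real t) / (of_real t - z)) \<le> M / \<delta> / (1 + t)\<^sup>2"
      by (simp add: norm_divide mult.commute)
  qed
qed

lemma half_line_separation:
  assumes "\<not> (Im z = 0 \<and> T \<le> Re z)"
  obtains \<delta> where "\<delta> > 0" "\<And>t. t \<ge> T \<Longrightarrow> cmod (of_real t - z) \<ge> \<delta>"
proof (cases "Im z = 0")
  case False
  show ?thesis
  proof (rule that[of "\<bar>Im z\<bar>"])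
    show "cmod (of_real t - z) \<ge> \<bar>Im z\<bar>" for t using abs_Im_le_cmod[of "of_real t - z"] by simp
  qed (use False in auto)
next
  case True
  show ?thesis
  proof (rule that[of "T - Re z"])
    show "cmod (of_real t - z) \<ge> T - Re z" if "t \<ge> T" for t
      using abs_Re_le_cmod[of "of_real t - z"] that by simp
  qed (use True assms in auto)
qed

text \<open>Differentiation under the integral sign: the error of the difference quotient at \<open>z\<close> is
  \<open>y - z\<close> times the integral of \<open>h / ((t - z)\<^sup>2 (t - y))\<close>, which stays bounded as long as
  \<open>y\<close> keeps away from the half-line.\<close>

lemma cauchy_on_holomorphic:
  assumes h: "rapid 1 h" and A: "A \<in> sets borel" "A \<subseteq> {T..}" and T: "T \<ge> 0"
  shows "cauchy_on A h holomorphic_on - {z. Im z = 0 \<and> T \<le> Re z}"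
proof -
  have A0: "A \<subseteq> {0..}" using A(2) T by auto
  obtain M where M: "M > 0" "\<And>t. t \<ge> 0 \<Longrightarrow> cmod (h (of_real t)) \<le> M / (1 + t)\<^sup>2"
    using rapid_dominated[OF h] by metis
  have "cauchy_on A h field_differentiable at z" if z: "\<not> (Im z = 0 \<and> T \<le> Re z)" for z
  proof -
    obtain \<delta>' where \<delta>': "\<delta>' > 0" "\<And>t. t \<ge> T \<Longrightarrow> cmod (of_real t - z) \<ge> \<delta>'"
      using half_line_separation[OF z] by metis
    define \<delta> where "\<delta> = \<delta>' / 2"
    have \<delta>: "\<delta> > 0" "\<And>t. t \<in> A \<Longrightarrow> cmod (of_real t - z) \<ge> \<delta>" "\<And>t. t \<in> A \<Longrightarrow> cmod (of_real t - z) \<ge> 2 * \<delta>"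
      using \<delta>' A(2) unfolding \<delta>_def by force+
    have \<delta>y: "cmod (of_real t - y) \<ge> \<delta>" if "t \<in> A" "dist y z < \<delta>" for t y
      using \<delta>(3)[OF that(1)] that(2) norm_triangle_ineq[of "of_real t - y" "y - z"] by (simp add: dist_norm)
    define D where "D = (LBINT t:A. h (of_real t) / (of_real t - z)\<^sup>2)"
    define E where "E = M / \<delta> ^ 3"
    have meas: "(\<lambda>t::real. h (of_real t) / (of_real t - z)\<^sup>2) \<in> borel_measurable borel"
      "(\<lambda>t::real. h (of_real t) / ((of_real t - z)\<^sup>2 * (of_real t - y))) \<in> borel_measurable borel" for y
      using rapid_measurable1[OF h] by measurable
    have intD: "set_integrable lborel A (\<lambda>t. h (of_real t) / (of_real t - z)\<^sup>2)"
    proof (rule set_integral_dominated(1)[OF A(1) A0 meas(1), where C = "M / \<delta>^2"])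
      fix t assume t: "t \<in> A"
      have "cmod (h (of_real t)) / cmod (of_real t - z)^2 \<le> (M / (1 + t)\<^sup>2) / \<delta>^2"
        using M t A0 \<delta> by (intro frac_le power_mono) auto
      then show "cmod (h (of_real t) / (of_real t - z)\<^sup>2) \<le> M / \<delta>^2 / (1 + t)\<^sup>2"
        by (simp add: norm_divide norm_power mult.commute)
    qed
    have est: "cmod ((cauchy_on A h y - cauchy_on A h z) / (y - z) - D) \<le> \<bar>E\<bar> * decay_mass * cmod (y - z)"
      if y: "dist y z < \<delta>" "y \<noteq> z" for y
    proof -
      have bd: "cmod (h (of_real t) / ((of_real t - z)\<^sup>2 * (of_real t - y))) \<le> E / (1 + t)\<^sup>2" if t: "t \<in> A" for t
      proof -
        have "cmod (h (of_real t)) / (cmod (of_real t - z)^2 * cmod (of_real t - y)) \<le> (M / (1 + t)\<^sup>2) / (\<delta>^2 * \<delta>)"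
          using M t A0 \<delta> \<delta>y[OF t y(1)] by (intro frac_le mult_mono power_mono mult_pos_pos) auto
        then show ?thesis by (simp add: E_def norm_divide norm_mult norm_power mult.commute power3_eq_cube power2_eq_square mult.left_commute)
      qed
      note R = set_integral_dominated[OF A(1) A0 meas(2) bd]
      have I: "set_integrable lborel A (\<lambda>t. h (of_real t) / (of_real t - y))"
        "set_integrable lborel A (\<lambda>t. h (of_real t) / (of_real t - z))"
        using cauchy_on_integrable[OF h A(1) A0 \<delta>(1)] \<delta>(2) \<delta>y[OF _ y(1)] by auto
      have "cauchy_on A h y - cauchy_on A h z - (y - z) * D
          = (LBINT t:A. h (of_real t) / (of_real t - y) - h (of_real t) / (of_real t - z)
              - (y - z) * (h (of_real t) / (of_real t - z)\<^sup>2))"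
        unfolding cauchy_on_def D_def
        by (simp only: set_integral_mult_right[symmetric] set_integral_diff set_integrable_mult_right I intD)
      also have "\<dots> = (LBINT t:A. (y - z)^2 * (h (of_real t) / ((of_real t - z)\<^sup>2 * (of_real t - y))))"
      proof (rule set_lebesgue_integral_cong)
        show "\<forall>t. t \<in> A \<longrightarrow> h (of_real t) / (of_real t - y) - h (of_real t) / (of_real t - z)
              - (y - z) * (h (of_real t) / (of_real t - z)\<^sup>2)
            = (y - z)^2 * (h (of_real t) / ((of_real t - z)\<^sup>2 * (of_real t - y)))"
        proof (intro allI impI)
          fix t assume t: "t \<in> A"
          have "of_real t - y \<noteq> 0" "of_real t - z \<noteq> 0" using \<delta>(1) \<delta>(2)[OF t] \<delta>y[OF t y(1)] by auto
          then have "a / (of_real t - y) - a / (of_real t - z) - (y - z) * (a / (of_real t - z)\<^sup>2)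
            = (y - z)^2 * (a / ((of_real t - z)\<^sup>2 * (of_real t - y)))" for a
            by (simp add: divide_simps power2_eq_square) (simp add: algebra_simps)
          then show "h (of_real t) / (of_real t - y) - h (of_real t) / (of_real t - z)
              - (y - z) * (h (of_real t) / (of_real t - z)\<^sup>2)
            = (y - z)^2 * (h (of_real t) / ((of_real t - z)\<^sup>2 * (of_real t - y)))" .
        qed
      qed (use A in auto)
      also have "\<dots> = (y - z)^2 * (LBINT t:A. h (of_real t) / ((of_real t - z)\<^sup>2 * (of_real t - y)))"
        by (rule set_integral_mult_right)
      finally have eq: "(cauchy_on A h y - cauchy_on A h z) / (y - z) - D
         = (y - z) * (LBINT t:A. h (of_real t) / ((of_real t - z)\<^sup>2 * (of_real t - y)))"
        using y(2) by (simp add: field_simps power2_eq_square)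
      show ?thesis unfolding eq norm_mult using mult_left_mono[OF R(2), of "cmod (y - z)"] by (simp add: mult_ac)
    qed
    have "(cauchy_on A h has_field_derivative D) (at z)"
      unfolding has_field_derivative_iff
    proof (rule LIM_zero_cancel, rule Lim_null_comparison)
      show "\<forall>\<^sub>F y in at z. norm ((cauchy_on A h y - cauchy_on A h z) / (y - z) - D) \<le> \<bar>E\<bar> * decay_mass * cmod (y - z)"
        unfolding eventually_at using est \<delta>(1) by (intro exI[of _ \<delta>]) auto
      show "((\<lambda>y. \<bar>E\<bar> * decay_mass * cmod (y - z)) \<longlongrightarrow> 0) (at z)"
        by (auto intro!: tendsto_eq_intros)
    qed
    then show ?thesis using field_differentiable_def by blast
  qed
  then show ?thesis
    unfolding holomorphic_on_def by (auto intro: field_differentiable_at_within)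
qed

text \<open>The difference quotient of \<open>h\<close> between \<open>t\<close> and \<open>z\<close>, written as an average of \<open>h'\<close> over the
  segment: in this form it is continuous in both arguments without a case distinction on the
  diagonal.\<close>

definition sec_slope :: "(complex \<Rightarrow> complex) \<Rightarrow> real \<Rightarrow> complex \<Rightarrow> complex" where
  "sec_slope h t z = integral (cbox 0 1) (\<lambda>s::real. deriv h (z + of_real s * (of_real t - z)))"

lemma sec_slope_times:
  assumes "h holomorphic_on UNIV"
  shows "sec_slope h t z * (of_real t - z) = h (of_real t) - h z"
proof -
  have D: "(h has_field_derivative deriv h x) (at x)" for x
    using assms holomorphic_derivI[of h UNIV x] by auto
  have "((\<lambda>s::real. h (z + of_real s * (of_real t - z))) has_vector_derivative
      (of_real t - z) * deriv h (z + of_real s * (of_real t - z))) (at s within {0..1})" for s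
  proof -
    have "((\<lambda>s. z + of_real s * (of_real t - z)) has_vector_derivative (of_real t - z)) (at s within {0..1})"
      by (auto intro!: derivative_eq_intros simp: has_vector_derivative_def scaleR_conv_of_real)
    from field_vector_diff_chain_within[OF this has_field_derivative_at_within[OF D]]
    show ?thesis by (simp add: o_def)
  qed
  then have I: "((\<lambda>s::real. (of_real t - z) * deriv h (z + of_real s * (of_real t - z))) has_integral
      h (z + of_real 1 * (of_real t - z)) - h (z + of_real 0 * (of_real t - z))) {0..1}"
    by (intro fundamental_theorem_of_calculus) auto
  have *: "integral {0..1} (\<lambda>s::real. (of_real t - z) * deriv h (z + of_real s * (of_real t - z)))
     = h (of_real t) - h z" using integral_unique[OF I] by simp
  have "sec_slope h t z * (of_real t - z)
    = integral {0..1} (\<lambda>s::real. (of_real t - z) * deriv h (z + of_real s * (of_real t - z)))"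
    unfolding sec_slope_def by (simp add: integral_mult_right mult.commute)
  then show ?thesis unfolding * .
qed

lemma continuous_sec_slope:
  assumes "h holomorphic_on UNIV"
  shows "continuous_on UNIV (\<lambda>(z, t). sec_slope h t z)"
proof -
  have c: "continuous_on UNIV (deriv h)"
    using holomorphic_deriv[OF assms] holomorphic_on_imp_continuous_on by blast
  have "continuous_on (UNIV \<times> cbox 0 1) (\<lambda>(p, s::real). deriv h (fst p + of_real s * (of_real (snd p) - fst p)))"
    unfolding case_prod_unfold
    by (rule continuous_on_compose2[OF c]) (auto intro!: continuous_intros)
  from integral_continuous_on_param[OF this]
  show ?thesis unfolding sec_slope_def by (simp add: case_prod_unfold)
qed

lemma continuous_integral_sec_slope:
  assumes "h holomorphic_on UNIV"
  shows "continuous_on UNIV (\<lambda>z. integral (cbox a b) (\<lambda>t. sec_slope h t z))"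
  by (rule integral_continuous_on_param[OF continuous_on_subset[OF continuous_sec_slope[OF assms]]]) auto

text \<open>The branch is correct because \<open>1 - t / z\<close> meets the cut of \<open>Ln\<close> only if \<open>z\<close> lies on \<open>[0, t]\<close>.\<close>

lemma integral_cauchy_kernel:
  assumes z: "\<not> (Im z = 0 \<and> 0 \<le> Re z)" and T: "T \<ge> 0"
  shows "((\<lambda>t::real. 1 / (of_real t - z)) has_integral Ln (1 - of_real T / z)) {0..T}"
proof -
  have z0: "z \<noteq> 0" using z by auto
  have nn: "1 - of_real t / z \<notin> \<real>\<^sub>\<le>\<^sub>0" if t: "t \<in> {0..T}" for t
  proof
    assume "1 - of_real t / z \<in> \<real>\<^sub>\<le>\<^sub>0"
    then obtain r where r: "r \<le> 0" "1 - of_real t / z = of_real r" using nonpos_Reals_cases by auto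
    then have "of_real t = z * (1 - of_real r)" using z0 by (simp add: field_simps)
    then have "z = of_real t / of_real (1 - r)" using r(1)
      by (metis add_diff_cancel_left' diff_add_cancel diff_gt_0_iff_gt le_add_same_cancel1 less_numeral_extra(1) linorder_not_le nonzero_mult_div_cancel_right of_real_1 of_real_diff of_real_eq_0_iff)
    then have "z = of_real (t / (1 - r))" by simp
    then have "Im z = 0" "Re z = t / (1 - r)" by (simp_all only: Im_complex_of_real Re_complex_of_real)
    then show False using z t r(1) by auto
  qed
  have "((\<lambda>t::real. Ln (1 - of_real t / z)) has_vector_derivative 1 / (of_real t - z)) (at t within {0..T})"
    if t: "t \<in> {0..T}" for t
  proof -
    have ne: "of_real t - z \<noteq> 0" using z t by (auto simp: complex_eq_iff)
    have "((\<lambda>w. Ln (1 - w / z)) has_field_derivative (- (1 / z)) / (1 - of_real t / z)) (at (of_real t))"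
      using nn[OF t] z0 by (auto intro!: derivative_eq_intros simp: field_simps)
    moreover have "(- (1 / z)) / (1 - of_real t / z) = 1 / (of_real t - z)"
    proof -
      have "(1 - of_real t / z) \<noteq> 0" using ne z0 by (auto simp: field_simps)
      then show ?thesis using ne z0 by (auto simp: field_simps)
    qed
    ultimately have "((\<lambda>w. Ln (1 - w / z)) has_field_derivative 1 / (of_real t - z)) (at (of_real t))" by simp
    from has_vector_derivative_real_field[OF this]
    show ?thesis by (simp add: o_def)
  qed
  then have "((\<lambda>t::real. 1 / (of_real t - z)) has_integral (Ln (1 - of_real T / z) - Ln (1 - of_real 0 / z))) {0..T}"
    by (intro fundamental_theorem_of_calculus T) auto
  then show ?thesis by simp
qed

text \<open>What is left of the Cauchy integral of \<open>h\<close> after splitting off, on \<open>[0, T]\<close>, the integral of the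
  constant \<open>h z\<close>; it does not see the half-line inside the disc of radius \<open>T\<close>.\<close>

definition regular_part :: "real \<Rightarrow> (complex \<Rightarrow> complex) \<Rightarrow> complex \<Rightarrow> complex" where
  "regular_part T h z = integral (cbox 0 T) (\<lambda>t. sec_slope h t z) + cauchy_on {T<..} h z"

lemma continuous_regular_part:
  assumes "rapid 1 h" "T \<ge> 0"
  shows "continuous_on {z. cmod z < T} (regular_part T h)"
proof -
  have "continuous_on {z. cmod z < T} (cauchy_on {T<..} h)"
  proof (rule continuous_on_subset[OF holomorphic_on_imp_continuous_on[OF cauchy_on_holomorphic[OF assms(1) _ _ assms(2)]]])
    show "{z. cmod z < T} \<subseteq> - {z. Im z = 0 \<and> T \<le> Re z}"
      using complex_Re_le_cmod order_trans leD by blast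
  qed auto
  moreover have "continuous_on {z. cmod z < T} (\<lambda>z. integral (cbox 0 T) (\<lambda>t. sec_slope h t z))"
    using continuous_integral_sec_slope[OF rapid_holo[OF assms(1)]] continuous_on_subset by blast
  ultimately show ?thesis unfolding regular_part_def[abs_def] by (intro continuous_intros) auto
qed

text \<open>Writing \<open>h t = h z + (h t - h z)\<close> under the integral sign over \<open>[0, T]\<close> concentrates the jump in
  an explicit logarithm.\<close>

lemma cauchy_on_decompose:
  assumes h: "rapid 1 h" and T: "T \<ge> 0" and z: "\<not> (Im z = 0 \<and> 0 \<le> Re z)"
  shows "cauchy_on {0..} h z = regular_part T h z + h z * Ln (1 - of_real T / z)"
proof -
  obtain \<delta> where \<delta>: "\<delta> > 0" "\<And>t. t \<ge> 0 \<Longrightarrow> cmod (of_real t - z) \<ge> \<delta>"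
    using half_line_separation[OF z] by metis
  have I: "set_integrable lborel A (\<lambda>t. h (of_real t) / (of_real t - z))"
    if "A \<in> sets borel" "A \<subseteq> {0..}" for A
    using cauchy_on_integrable[OF h that \<delta>(1)] \<delta>(2) that(2) by blast
  have "{0..} = {0..T} \<union> {T<..}" using T by auto
  then have "cauchy_on {0..} h z = (LBINT t:{0..T}. h (of_real t) / (of_real t - z)) + cauchy_on {T<..} h z"
    unfolding cauchy_on_def using T by (simp only:) (intro set_integral_Un I, auto)
  also have "(LBINT t:{0..T}. h (of_real t) / (of_real t - z)) = integral {0..T} (\<lambda>t. h (of_real t) / (of_real t - z))"
    by (rule set_borel_integral_eq_integral) (intro I, auto)
  also have "\<dots> = integral {0..T} (\<lambda>t. sec_slope h t z + h z * (1 / (of_real t - z)))"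
  proof (rule Henstock_Kurzweil_Integration.integral_cong)
    fix t assume "t \<in> {0..T}"
    then have ne: "of_real t - z \<noteq> 0" using z by (auto simp: complex_eq_iff)
    have "h (of_real t) = sec_slope h t z * (of_real t - z) + h z"
      using sec_slope_times[OF rapid_holo[OF h], of t z] by simp
    then show "h (of_real t) / (of_real t - z) = sec_slope h t z + h z * (1 / (of_real t - z))"
      using ne by (simp add: field_simps)
  qed
  also have "\<dots> = integral {0..T} (\<lambda>t. sec_slope h t z) + integral {0..T} (\<lambda>t. h z * (1 / (of_real t - z)))"
  proof (rule Henstock_Kurzweil_Integration.integral_add)
    have "continuous_on {0..T} (\<lambda>t. sec_slope h t z)"
      using continuous_on_compose2[OF continuous_sec_slope[OF rapid_holo[OF h]], of "{0..T}" "\<lambda>t. (z, t)"]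
      by (simp add: continuous_intros)
    then show "(\<lambda>t. sec_slope h t z) integrable_on {0..T}" by (rule integrable_continuous_real)
    show "(\<lambda>t. h z * (1 / (of_real t - z))) integrable_on {0..T}"
      using has_integral_mult_right[OF integral_cauchy_kernel[OF z T], of "h z"] by blast
  qed
  also have "integral {0..T} (\<lambda>t. h z * (1 / (of_real t - z))) = h z * Ln (1 - of_real T / z)"
    using has_integral_mult_right[OF integral_cauchy_kernel[OF z T], of "h z"] by (rule integral_unique)
  finally show ?thesis unfolding regular_part_def by (simp add: add_ac)
qed

text \<open>To the right of the imaginary axis the logarithm splits into parts that are continuous across
  \<open>(0, T)\<close> and a constant that depends on the side.\<close>

lemma Ln_one_minus_quotient:
  assumes \<sigma>: "\<sigma> = 1 \<or> \<sigma> = - 1" and z: "0 < Re z" "cmod z < T" "\<sigma> * Im z > 0"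
  shows "Ln (1 - of_real T / z) = Ln (of_real T - z) - Ln z + of_real \<sigma> * \<i> * of_real pi"
proof (rule Ln_unique)
  have z0: "z \<noteq> 0" "of_real T - z \<noteq> 0" using z by auto
  have ReT: "Re (of_real T - z) > 0" using z(2) complex_Re_le_cmod[of z] by simp
  have e: "exp (of_real \<sigma> * \<i> * of_real pi) = -1"
    using \<sigma> exp_pi_i exp_pi_i' by (auto simp: mult.commute exp_minus)
  show "exp (Ln (of_real T - z) - Ln z + of_real \<sigma> * \<i> * of_real pi) = 1 - of_real T / z"
    unfolding exp_add exp_diff e using z0 by (simp add: field_simps)
  have 1: "\<bar>Im (Ln (of_real T - z))\<bar> < pi / 2" "\<bar>Im (Ln z)\<bar> < pi / 2"
    using Re_Ln_pos_lt z0 z(1) ReT by auto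
  show "- pi < Im (Ln (of_real T - z) - Ln z + of_real \<sigma> * \<i> * of_real pi)"
    and "Im (Ln (of_real T - z) - Ln z + of_real \<sigma> * \<i> * of_real pi) \<le> pi"
  proof -
    have "- pi < Im (Ln (of_real T - z) - Ln z + of_real \<sigma> * \<i> * of_real pi) \<and>
      Im (Ln (of_real T - z) - Ln z + of_real \<sigma> * \<i> * of_real pi) \<le> pi"
      using \<sigma>
    proof
      assume s: "\<sigma> = 1"
      then have "Im z > 0" "Im (of_real T - z) < 0" using z by auto
      then have "0 < Im (Ln z)" "Im (Ln (of_real T - z)) < 0"
        using Im_Ln_pos_lt[OF z0(1)] Im_Ln_pos_le[OF z0(2)] 1 by auto
      then show ?thesis using 1 s by auto
    next
      assume s: "\<sigma> = -1"
      then have "Im z < 0" "Im (of_real T - z) > 0" using z by auto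
      then have "Im (Ln z) < 0" "0 < Im (Ln (of_real T - z))"
        using Im_Ln_pos_lt[OF z0(2)] Im_Ln_pos_le[OF z0(1)] 1 by auto
      then show ?thesis using 1 s by auto
    qed
    then show "- pi < Im (Ln (of_real T - z) - Ln z + of_real \<sigma> * \<i> * of_real pi)"
     "Im (Ln (of_real T - z) - Ln z + of_real \<sigma> * \<i> * of_real pi) \<le> pi" by auto
  qed
qed

text \<open>A limit, so that one function serves all radii \<open>T\<close>; the functions \<open>half_ext T\<close> below compute it.\<close>

definition half_bdry :: "real \<Rightarrow> (complex \<Rightarrow> complex) \<Rightarrow> complex \<Rightarrow> complex" where
  "half_bdry \<sigma> h x = Lim (at x within {z. \<sigma> * Im z > 0}) (cauchy_on {0..} h)"

text \<open>Continuous continuation, from the side with sign \<open>\<sigma>\<close>, of the Cauchy integral across \<open>(0, T)\<close>.\<close>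

definition half_ext :: "real \<Rightarrow> real \<Rightarrow> (complex \<Rightarrow> complex) \<Rightarrow> complex \<Rightarrow> complex" where
  "half_ext T \<sigma> h z = regular_part T h z + h z * (Ln (of_real T - z) - Ln z + of_real \<sigma> * \<i> * of_real pi)"

lemma continuous_half_ext:
  assumes "rapid 1 h" "T > 0"
  shows "continuous_on {z. 0 < Re z \<and> cmod z < T} (half_ext T \<sigma> h)"
proof -
  have nn: "of_real T - z \<notin> \<real>\<^sub>\<le>\<^sub>0" "z \<notin> \<real>\<^sub>\<le>\<^sub>0" if "0 < Re z" "cmod z < T" for z
    using that complex_Re_le_cmod[of z] by (auto simp: complex_nonpos_Reals_iff)
  have "continuous_on {z. 0 < Re z \<and> cmod z < T} (regular_part T h)"
    using continuous_regular_part[OF assms(1), of T] assms(2) by (auto elim: continuous_on_subset)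
  then show ?thesis unfolding half_ext_def[abs_def]
    using nn by (intro continuous_intros holomorphic_on_imp_continuous_on[OF rapid_holo[OF assms(1)]]) auto
qed

lemma half_ext_off_axis:
  assumes "rapid 1 h" "\<sigma> = 1 \<or> \<sigma> = - 1" "0 < Re z" "cmod z < T" "\<sigma> * Im z > 0"
  shows "half_ext T \<sigma> h z = cauchy_on {0..} h z"
proof -
  have "Im z \<noteq> 0" "T \<ge> 0" using assms norm_ge_zero[of z] by (auto simp del: norm_ge_zero)
  then show ?thesis
    unfolding half_ext_def Ln_one_minus_quotient[OF assms(2-5), symmetric]
    by (subst cauchy_on_decompose[OF assms(1), of T]) auto
qed

lemma half_ext_on_axis:
  assumes h: "rapid 1 h" and \<sigma>: "\<sigma> = 1 \<or> \<sigma> = - 1" and x: "0 < Re x" "cmod x < T" "Im x = 0"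
  shows "half_ext T \<sigma> h x = half_bdry \<sigma> h x"
proof -
  have T: "T > 0" using x(2) norm_ge_zero[of x] by linarith
  let ?W = "{z. 0 < Re z \<and> cmod z < T}"
  have opW: "open ?W"
    unfolding Collect_conj_eq by (intro open_Int open_Collect_less continuous_intros)
  have "isCont (half_ext T \<sigma> h) x"
    using continuous_half_ext[OF h T] opW x by (auto simp: continuous_on_eq_continuous_at)
  then have "(half_ext T \<sigma> h \<longlongrightarrow> half_ext T \<sigma> h x) (at x within {z. \<sigma> * Im z > 0})"
    unfolding isCont_def using tendsto_within_subset by blast
  moreover have "\<forall>\<^sub>F z in at x within {z. \<sigma> * Im z > 0}. half_ext T \<sigma> h z = cauchy_on {0..} h z"
  proof -
    have "\<forall>\<^sub>F z in at x within {z. \<sigma> * Im z > 0}. z \<in> ?W \<inter> {z. \<sigma> * Im z > 0}"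
      using x by (auto simp: eventually_at_topological intro!: exI[of _ ?W] opW)
    then show ?thesis by eventually_elim (use half_ext_off_axis[OF h \<sigma>] in auto)
  qed
  ultimately have lim: "(cauchy_on {0..} h \<longlongrightarrow> half_ext T \<sigma> h x) (at x within {z. \<sigma> * Im z > 0})"
    using tendsto_cong by metis
  have "x islimpt {z. \<sigma> * Im z > 0}"
    unfolding islimpt_approachable
  proof (intro allI impI)
    fix e :: real assume e: "e > 0"
    have "cmod (x + of_real \<sigma> * \<i> * of_real (e / 2) - x) < e" using \<sigma> e by (auto simp: norm_mult)
    then show "\<exists>x'\<in>{z. \<sigma> * Im z > 0}. x' \<noteq> x \<and> dist x' x < e"
      using \<sigma> e x(3) by (intro bexI[of _ "x + of_real \<sigma> * \<i> * of_real (e / 2)"]) (auto simp: dist_norm)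
  qed
  then have "\<not> trivial_limit (at x within {z. \<sigma> * Im z > 0})"
    using trivial_limit_within by blast
  from tendsto_Lim[OF this lim] show ?thesis unfolding half_bdry_def by simp
qed

text \<open>The Sokhotski-Plemelj formula: only the constant \<open>\<sigma> i \<pi>\<close> in \<open>half_ext\<close> changes between the
  sides.\<close>

lemma half_bdry_jump:
  assumes "rapid 1 h" "0 < Re x" "Im x = 0"
  shows "half_bdry 1 h x - half_bdry (-1) h x = 2 * of_real pi * \<i> * h x"
proof -
  have eqs: "half_bdry 1 h x = half_ext (cmod x + 1) 1 h x" "half_bdry (-1) h x = half_ext (cmod x + 1) (-1) h x"
    using half_ext_on_axis[OF assms(1) _ assms(2)] assms(3) by auto
  show ?thesis unfolding eqs half_ext_def by (simp add: algebra_simps)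
qed

lemma rapid_lipschitz:
  assumes h: "rapid 1 h" and M: "\<And>t. t \<ge> 0 \<Longrightarrow> cmod (deriv h (of_real t)) \<le> M" and st: "s \<ge> 0" "t \<ge> 0"
  shows "cmod (h (of_real t) - h (of_real s)) \<le> M * \<bar>t - s\<bar>"
proof -
  have "cmod (h (of_real t) - h (of_real s)) \<le> M * cmod (of_real t - of_real s)"
  proof (rule field_differentiable_bound[where S = "of_real ` {0..}" and f' = "deriv h"])
    show "convex (of_real ` {0..} :: complex set)"
      by (rule convex_linear_image) (auto intro: bounded_linear.linear bounded_linear_of_real)
    show "\<And>z. z \<in> of_real ` {0..} \<Longrightarrow> (h has_field_derivative deriv h z) (at z within of_real ` {0..})"
      using rapid_DERIV[OF h] has_field_derivative_at_within by blast
  qed (use M st in auto)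
  then show ?thesis by (simp flip: of_real_diff)
qed

lemma has_integral_kernel_symmetric:
  assumes "Im z \<noteq> 0"
  shows "((\<lambda>t::real. 1 / (of_real t - z)) has_integral
     (Ln (of_real (Re z + 1) - z) - Ln (of_real (Re z - 1) - z))) {Re z - 1..Re z + 1}"
proof (rule fundamental_theorem_of_calculus)
  fix t :: real
  have "of_real t - z \<notin> \<real>\<^sub>\<le>\<^sub>0" using assms by (auto simp: complex_nonpos_Reals_iff)
  then have "((\<lambda>w. Ln (w - z)) has_field_derivative 1 / (of_real t - z)) (at (of_real t))"
    by (auto intro!: derivative_eq_intros simp: divide_inverse)
  from has_vector_derivative_real_field[OF this]
  show "((\<lambda>t::real. Ln (of_real t - z)) has_vector_derivative 1 / (of_real t - z)) (at t within {Re z - 1..Re z + 1})"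
    by (simp add: o_def)
qed auto

text \<open>The interval is symmetric about \<open>Re z\<close>, so both logarithms have the same real part.\<close>

lemma kernel_symmetric_bound:
  assumes "Im z \<noteq> 0"
  shows "cmod (Ln (of_real (Re z + 1) - z) - Ln (of_real (Re z - 1) - z)) \<le> 2 * pi"
proof -
  have e: "of_real (Re z + 1) - z = Complex 1 (- Im z)" "of_real (Re z - 1) - z = Complex (-1) (- Im z)"
    by (auto simp: complex_eq_iff)
  have nz: "Complex 1 (- Im z) \<noteq> 0" "Complex (-1) (- Im z) \<noteq> 0" by (auto simp: complex_eq_iff)
  have r: "Re (Ln (Complex 1 (- Im z)) - Ln (Complex (-1) (- Im z))) = 0"
    using nz by (simp add: Re_Ln cmod_def)
  have i: "\<bar>Im (Ln (Complex 1 (- Im z)) - Ln (Complex (-1) (- Im z)))\<bar> \<le> 2 * pi"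
    using mpi_less_Im_Ln[OF nz(1)] Im_Ln_le_pi[OF nz(1)] mpi_less_Im_Ln[OF nz(2)] Im_Ln_le_pi[OF nz(2)] by auto
  show ?thesis unfolding e
    using cmod_le[of "Ln (Complex 1 (- Im z)) - Ln (Complex (-1) (- Im z))"] r i by linarith
qed

text \<open>The bound must hold up to the half-line. Near it, \<open>h t\<close> is compared with \<open>h\<close> at the foot
  \<open>x = Re z\<close> of the perpendicular: the Lipschitz bound cancels the kernel, and the kernel itself has a
  bounded integral over \<open>[x - 1, x + 1]\<close>.\<close>

lemma cauchy_on_bounded_far:
  assumes h: "rapid 1 h"
  obtains M where "\<And>z. \<not> (Im z = 0 \<and> 0 \<le> Re z) \<Longrightarrow> cmod z \<ge> 2 \<Longrightarrow> cmod (cauchy_on {0..} h z) \<le> M"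
proof -
  obtain M where M: "M > 0" "\<And>t. t \<ge> 0 \<Longrightarrow> cmod (h (of_real t)) \<le> M / (1 + t)\<^sup>2"
    "\<And>t. t \<ge> 0 \<Longrightarrow> cmod (h (of_real t)) \<le> M"
    "\<And>t. t \<ge> 0 \<Longrightarrow> cmod (deriv h (of_real t)) \<le> M"
    using rapid_dominated[OF h] by metis
  have meas: "(\<lambda>t::real. h (of_real t) / (of_real t - z)) \<in> borel_measurable borel" for z
    using rapid_measurable1[OF h] by measurable
  \<comment> \<open>Where the half-line stays at distance at least \<open>1\<close> from \<open>z\<close>, the kernel is harmless.\<close>
  have far: "set_integrable lborel A (\<lambda>t. h (of_real t) / (of_real t - z))"
    "cmod (cauchy_on A h z) \<le> M * decay_mass"
    if A: "A \<in> sets borel" "A \<subseteq> {0..}" "\<And>t. t \<in> A \<Longrightarrow> cmod (of_real t - z) \<ge> 1" for A z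
  proof -
    have bd: "cmod (h (of_real t) / (of_real t - z)) \<le> M / (1 + t)\<^sup>2" if t: "t \<in> A" for t
    proof -
      have "cmod (h (of_real t)) / cmod (of_real t - z) \<le> (M / (1 + t)\<^sup>2) / 1"
        using M t A by (intro frac_le) auto
      then show ?thesis by (simp add: norm_divide)
    qed
    from set_integral_dominated[OF A(1,2) meas bd]
    show "set_integrable lborel A (\<lambda>t. h (of_real t) / (of_real t - z))"
      "cmod (cauchy_on A h z) \<le> M * decay_mass" using M(1) unfolding cauchy_on_def by auto
  qed
  have "cmod (cauchy_on {0..} h z) \<le> M * decay_mass + (2 * M + M * (2 * pi))"
    if z: "\<not> (Im z = 0 \<and> 0 \<le> Re z)" "cmod z \<ge> 2" for z
  proof (cases "\<forall>t\<ge>0. cmod (of_real t - z) \<ge> 1")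
    case True
    then have "cmod (cauchy_on {0..} h z) \<le> M * decay_mass" using far(2)[of "{0..}" z] by auto
    moreover have "0 \<le> 2 * M + M * (2 * pi)" using M(1) by simp
    ultimately show ?thesis by linarith
  next
    case False
    then obtain t0 where t0: "t0 \<ge> 0" "cmod (of_real t0 - z) < 1" by auto
    define x where "x = Re z"
    have im: "\<bar>Im z\<bar> < 1" using t0(2) abs_Im_le_cmod[of "of_real t0 - z"] by simp
    have "\<bar>t0 - x\<bar> < 1" using t0(2) abs_Re_le_cmod[of "of_real t0 - z"] by (simp add: x_def)
    moreover have "2 \<le> \<bar>x\<bar> + \<bar>Im z\<bar>" using z(2) cmod_le[of z] by (simp add: x_def)
    ultimately have x1: "x > 1" using im t0(1) by linarith
    have im0: "Im z \<noteq> 0" using z(1) x1 by (auto simp: x_def)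
    obtain \<delta> where \<delta>: "\<delta> > 0" "\<And>t. t \<ge> 0 \<Longrightarrow> cmod (of_real t - z) \<ge> \<delta>"
      using half_line_separation[OF z(1)] by metis
    have I: "set_integrable lborel A (\<lambda>t. h (of_real t) / (of_real t - z))"
      if "A \<in> sets borel" "A \<subseteq> {0..}" for A
      using cauchy_on_integrable[OF h that \<delta>(1)] \<delta>(2) that(2) by blast
    \<comment> \<open>The part of the half-line near \<open>z\<close> and the rest; \<open>?N\<close> does not reach the end point as \<open>x > 1\<close>.\<close>
    let ?N = "{x - 1..x + 1}" and ?R = "{0..} - {x - 1..x + 1}"
    have N0: "?N \<subseteq> {0..}" using x1 by auto
    then have U: "{0..} = ?R \<union> ?N" by auto
    have "cauchy_on {0..} h z = cauchy_on ?R h z + cauchy_on ?N h z"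
      unfolding cauchy_on_def by (subst U, intro set_integral_Un I) (use N0 in auto)
    moreover have "cmod (cauchy_on ?R h z) \<le> M * decay_mass"
    proof (rule far(2))
      fix t assume "t \<in> ?R"
      then have "\<bar>t - x\<bar> \<ge> 1" by auto
      then show "cmod (of_real t - z) \<ge> 1" using abs_Re_le_cmod[of "of_real t - z"] by (simp add: x_def)
    qed auto
    moreover have "cmod (cauchy_on ?N h z) \<le> 2 * M + M * (2 * pi)"
    proof -
      let ?L = "Ln (of_real (x + 1) - z) - Ln (of_real (x - 1) - z)"
      have e1: "cauchy_on ?N h z = integral ?N (\<lambda>t. h (of_real t) / (of_real t - z))"
        and i1: "(\<lambda>t. h (of_real t) / (of_real t - z)) integrable_on ?N"
        unfolding cauchy_on_def using set_borel_integral_eq_integral[OF I[OF _ N0]] by auto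
      have k: "((\<lambda>t::real. h (of_real x) * (1 / (of_real t - z))) has_integral h (of_real x) * ?L) ?N"
        using has_integral_mult_right[OF has_integral_kernel_symmetric[OF im0]] unfolding x_def .
      have d: "((\<lambda>t. h (of_real t) / (of_real t - z) - h (of_real x) * (1 / (of_real t - z))) has_integral
         (cauchy_on ?N h z - h (of_real x) * ?L)) ?N"
        using has_integral_diff[OF integrable_integral[OF i1] k] unfolding e1 .
      have "cmod (cauchy_on ?N h z - h (of_real x) * ?L) \<le> M * measure lborel (cbox (x - 1) (x + 1))"
      proof (rule has_integral_bound)
        fix t assume t: "t \<in> cbox (x - 1) (x + 1)"
        have "cmod (h (of_real t) - h (of_real x)) \<le> M * \<bar>t - x\<bar>"
          using rapid_lipschitz[OF h M(4)] t x1 by auto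
        also have "\<dots> \<le> M * cmod (of_real t - z)"
          using abs_Re_le_cmod[of "of_real t - z"] M(1) by (intro mult_left_mono) (auto simp: x_def)
        finally have "cmod (h (of_real t) - h (of_real x)) / cmod (of_real t - z) \<le> M"
          using im0 by (subst pos_divide_le_eq) (auto simp: complex_eq_iff)
        then show "cmod (h (of_real t) / (of_real t - z) - h (of_real x) * (1 / (of_real t - z))) \<le> M"
          by (simp add: norm_divide flip: diff_divide_distrib)
      qed (use M(1) d in auto)
      then have "cmod (cauchy_on ?N h z - h (of_real x) * ?L) \<le> 2 * M" by simp
      moreover have "cmod (h (of_real x) * ?L) \<le> M * (2 * pi)"
        unfolding norm_mult using kernel_symmetric_bound[OF im0] M(1) M(3)[of x] x1
        by (intro mult_mono) (auto simp: x_def)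
      ultimately show ?thesis
        using norm_triangle_ineq[of "cauchy_on ?N h z - h (of_real x) * ?L" "h (of_real x) * ?L"] by simp
    qed
    ultimately show ?thesis
      using norm_triangle_ineq[of "cauchy_on ?R h z" "cauchy_on ?N h z"] by simp
  qed
  then show ?thesis using that by blast
qed

text \<open>The only singularity at the end point is logarithmic, with coefficient \<open>- h 0\<close>; it appears with
  \<open>ln (cmod z)\<close>, which is the same for all rays, so that it can cancel between them.\<close>

lemma cauchy_on_near_origin:
  assumes h: "rapid 1 h"
  obtains M where "\<And>z. \<not> (Im z = 0 \<and> 0 \<le> Re z) \<Longrightarrow> cmod z \<le> 1 / 2 \<Longrightarrow>
     cmod (cauchy_on {0..} h z + h 0 * of_real (ln (cmod z))) \<le> M"
proof -
  have "compact (regular_part 1 h ` cball 0 (1/2))"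
    by (rule compact_continuous_image[OF continuous_on_subset[OF continuous_regular_part[OF h, of 1]]]) auto
  then obtain A where A: "\<And>z. cmod z \<le> 1/2 \<Longrightarrow> cmod (regular_part 1 h z) \<le> A"
    using compact_imp_bounded[THEN bounded_iff[THEN iffD1]] by (metis imageI mem_cball_0)
  have "continuous_on (cball 0 (1/2)) (deriv h)"
    using holomorphic_on_imp_continuous_on[OF holomorphic_deriv[OF rapid_holo[OF h] open_UNIV]]
    continuous_on_subset by blast
  then have "compact (deriv h ` cball 0 (1/2))" by (rule compact_continuous_image) auto
  then obtain L where L: "\<And>z. cmod z \<le> 1/2 \<Longrightarrow> cmod (deriv h z) \<le> L"
    using compact_imp_bounded[THEN bounded_iff[THEN iffD1]] by (metis imageI mem_cball_0)
  have L0: "L \<ge> 0" using L[of 0] norm_ge_zero order_trans by (metis norm_zero zero_le_divide_1_iff zero_le_numeral)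
  have lip: "cmod (h z - h 0) \<le> L * cmod z" if "cmod z \<le> 1/2" for z
    using field_differentiable_bound[of "cball 0 (1/2)" h "deriv h" L z 0] L that
      has_field_derivative_at_within[OF rapid_DERIV[OF h]] by auto
  have "cmod (cauchy_on {0..} h z + h 0 * of_real (ln (cmod z)))
     \<le> A + (L * (ln 2 + 1 + pi) + cmod (h 0) * (ln 2 + pi))"
    if z: "\<not> (Im z = 0 \<and> 0 \<le> Re z)" "cmod z \<le> 1 / 2" for z
  proof -
    have z0: "z \<noteq> 0" using z(1) by auto
    then have zp: "cmod z > 0" by simp
    have z1: "cmod (z - 1) \<ge> 1/2" "cmod (z - 1) \<le> 2"
      using norm_triangle_ineq2[of 1 z] norm_triangle_ineq4[of z 1] z(2) by (auto simp: norm_minus_commute)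
    have zq: "1 - 1 / z = (z - 1) / z" "(z - 1) / z \<noteq> 0"
      using z0 z1 by (auto simp: field_simps)
    define l where "l = Ln (1 - of_real 1 / z)"
    have re: "Re l = ln (cmod (z - 1)) - ln (cmod z)"
      unfolding l_def of_real_1 zq(1) using zq(2) z0 z1(1) zp
      by (simp add: Re_Ln norm_divide ln_div)
    have im: "\<bar>Im l\<bar> \<le> pi"
      unfolding l_def of_real_1 zq(1) using mpi_less_Im_Ln[OF zq(2)] Im_Ln_le_pi[OF zq(2)] by auto
    have "ln (cmod (z - 1)) \<le> ln 2" using z1 by (subst ln_le_cancel_iff) auto
    moreover have "ln (1/2::real) \<le> ln (cmod (z - 1))" using z1 by (subst ln_le_cancel_iff) auto
    ultimately have ln1: "\<bar>ln (cmod (z - 1))\<bar> \<le> ln 2" by (simp add: ln_div)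
    have "cmod (l + of_real (ln (cmod z))) \<le> \<bar>Re l + ln (cmod z)\<bar> + \<bar>Im l\<bar>"
      using cmod_le[of "l + of_real (ln (cmod z))"] by simp
    also have "\<dots> \<le> ln 2 + pi" using re ln1 im by linarith
    finally have b1: "cmod (l + of_real (ln (cmod z))) \<le> ln 2 + pi" .
    have "ln (1 / cmod z) \<le> 1 / cmod z - 1" using zp by (intro ln_le_minus_one) auto
    then have "- ln (cmod z) * cmod z \<le> (1 / cmod z) * cmod z"
      using zp by (intro mult_right_mono) (auto simp: ln_div)
    then have zl: "- ln (cmod z) * cmod z \<le> 1" using zp by simp
    have "cmod l \<le> \<bar>Re l\<bar> + \<bar>Im l\<bar>" by (rule cmod_le)
    moreover have "ln (cmod z) < 0" using zp z(2) by (intro ln_less_zero) auto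
    ultimately have "cmod l \<le> (ln 2 + pi) - ln (cmod z)" using re ln1 im by linarith
    then have "cmod l * cmod z \<le> ((ln 2 + pi) - ln (cmod z)) * cmod z" by (intro mult_right_mono) auto
    also have "\<dots> = (ln 2 + pi) * cmod z + (- ln (cmod z) * cmod z)" by (simp add: algebra_simps)
    also have "\<dots> \<le> (ln 2 + pi) * 1 + 1" using zl z(2) by (intro add_mono mult_left_mono) auto
    finally have lz: "cmod l * cmod z \<le> ln 2 + 1 + pi" by simp
    have "cauchy_on {0..} h z + h 0 * of_real (ln (cmod z))
       = regular_part 1 h z + ((h z - h 0) * l + h 0 * (l + of_real (ln (cmod z))))"
      using cauchy_on_decompose[OF h, of 1 z] z(1) unfolding l_def by (simp add: algebra_simps)
    also have "cmod \<dots> \<le> A + (L * (ln 2 + 1 + pi) + cmod (h 0) * (ln 2 + pi))"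
    proof (intro norm_triangle_le add_mono)
      have "cmod (h z - h 0) * cmod l \<le> (L * cmod z) * cmod l"
        using lip[OF z(2)] by (rule mult_right_mono) auto
      also have "\<dots> = L * (cmod l * cmod z)" by simp
      also have "\<dots> \<le> L * (ln 2 + 1 + pi)" using lz L0 by (rule mult_left_mono)
      finally show "cmod ((h z - h 0) * l) \<le> L * (ln 2 + 1 + pi)" by (simp add: norm_mult)
    qed (use A[OF z(2)] b1 in \<open>auto simp: norm_mult intro: mult_left_mono\<close>)
    finally show ?thesis .
  qed
  then show ?thesis using that by blast
qed

section \<open>Rays, sectors and boundary values\<close>

lemma ray_dir_nz [simp]: "ray_dir D k \<noteq> 0"
  unfolding ray_dir_def by (simp add: cis_neq_zero)

lemma norm_ray_dir [simp]: "cmod (ray_dir D k) = 1"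
  unfolding ray_dir_def by simp

lemma orient_cases: "orient D k = 1 \<or> orient D k = -1"
  by (auto simp: orient_def)

text \<open>After rotation the ray is the half-line \<open>[0, \<infinity>)\<close>.\<close>

lemma mem_Sigma_ray:
  "z \<in> Sigma_ray D k \<longleftrightarrow> Im (z / ray_dir D (2 * k)) = 0 \<and> 0 \<le> Re (z / ray_dir D (2 * k))"
proof
  assume "z \<in> Sigma_ray D k"
  then show "Im (z / ray_dir D (2 * k)) = 0 \<and> 0 \<le> Re (z / ray_dir D (2 * k))"
    unfolding Sigma_ray_def by auto
next
  assume a: "Im (z / ray_dir D (2 * k)) = 0 \<and> 0 \<le> Re (z / ray_dir D (2 * k))"
  then have "z / ray_dir D (2 * k) = of_real (Re (z / ray_dir D (2 * k)))" by (simp add: complex_eq_iff)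
  then have "z = of_real (Re (z / ray_dir D (2 * k))) * ray_dir D (2 * k)"
    by (simp add: divide_eq_eq)
  then show "z \<in> Sigma_ray D k" unfolding Sigma_ray_def using a by blast
qed

lemma Sigma_ray_0 [simp]: "0 \<in> Sigma_ray D k"
  by (simp add: mem_Sigma_ray)

text \<open>An open cone about the \<open>k\<close>-th ray, bounded by the directions of the neighbouring rays.\<close>

definition sector :: "nat \<Rightarrow> nat \<Rightarrow> complex set" where
  "sector D k = {z. cos (2 * pi / real D) * cmod z < Re (z / ray_dir D (2 * k))}"

lemma open_sector: "open (sector D k)"
  unfolding sector_def by (intro open_Collect_less continuous_intros) auto

lemma sector_Re_pos:
  assumes "D \<ge> 4" "z \<in> sector D k" shows "0 < Re (z / ray_dir D (2 * k))"
proof -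
  have "2 * pi / real D \<le> pi / 2" using assms(1) by (auto simp: field_simps)
  moreover have "0 \<le> 2 * pi / real D" by simp
  then have "- (pi / 2) \<le> 2 * pi / real D" using pi_gt_zero by linarith
  ultimately have "0 \<le> cos (2 * pi / real D)" by (intro cos_ge_zero) auto
  then have "0 \<le> cos (2 * pi / real D) * cmod z" by simp
  with assms(2) show ?thesis unfolding sector_def by auto
qed

lemma ray_in_sector:
  assumes "D \<ge> 4" "x \<in> Sigma_ray D k" "x \<noteq> 0" shows "x \<in> sector D k"
proof -
  obtain t where t: "t \<ge> 0" "x = of_real t * ray_dir D (2 * k)" using assms(2) unfolding Sigma_ray_def by auto
  with assms(3) have "t > 0" by (cases "t = 0") auto
  have "cos (2 * pi / real D) < cos 0"
    using assms(1) by (intro cos_monotone_0_pi) (auto simp: field_simps)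
  then have "cos (2 * pi / real D) * t < t" using \<open>t > 0\<close> by simp
  then show ?thesis unfolding sector_def t(2) using \<open>t > 0\<close> by (simp add: norm_mult)
qed

text \<open>The angle between two distinct rays is at least \<open>2 \<pi> / D\<close>, measured either way round; hence the
  reflection \<open>i \<mapsto> D - i\<close> for angles beyond \<open>\<pi>\<close>.\<close>

lemma cos_ray_gap:
  assumes D: "D \<ge> 2" and i: "1 \<le> i" "i < D"
  shows "cos (2 * pi * real i / real D) \<le> cos (2 * pi / real D)"
proof (cases "2 * i \<le> D")
  case True
  then have "real (2 * i) \<le> real D" by (rule of_nat_mono)
  then show ?thesis using assms by (intro cos_monotone_0_pi_le) (auto simp: field_simps)
next
  case False
  have "cos (2 * pi * real i / real D) = cos (2 * pi - 2 * pi * real i / real D)"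
    by (simp add: cos_diff)
  also have "2 * pi - 2 * pi * real i / real D = 2 * pi * real (D - i) / real D"
    using i by (simp add: of_nat_diff field_simps)
  also have "cos \<dots> \<le> cos (2 * pi / real D)"
  proof (rule cos_monotone_0_pi_le)
    have "real (2 * (D - i)) \<le> real D" using False by (intro of_nat_mono) auto
    then have "2 * real (D - i) \<le> real D" by simp
    then show "2 * pi * real (D - i) / real D \<le> pi" using D by (simp add: field_simps)
    have "1 \<le> real (D - i)" using i by auto
    then show "2 * pi / real D \<le> 2 * pi * real (D - i) / real D" by (simp add: divide_right_mono)
  qed auto
  finally show ?thesis .
qed

lemma other_ray_not_in_sector:
  assumes D: "D \<ge> 2" and kl: "k < D" "l < D" "k \<noteq> l" and z: "z \<in> Sigma_ray D l"
  shows "z \<notin> sector D k"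
proof -
  obtain t where t: "t \<ge> 0" "z = of_real t * ray_dir D (2 * l)" using z unfolding Sigma_ray_def by auto
  have "ray_dir D (2 * l) / ray_dir D (2 * k) = cis (2 * pi * (real l - real k) / real D)"
    unfolding ray_dir_def by (simp add: cis_divide) (simp add: algebra_simps diff_divide_distrib)
  then have "Re (z / ray_dir D (2 * k)) = t * cos (2 * pi * (real l - real k) / real D)"
    unfolding t(2) by (simp flip: times_divide_eq_right)
  moreover have "cos (2 * pi * (real l - real k) / real D) \<le> cos (2 * pi / real D)"
  proof (cases "k < l")
    case True
    then have "real l - real k = real (l - k)" by auto
    then show ?thesis using cos_ray_gap[OF D, of "l - k"] True kl by auto
  next
    case False
    then have "2 * pi * (real l - real k) / real D = - (2 * pi * real (k - l) / real D)"
      by (simp add: of_nat_diff algebra_simps diff_divide_distrib)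
    then show ?thesis using cos_ray_gap[OF D, of "k - l"] False kl by (simp only: cos_minus)
  qed
  ultimately have "Re (z / ray_dir D (2 * k)) \<le> cos (2 * pi / real D) * cmod z"
    using t by (simp add: norm_mult mult.commute mult_left_mono)
  then show ?thesis unfolding sector_def by auto
qed

lemma rays_disjoint:
  assumes D: "D \<ge> 4" and "k < D" "l < D" "x \<in> Sigma_ray D k" "x \<in> Sigma_ray D l" "x \<noteq> 0"
  shows "k = l"
  using ray_in_sector[OF D assms(4,6)] other_ray_not_in_sector[of D k l x] assms by auto

lemma sector_off_ray:
  assumes D: "D \<ge> 4" and k: "k < D" and z: "z \<in> sector D k" "Im (z / ray_dir D (2 * k)) \<noteq> 0"
  shows "z \<notin> Sigma_all D"
  unfolding Sigma_all_def using other_ray_not_in_sector[of D k _ z] assms mem_Sigma_ray by fastforce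

text \<open>Near each point of the ray without the origin, \<open>f\<close> on the side with sign \<open>s\<close> agrees with a function
  that is continuous in a full neighbourhood. This is easy to check and to combine, and it implies
  the uniform limits in \<open>has_nontangential_values\<close>.\<close>

definition local_extension :: "nat \<Rightarrow> nat \<Rightarrow> real \<Rightarrow> (complex \<Rightarrow> complex) \<Rightarrow> (complex \<Rightarrow> complex) \<Rightarrow> bool" where
  "local_extension D k s f b \<longleftrightarrow>
     (\<forall>x0\<in>Sigma_ray D k - {0}. \<exists>W g. open W \<and> x0 \<in> W \<and> continuous_on W g \<and>
        (\<forall>z\<in>W. s * Im (z / (orient D k * ray_dir D (2 * k))) > 0 \<longrightarrow> f z = g z) \<and>
        (\<forall>x\<in>W \<inter> Sigma_ray D k. x \<noteq> 0 \<longrightarrow> b x = g x))"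

lemma local_extension_self:
  "continuous_on UNIV f \<Longrightarrow> local_extension D k s f f"
  unfolding local_extension_def by blast

text \<open>Uniformity on a compact set comes from a Lebesgue number for the cover by sets on which the local
  continuation oscillates by less than \<open>e\<close>.\<close>

lemma local_extension_nontangential:
  assumes "local_extension D k s f b"
  shows "has_nontangential_values D k s f b"
  unfolding has_nontangential_values_def Let_def
proof (intro allI impI)
  define \<tau> where "\<tau> = orient D k * ray_dir D (2 * k)"
  fix c :: real and K :: "complex set" and e :: real
  assume a: "0 < c \<and> c < 1 \<and> compact K \<and> K \<subseteq> Sigma_ray D k - {0} \<and> 0 < e"
  define \<G> where "\<G> = {G. open G \<and> (\<exists>g. (\<forall>z\<in>G. \<forall>z'\<in>G. cmod (g z - g z') < e) \<and>
      (\<forall>z\<in>G. s * Im (z / \<tau>) > 0 \<longrightarrow> f z = g z) \<and> (\<forall>x\<in>G \<inter> Sigma_ray D k. x \<noteq> 0 \<longrightarrow> b x = g x))}"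
  have "K \<subseteq> \<Union>\<G>"
  proof
    fix x0 assume x0: "x0 \<in> K"
    with a have "x0 \<in> Sigma_ray D k - {0}" by blast
    from assms[unfolded local_extension_def, rule_format, OF this] obtain W g where W: "open W" "x0 \<in> W" "continuous_on W g"
        "\<forall>z\<in>W. s * Im (z / \<tau>) > 0 \<longrightarrow> f z = g z"
        "\<forall>x\<in>W \<inter> Sigma_ray D k. x \<noteq> 0 \<longrightarrow> b x = g x"
      unfolding \<tau>_def by blast
    define G where "G = W \<inter> g -` ball (g x0) (e / 2)"
    have "open G" unfolding G_def
      using continuous_openin_preimage_gen[OF W(3) open_ball[of "g x0" "e/2"]] W(1)
        openin_open_eq by blast
    moreover have "cmod (g z - g z') < e" if "z \<in> G" "z' \<in> G" for z z'
      using dist_triangle_half_r[of "g x0" "g z" e "g z'"] that unfolding G_def by (auto simp: dist_norm)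
    ultimately have "G \<in> \<G>" unfolding \<G>_def
      using W(4,5) by (auto simp: G_def intro!: exI[of _ g])
    moreover have "x0 \<in> G" unfolding G_def using W(2) a by auto
    ultimately show "x0 \<in> \<Union>\<G>" by blast
  qed
  moreover have "open G" if "G \<in> \<G>" for G using that unfolding \<G>_def by auto
  ultimately obtain d where d: "d > 0" "\<forall>x\<in>K. \<exists>G\<in>\<G>. ball x d \<subseteq> G"
    by (rule Heine_Borel_lemma[of K \<G>, rotated]) (use a in auto)
  show "\<exists>d>0. \<forall>x\<in>K. \<forall>z. 0 < cmod (z - x) \<and> cmod (z - x) < d \<and>
       s * Im ((z - x) / (orient D k * ray_dir D (2 * k))) \<ge> c * cmod (z - x) \<longrightarrow> cmod (f z - b x) < e"
  proof (intro exI conjI ballI allI impI)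
    fix x z assume x: "x \<in> K" and z: "0 < cmod (z - x) \<and> cmod (z - x) < d \<and>
       s * Im ((z - x) / (orient D k * ray_dir D (2 * k))) \<ge> c * cmod (z - x)"
    obtain G where G: "G \<in> \<G>" "ball x d \<subseteq> G" using d x by blast
    then obtain g where g: "\<forall>z\<in>G. \<forall>z'\<in>G. cmod (g z - g z') < e"
      "\<forall>z\<in>G. s * Im (z / \<tau>) > 0 \<longrightarrow> f z = g z" "\<forall>x\<in>G \<inter> Sigma_ray D k. x \<noteq> 0 \<longrightarrow> b x = g x"
      unfolding \<G>_def by blast
    have xr: "x \<in> Sigma_ray D k" "x \<noteq> 0" using x a by auto
    have "Im (x / \<tau>) = 0"
      using xr(1) unfolding mem_Sigma_ray \<tau>_def by (auto simp: orient_def)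
    then have "s * Im ((z - x) / \<tau>) = s * Im (z / \<tau>)" by (simp add: diff_divide_distrib)
    moreover have "0 < c * cmod (z - x)" using z a by simp
    ultimately have "s * Im (z / \<tau>) > 0" using z unfolding \<tau>_def by linarith
    moreover have "x \<in> ball x d" using d(1) by (simp only: centre_in_ball)
    moreover have "z \<in> ball x d" using z by (simp add: dist_norm norm_minus_commute)
    ultimately have "s * Im (z / \<tau>) > 0" "x \<in> G" "z \<in> G" using G(2) by auto
    then have "f z = g z" "b x = g x" "cmod (g z - g x) < e" using g xr by auto
    then show "cmod (f z - b x) < e" by simp
  qed (use d in auto)
qed

text \<open>Near a point of one ray no other ray is present, so the boundary function agrees there with a
  continuous one.\<close>

lemma local_extension_continuous:
  assumes D: "D \<ge> 4" and ext: "\<And>k. k < D \<Longrightarrow> local_extension D k s f b"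
  shows "continuous_on (Sigma_all D - {0}) b"
  unfolding continuous_on_def
proof
  fix x0 assume x0: "x0 \<in> Sigma_all D - {0}"
  then obtain k where k: "k < D" "x0 \<in> Sigma_ray D k" unfolding Sigma_all_def by auto
  obtain W g where W: "open W" "x0 \<in> W" "continuous_on W g"
        "\<forall>x\<in>W \<inter> Sigma_ray D k. x \<noteq> 0 \<longrightarrow> b x = g x"
    using ext[OF k(1)] x0 k(2) unfolding local_extension_def by blast
  have xs: "x0 \<in> sector D k" using ray_in_sector[OF D k(2)] x0 by auto
  have "isCont g x0" using W(1-3) continuous_on_eq_continuous_at by blast
  then have "(g \<longlongrightarrow> g x0) (at x0 within (Sigma_all D - {0}))"
    unfolding isCont_def using tendsto_within_subset by blast
  moreover have "\<forall>\<^sub>F x in at x0 within (Sigma_all D - {0}). g x = b x"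
    unfolding eventually_at_topological
  proof (intro exI[of _ "W \<inter> sector D k"] conjI ballI impI)
    fix x assume x: "x \<in> W \<inter> sector D k" "x \<in> Sigma_all D - {0}"
    then obtain l where l: "l < D" "x \<in> Sigma_ray D l" unfolding Sigma_all_def by auto
    then have "l = k" using other_ray_not_in_sector[of D k l x] D k x by auto
    then show "g x = b x" using W(4) x l by auto
  qed (use W xs open_sector in auto)
  moreover have "g x0 = b x0" using W(2,4) k(2) x0 by auto
  ultimately show "(b \<longlongrightarrow> b x0) (at x0 within (Sigma_all D - {0}))"
    using tendsto_cong by force
qed

lemma local_extension_cong:
  assumes D: "D \<ge> 4" and k: "k < D" and ext: "local_extension D k s f b"
    and eq: "\<And>z. z \<notin> Sigma_all D \<Longrightarrow> f' z = f z"
    and eqb: "\<And>x. x \<in> Sigma_ray D k \<Longrightarrow> x \<noteq> 0 \<Longrightarrow> b' x = b x"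
  shows "local_extension D k s f' b'"
  unfolding local_extension_def
proof
  fix x0 assume x0: "x0 \<in> Sigma_ray D k - {0}"
  then obtain W g where W: "open W" "x0 \<in> W" "continuous_on W g"
    "\<forall>z\<in>W. s * Im (z / (orient D k * ray_dir D (2 * k))) > 0 \<longrightarrow> f z = g z"
    "\<forall>x\<in>W \<inter> Sigma_ray D k. x \<noteq> 0 \<longrightarrow> b x = g x"
    using ext unfolding local_extension_def by blast
  have off: "z \<notin> Sigma_all D" if "z \<in> sector D k" "s * Im (z / (orient D k * ray_dir D (2 * k))) > 0" for z
  proof -
    have "Im (z / ray_dir D (2 * k)) \<noteq> 0"
    proof
      assume "Im (z / ray_dir D (2 * k)) = 0"
      then have "Im (z / (orient D k * ray_dir D (2 * k))) = 0" using orient_cases[of D k] by auto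
      then show False using that(2) by simp
    qed
    then show ?thesis using sector_off_ray[OF D k that(1)] by blast
  qed
  show "\<exists>W g. open W \<and> x0 \<in> W \<and> continuous_on W g \<and>
        (\<forall>z\<in>W. s * Im (z / (orient D k * ray_dir D (2 * k))) > 0 \<longrightarrow> f' z = g z) \<and>
        (\<forall>x\<in>W \<inter> Sigma_ray D k. x \<noteq> 0 \<longrightarrow> b' x = g x)"
  proof (intro exI[of _ "W \<inter> sector D k"] exI[of _ g] conjI ballI impI)
    show "x0 \<in> W \<inter> sector D k" using W(2) ray_in_sector[OF D, of x0 k] x0 by auto
    show "continuous_on (W \<inter> sector D k) g" using W(3) by (rule continuous_on_subset) auto
    show "open (W \<inter> sector D k)" using W(1) open_sector by auto
    fix z assume z: "z \<in> W \<inter> sector D k" "s * Im (z / (orient D k * ray_dir D (2 * k))) > 0"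
    then show "f' z = g z" using W(4) off[of z] eq[of z] by auto
  next
    fix x assume "x \<in> (W \<inter> sector D k) \<inter> Sigma_ray D k" "x \<noteq> 0"
    then show "b' x = g x" using W(5) eqb by auto
  qed
qed

section \<open>Cauchy integrals over the contour\<close>

definition ray_coord :: "nat \<Rightarrow> nat \<Rightarrow> (complex \<Rightarrow> complex) \<Rightarrow> complex \<Rightarrow> complex" where
  "ray_coord D k f w = f (ray_dir D (2 * k) * w)"

definition ray_cauchy :: "nat \<Rightarrow> nat \<Rightarrow> (complex \<Rightarrow> complex) \<Rightarrow> complex \<Rightarrow> complex" where
  "ray_cauchy D k f z = ray_integral D (2 * k) (\<lambda>x. f x / (x - z))"

lemma ray_cauchy_eq:
  "ray_cauchy D k f z = cauchy_on {0..} (ray_coord D k f) (z / ray_dir D (2 * k))"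
proof -
  have e: "d * (a / (of_real t * d - z)) = a / (of_real t - z / d)" if "d \<noteq> 0" for d a and t :: real
  proof -
    have "of_real t * d - z = d * (of_real t - z / d)" using that by (simp add: algebra_simps)
    then show ?thesis using that by simp
  qed
  show ?thesis
    unfolding ray_cauchy_def ray_integral_def cauchy_on_def ray_coord_def
      set_integral_mult_right[symmetric]
    by (subst e) (simp_all add: mult.commute)
qed

lemma rapid_ray_coord:
  "rapid (ray_dir D (2 * k)) f \<Longrightarrow> rapid 1 (ray_coord D k f)"
  unfolding ray_coord_def[abs_def] by (rule rapid_rotate)

lemma ray_cauchy_holomorphic:
  assumes "rapid (ray_dir D (2 * k)) f"
  shows "ray_cauchy D k f holomorphic_on - Sigma_ray D k"
proof -
  have "(cauchy_on {0..} (ray_coord D k f) \<circ> (\<lambda>z. z / ray_dir D (2 * k))) holomorphic_on - Sigma_ray D k"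
    by (rule holomorphic_on_compose_gen[OF _ cauchy_on_holomorphic[OF rapid_ray_coord[OF assms], of _ 0]])
       (auto intro!: holomorphic_intros simp: mem_Sigma_ray)
  then show ?thesis unfolding ray_cauchy_eq[abs_def] o_def .
qed

lemma ray_cauchy_bounded_far:
  assumes "rapid (ray_dir D (2 * k)) f"
  obtains M where "\<And>z. z \<notin> Sigma_ray D k \<Longrightarrow> cmod z \<ge> 2 \<Longrightarrow> cmod (ray_cauchy D k f z) \<le> M"
proof -
  obtain M where M: "\<And>z. \<not> (Im z = 0 \<and> 0 \<le> Re z) \<Longrightarrow> cmod z \<ge> 2 \<Longrightarrow>
      cmod (cauchy_on {0..} (ray_coord D k f) z) \<le> M"
    using cauchy_on_bounded_far[OF rapid_ray_coord[OF assms]] by metis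
  show ?thesis
    by (rule that[of M]) (use M in \<open>auto simp: ray_cauchy_eq mem_Sigma_ray norm_divide\<close>)
qed

text \<open>The factor \<open>ray_dir\<close> in the ray integral cancels against the one in \<open>x - z\<close>, so the coefficient of
  the logarithm does not depend on the direction of the ray.\<close>

lemma ray_cauchy_near_origin:
  assumes "rapid (ray_dir D (2 * k)) f"
  obtains M where "\<And>z. z \<notin> Sigma_ray D k \<Longrightarrow> cmod z \<le> 1 / 2 \<Longrightarrow>
      cmod (ray_cauchy D k f z + f 0 * of_real (ln (cmod z))) \<le> M"
proof -
  obtain M where M: "\<And>z. \<not> (Im z = 0 \<and> 0 \<le> Re z) \<Longrightarrow> cmod z \<le> 1 / 2 \<Longrightarrow>
      cmod (cauchy_on {0..} (ray_coord D k f) z + ray_coord D k f 0 * of_real (ln (cmod z))) \<le> M"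
    using cauchy_on_near_origin[OF rapid_ray_coord[OF assms]] by metis
  show ?thesis
  proof (rule that[of M])
    fix z assume z: "z \<notin> Sigma_ray D k" "cmod z \<le> 1 / 2"
    show "cmod (ray_cauchy D k f z + f 0 * of_real (ln (cmod z))) \<le> M"
      using M[of "z / ray_dir D (2 * k)"] z
      by (auto simp: ray_cauchy_eq mem_Sigma_ray norm_divide ray_coord_def)
  qed
qed

text \<open>The density may be a different entire function \<open>f k\<close> on each ray. This covers the transform over
  the real line and those over the whole contour: a density is \<open>0\<close> on the rays that do not
  contribute.\<close>

definition contour_cauchy :: "nat \<Rightarrow> (nat \<Rightarrow> complex \<Rightarrow> complex) \<Rightarrow> complex \<Rightarrow> complex" where
  "contour_cauchy D f z = 1 / (2 * of_real pi * \<i>) * (\<Sum>k<D. orient D k * ray_cauchy D k (f k) z)"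

definition rapid_densities :: "nat \<Rightarrow> (nat \<Rightarrow> complex \<Rightarrow> complex) \<Rightarrow> bool" where
  "rapid_densities D f \<longleftrightarrow> (\<forall>k<D. rapid (ray_dir D (2 * k)) (f k))"

lemma contour_cauchy_holomorphic:
  assumes "rapid_densities D f"
  shows "contour_cauchy D f holomorphic_on - Sigma_all D"
  unfolding contour_cauchy_def[abs_def]
proof (intro holomorphic_intros)
  fix k assume "k \<in> {..<D}"
  then have "rapid (ray_dir D (2 * k)) (f k)" "- Sigma_all D \<subseteq> - Sigma_ray D k"
    using assms by (auto simp: rapid_densities_def Sigma_all_def)
  then show "ray_cauchy D k (f k) holomorphic_on - Sigma_all D"
    using ray_cauchy_holomorphic holomorphic_on_subset by blast
qed

lemma contour_cauchy_bounded_far: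
  assumes "rapid_densities D f"
  obtains M where "\<And>z. z \<notin> Sigma_all D \<Longrightarrow> cmod z \<ge> 2 \<Longrightarrow> cmod (contour_cauchy D f z) \<le> M"
proof -
  have "\<forall>k\<in>{..<D}. \<exists>M. \<forall>z. z \<notin> Sigma_ray D k \<longrightarrow> cmod z \<ge> 2 \<longrightarrow> cmod (ray_cauchy D k (f k) z) \<le> M"
  proof
    fix k assume "k \<in> {..<D}"
    with assms have "rapid (ray_dir D (2 * k)) (f k)" unfolding rapid_densities_def by auto
    then show "\<exists>M. \<forall>z. z \<notin> Sigma_ray D k \<longrightarrow> cmod z \<ge> 2 \<longrightarrow> cmod (ray_cauchy D k (f k) z) \<le> M"
      by (rule ray_cauchy_bounded_far) blast
  qed
  then obtain M where M: "\<forall>k\<in>{..<D}. \<forall>z. z \<notin> Sigma_ray D k \<longrightarrow> cmod z \<ge> 2 \<longrightarrow> cmod (ray_cauchy D k (f k) z) \<le> M k"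
    by metis
  show ?thesis
  proof (rule that[of "cmod (1 / (2 * of_real pi * \<i>)) * (\<Sum>k<D. M k)"])
    fix z assume z: "z \<notin> Sigma_all D" "cmod z \<ge> 2"
    have "cmod (\<Sum>k<D. orient D k * ray_cauchy D k (f k) z) \<le> (\<Sum>k<D. M k)"
      using M z by (intro sum_norm_le) (auto simp: Sigma_all_def norm_mult orient_def)
    then show "cmod (contour_cauchy D f z) \<le> cmod (1 / (2 * of_real pi * \<i>)) * (\<Sum>k<D. M k)"
      unfolding contour_cauchy_def norm_mult by (intro mult_left_mono) auto
  qed
qed

text \<open>The hypothesis says that the logarithms from the individual rays cancel.\<close>

lemma contour_cauchy_bounded_near_origin:
  assumes "rapid_densities D f" and bal: "(\<Sum>k<D. orient D k * f k 0) = 0"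
  obtains M where "\<And>z. z \<notin> Sigma_all D \<Longrightarrow> cmod z \<le> 1 / 2 \<Longrightarrow> cmod (contour_cauchy D f z) \<le> M"
proof -
  have "\<forall>k\<in>{..<D}. \<exists>M. \<forall>z. z \<notin> Sigma_ray D k \<longrightarrow> cmod z \<le> 1/2 \<longrightarrow>
     cmod (ray_cauchy D k (f k) z + f k 0 * of_real (ln (cmod z))) \<le> M"
  proof
    fix k assume "k \<in> {..<D}"
    with assms have "rapid (ray_dir D (2 * k)) (f k)" unfolding rapid_densities_def by auto
    then show "\<exists>M. \<forall>z. z \<notin> Sigma_ray D k \<longrightarrow> cmod z \<le> 1/2 \<longrightarrow>
     cmod (ray_cauchy D k (f k) z + f k 0 * of_real (ln (cmod z))) \<le> M"
      by (rule ray_cauchy_near_origin) blast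
  qed
  then obtain M where M: "\<forall>k\<in>{..<D}. \<forall>z. z \<notin> Sigma_ray D k \<longrightarrow> cmod z \<le> 1/2 \<longrightarrow>
     cmod (ray_cauchy D k (f k) z + f k 0 * of_real (ln (cmod z))) \<le> M k"
    by metis
  show ?thesis
  proof (rule that[of "cmod (1 / (2 * of_real pi * \<i>)) * (\<Sum>k<D. M k)"])
    fix z assume z: "z \<notin> Sigma_all D" "cmod z \<le> 1/2"
    have "(\<Sum>k<D. orient D k * (ray_cauchy D k (f k) z + f k 0 * of_real (ln (cmod z))))
       = (\<Sum>k<D. orient D k * ray_cauchy D k (f k) z) + (\<Sum>k<D. orient D k * f k 0) * of_real (ln (cmod z))"
      by (simp add: sum.distrib distrib_left sum_distrib_right mult.assoc)
    then have "(\<Sum>k<D. orient D k * ray_cauchy D k (f k) z) =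
        (\<Sum>k<D. orient D k * (ray_cauchy D k (f k) z + f k 0 * of_real (ln (cmod z))))"
      using bal by simp
    also have "cmod \<dots> \<le> (\<Sum>k<D. M k)"
      using M z by (intro sum_norm_le) (auto simp: Sigma_all_def norm_mult orient_def)
    finally show "cmod (contour_cauchy D f z) \<le> cmod (1 / (2 * of_real pi * \<i>)) * (\<Sum>k<D. M k)"
      unfolding contour_cauchy_def norm_mult by (intro mult_left_mono) auto
  qed
qed

definition ray_number :: "nat \<Rightarrow> complex \<Rightarrow> nat" where
  "ray_number D x = (THE k. k < D \<and> x \<in> Sigma_ray D k)"

lemma ray_number_eq:
  assumes "D \<ge> 4" "k < D" "x \<in> Sigma_ray D k" "x \<noteq> 0"
  shows "ray_number D x = k"
  unfolding ray_number_def using rays_disjoint[OF assms(1)] assms by (intro the_equality) auto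

text \<open>On the ray that contains \<open>x\<close> the boundary value from the side \<open>s\<close> is taken; the other rays
  contribute analytically. Left and right are exchanged on the ray oriented towards the origin, hence
  the factor \<open>Re (orient D k)\<close> in the side.\<close>

definition contour_bdry :: "nat \<Rightarrow> (nat \<Rightarrow> complex \<Rightarrow> complex) \<Rightarrow> real \<Rightarrow> complex \<Rightarrow> complex" where
  "contour_bdry D f s x = (let k = ray_number D x in
     1 / (2 * of_real pi * \<i>) *
      (orient D k * half_bdry (s * Re (orient D k)) (ray_coord D k (f k)) (x / ray_dir D (2 * k)) +
       (\<Sum>l\<in>{..<D} - {k}. orient D l * ray_cauchy D l (f l) x)))"

lemma contour_cauchy_local_extension:
  assumes D: "D \<ge> 4" and f: "rapid_densities D f" and k: "k < D" and s: "s = 1 \<or> s = -1"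
  shows "local_extension D k s (contour_cauchy D f) (contour_bdry D f s)"
  unfolding local_extension_def
proof
  fix x0 assume x0: "x0 \<in> Sigma_ray D k - {0}"
  define d where "d = ray_dir D (2 * k)"
  have d: "d \<noteq> 0" "cmod d = 1" by (auto simp: d_def)
  define T where "T = cmod x0 + 1"
  have T: "T > 0" unfolding T_def by (simp add: add_nonneg_pos)
  define \<sigma> where "\<sigma> = s * Re (orient D k)"
  have \<sigma>: "\<sigma> = 1 \<or> \<sigma> = -1" using s orient_cases[of D k] by (auto simp: \<sigma>_def)
  define h where "h = ray_coord D k (f k)"
  have fk: "rapid (ray_dir D (2 * l)) (f l)" if "l < D" for l using f that unfolding rapid_densities_def by auto
  have h: "rapid 1 h" unfolding h_def by (rule rapid_ray_coord[OF fk[OF k]])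
  define W where "W = sector D k \<inter> ball 0 T"
  define g where "g z = 1 / (2 * of_real pi * \<i>) *
      (orient D k * half_ext T \<sigma> h (z / d) + (\<Sum>l\<in>{..<D} - {k}. orient D l * ray_cauchy D l (f l) z))" for z
  have Wpos: "0 < Re (z / d)" "cmod (z / d) < T" if "z \<in> W" for z
    using that sector_Re_pos[OF D, of z k] d by (auto simp: W_def d_def norm_divide)
  show "\<exists>W g. open W \<and> x0 \<in> W \<and> continuous_on W g \<and>
        (\<forall>z\<in>W. s * Im (z / (orient D k * ray_dir D (2 * k))) > 0 \<longrightarrow> contour_cauchy D f z = g z) \<and>
        (\<forall>x\<in>W \<inter> Sigma_ray D k. x \<noteq> 0 \<longrightarrow> contour_bdry D f s x = g x)"
  proof (intro exI[of _ W] exI[of _ g] conjI ballI impI)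
    show "open W" unfolding W_def using open_sector by auto
    show "x0 \<in> W" unfolding W_def T_def using ray_in_sector[OF D, of x0 k] x0 by auto
    have "continuous_on W (\<lambda>z. half_ext T \<sigma> h (z / d))"
      by (rule continuous_on_compose2[OF continuous_half_ext[OF h T]])
         (use Wpos d in \<open>auto intro!: continuous_intros\<close>)
    moreover have "continuous_on W (ray_cauchy D l (f l))" if "l \<in> {..<D} - {k}" for l
    proof (rule continuous_on_subset[OF holomorphic_on_imp_continuous_on[OF ray_cauchy_holomorphic[OF fk]]])
      show "W \<subseteq> - Sigma_ray D l"
        using other_ray_not_in_sector[of D k l] that k D unfolding W_def by auto
    qed (use that in auto)
    ultimately show "continuous_on W g"
      unfolding g_def[abs_def] by (intro continuous_intros) auto
    have split: "contour_cauchy D f z = 1 / (2 * of_real pi * \<i>) *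
      (orient D k * ray_cauchy D k (f k) z + (\<Sum>l\<in>{..<D} - {k}. orient D l * ray_cauchy D l (f l) z))" for z
      unfolding contour_cauchy_def using k by (subst sum.remove[of _ k]) auto
    fix z assume z: "z \<in> W" "s * Im (z / (orient D k * ray_dir D (2 * k))) > 0"
    have "s * Im (z / (orient D k * ray_dir D (2 * k))) = \<sigma> * Im (z / d)"
      using orient_cases[of D k] by (auto simp: \<sigma>_def d_def)
    then have "half_ext T \<sigma> h (z / d) = ray_cauchy D k (f k) z"
      using half_ext_off_axis[OF h \<sigma> Wpos[OF z(1)]] z(2) by (simp add: ray_cauchy_eq h_def d_def)
    then show "contour_cauchy D f z = g z" unfolding split g_def by simp
  next
    fix x assume x: "x \<in> W \<inter> Sigma_ray D k" "x \<noteq> 0"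
    have "half_ext T \<sigma> h (x / d) = half_bdry \<sigma> h (x / d)"
      using half_ext_on_axis[OF h \<sigma>] Wpos[of x] x by (auto simp: mem_Sigma_ray d_def)
    then show "contour_bdry D f s x = g x"
      using ray_number_eq[OF D k _ x(2)] x(1)
      unfolding contour_bdry_def g_def by (simp add: \<sigma>_def h_def d_def)
  qed
qed

lemma contour_bdry_jump:
  assumes D: "D \<ge> 4" and f: "rapid_densities D f" and k: "k < D" and x: "x \<in> Sigma_ray D k" "x \<noteq> 0"
  shows "contour_bdry D f 1 x - contour_bdry D f (-1) x = f k x"
proof -
  define h where "h = ray_coord D k (f k)"
  define y where "y = x / ray_dir D (2 * k)"
  have h: "rapid 1 h" unfolding h_def using f k rapid_ray_coord unfolding rapid_densities_def by blast
  have y: "0 < Re y" "Im y = 0"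
    using sector_Re_pos[OF D ray_in_sector[OF D x]] x(1) unfolding mem_Sigma_ray y_def by auto
  have hy: "h y = f k x" unfolding h_def y_def ray_coord_def by simp
  have "orient D k * half_bdry (1 * Re (orient D k)) h y - orient D k * half_bdry (- 1 * Re (orient D k)) h y
      = 2 * of_real pi * \<i> * h y"
    using orient_cases[of D k] half_bdry_jump[OF h y] by (auto simp: algebra_simps)
  then show ?thesis
    unfolding contour_bdry_def Let_def ray_number_eq[OF D k x] hy h_def[symmetric] y_def[symmetric]
    by (simp add: field_simps)
qed

lemma rapid_set_integrable:
  assumes "rapid d f" shows "set_integrable lborel {0..} (\<lambda>t. f (of_real t * d))"
proof -
  note h = rapid_rotate[OF assms]
  obtain M where M: "\<And>t. t \<ge> 0 \<Longrightarrow> cmod (f (d * of_real t)) \<le> M / (1 + t)\<^sup>2"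
    using rapid_dominated[OF h] by metis
  show ?thesis
    by (rule set_integral_dominated(1)[where C = M]) (use M rapid_measurable[OF assms] in \<open>auto simp: mult.commute\<close>)
qed

lemma ray_integral_add:
  assumes "rapid (ray_dir D k) f" "rapid (ray_dir D k) g"
  shows "ray_integral D k (\<lambda>x. f x + g x) = ray_integral D k f + ray_integral D k g"
  unfolding ray_integral_def
  using set_integral_add(2)[OF rapid_set_integrable[OF assms(1)] rapid_set_integrable[OF assms(2)]]
  by (simp add: distrib_left)

lemma ray_integral_cmult: "ray_integral D k (\<lambda>x. c * f x) = c * ray_integral D k f"
  unfolding ray_integral_def by simp

text \<open>The leading coefficient of the Cauchy integral at infinity, up to the factor \<open>-1 / (2 \<pi> i)\<close>.\<close>

definition contour_mass :: "nat \<Rightarrow> (nat \<Rightarrow> complex \<Rightarrow> complex) \<Rightarrow> complex" where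
  "contour_mass D f = (\<Sum>k<D. orient D k * ray_integral D (2 * k) (f k))"

lemma rapid_densities_times_z:
  "rapid_densities D f \<Longrightarrow> rapid_densities D (\<lambda>k x. x * f k x)"
  unfolding rapid_densities_def using rapid_times_z by blast

lemma ray_cauchy_integrable:
  assumes f: "rapid (ray_dir D (2 * k)) f" and z: "z \<notin> Sigma_ray D k"
  shows "set_integrable lborel {0..}
     (\<lambda>t. f (of_real t * ray_dir D (2 * k)) / (of_real t * ray_dir D (2 * k) - z))"
proof -
  define d where "d = ray_dir D (2 * k)"
  have d: "d \<noteq> 0" by (simp add: d_def)
  obtain \<delta> where \<delta>: "\<delta> > 0" "\<And>t. t \<ge> 0 \<Longrightarrow> cmod (of_real t - z / d) \<ge> \<delta>"
    using half_line_separation[of "z / d" 0] z unfolding mem_Sigma_ray d_def by metis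
  have "set_integrable lborel {0..} (\<lambda>t. ray_coord D k f (of_real t) / (of_real t - z / d))"
    by (rule cauchy_on_integrable[OF rapid_ray_coord[OF f] _ _ \<delta>(1)]) (use \<delta>(2) in auto)
  then have "set_integrable lborel {0..} (\<lambda>t. 1 / d * (ray_coord D k f (of_real t) / (of_real t - z / d)))"
    by (rule set_integrable_mult_right)
  moreover have "1 / d * (ray_coord D k f (of_real t) / (of_real t - z / d)) = f (of_real t * d) / (of_real t * d - z)" for t :: real
  proof -
    have "of_real t * d - z = d * (of_real t - z / d)" using d by (simp add: algebra_simps)
    then show ?thesis by (simp add: ray_coord_def d_def mult.commute)
  qed
  ultimately show ?thesis unfolding d_def by simp
qed

text \<open>From \<open>z / (x - z) = x / (x - z) - 1\<close>.\<close>

lemma ray_cauchy_shift: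
  assumes f: "rapid (ray_dir D (2 * k)) f" and z: "z \<notin> Sigma_ray D k"
  shows "z * ray_cauchy D k f z = ray_cauchy D k (\<lambda>x. x * f x) z - ray_integral D (2 * k) f"
proof -
  define d where "d = ray_dir D (2 * k)"
  have d: "d \<noteq> 0" by (simp add: d_def)
  have I: "set_integrable lborel {0..} (\<lambda>t. f (of_real t * d) / (of_real t * d - z))"
    unfolding d_def by (rule ray_cauchy_integrable[OF assms])
  have J: "set_integrable lborel {0..} (\<lambda>t. f (of_real t * d))"
    unfolding d_def by (rule rapid_set_integrable[OF f])
  have "(LBINT t:{0..}. (of_real t * d) * f (of_real t * d) / (of_real t * d - z))
      = (LBINT t:{0..}. z * (f (of_real t * d) / (of_real t * d - z)) + f (of_real t * d))"
  proof (rule set_lebesgue_integral_cong)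
    show "\<forall>t. t \<in> {0..} \<longrightarrow> (of_real t * d) * f (of_real t * d) / (of_real t * d - z)
       = z * (f (of_real t * d) / (of_real t * d - z)) + f (of_real t * d)"
    proof (intro allI impI)
      fix t :: real assume "t \<in> {0..}"
      then have "of_real t * d - z \<noteq> 0" using z unfolding Sigma_ray_def d_def by auto
      then show "(of_real t * d) * f (of_real t * d) / (of_real t * d - z)
       = z * (f (of_real t * d) / (of_real t * d - z)) + f (of_real t * d)"
        by (simp add: field_simps)
    qed
  qed auto
  also have "\<dots> = z * (LBINT t:{0..}. f (of_real t * d) / (of_real t * d - z)) + (LBINT t:{0..}. f (of_real t * d))"
    by (subst set_integral_add(2)) (use I J in \<open>simp_all del: times_divide_eq_right\<close>)
  finally show ?thesis
    unfolding ray_cauchy_def ray_integral_def d_def[symmetric] by (simp add: algebra_simps)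
qed

lemma contour_cauchy_shift:
  assumes f: "rapid_densities D f" and z: "z \<notin> Sigma_all D"
  shows "z * contour_cauchy D f z =
     contour_cauchy D (\<lambda>k x. x * f k x) z - 1 / (2 * of_real pi * \<i>) * contour_mass D f"
proof -
  have "z * (\<Sum>k<D. orient D k * ray_cauchy D k (f k) z) =
     (\<Sum>k<D. orient D k * (z * ray_cauchy D k (f k) z))"
    by (simp add: sum_distrib_left mult.left_commute)
  also have "\<dots> = (\<Sum>k<D. orient D k * (ray_cauchy D k (\<lambda>x. x * f k x) z - ray_integral D (2 * k) (f k)))"
    by (intro sum.cong refl arg_cong2[where f = "(*)"] ray_cauchy_shift)
       (use f z in \<open>auto simp: rapid_densities_def Sigma_all_def\<close>)
  also have "\<dots> = (\<Sum>k<D. orient D k * ray_cauchy D k (\<lambda>x. x * f k x) z) - contour_mass D f"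
    by (simp add: contour_mass_def right_diff_distrib sum_subtractf)
  finally have e: "z * (\<Sum>k<D. orient D k * ray_cauchy D k (f k) z)
     = (\<Sum>k<D. orient D k * ray_cauchy D k (\<lambda>x. x * f k x) z) - contour_mass D f" .
  have "z * contour_cauchy D f z = 1 / (2 * of_real pi * \<i>) * (z * (\<Sum>k<D. orient D k * ray_cauchy D k (f k) z))"
    by (simp add: contour_cauchy_def)
  then show ?thesis unfolding e by (simp add: contour_cauchy_def right_diff_distrib)
qed

section \<open>Functions without a jump across the contour\<close>

lemma closed_Sigma_ray: "closed (Sigma_ray D k)"
proof -
  have "Sigma_ray D k = {z. Im (z / ray_dir D (2 * k)) = 0} \<inter> {z. 0 \<le> Re (z / ray_dir D (2 * k))}"
    by (auto simp: mem_Sigma_ray)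
  moreover have "closed \<dots>"
    by (intro closed_Int closed_Collect_eq closed_Collect_le continuous_intros) auto
  ultimately show ?thesis by simp
qed

lemma closed_Sigma_all: "closed (Sigma_all D)"
  unfolding Sigma_all_def by (intro closed_UN) (auto simp: closed_Sigma_ray)

text \<open>Describes the line through the ray as the zero set of a real linear form, as needed for pasting
  across a line.\<close>

lemma inner_rotated:
  assumes "cmod d = 1" shows "(\<i> * d) \<bullet> z = Im (z / d)"
proof -
  have "(Re d)\<^sup>2 + (Im d)\<^sup>2 = 1" using assms by (simp add: cmod_def)
  then show ?thesis by (simp add: inner_complex_def Im_divide field_simps)
qed

lemma negligible_Sigma_all: "negligible (Sigma_all D)"
  unfolding Sigma_all_def
proof (rule negligible_Union)
  fix T assume "T \<in> Sigma_ray D ` {..<D}"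
  then obtain k where T: "T = Sigma_ray D k" by auto
  have "negligible {z. (\<i> * ray_dir D (2 * k)) \<bullet> z = 0}" by (intro negligible_hyperplane) simp
  then show "negligible T" unfolding T
    by (rule negligible_subset) (auto simp: inner_rotated mem_Sigma_ray)
qed simp

text \<open>Lets estimates that are known off the contour pass to continuous functions on it.\<close>

lemma islimpt_off_contour: "x islimpt (- Sigma_all D)"
  unfolding islimpt_def
proof (intro allI impI)
  fix T assume T: "x \<in> T" "open T"
  have "\<not> negligible T" using T open_not_negligible by blast
  moreover have "negligible (Sigma_all D \<union> {x})" using negligible_Sigma_all by (intro negligible_Un) auto
  ultimately have "\<not> T \<subseteq> Sigma_all D \<union> {x}" using negligible_subset by blast
  then show "\<exists>y\<in>- Sigma_all D. y \<in> T \<and> y \<noteq> x" by auto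
qed

lemma bound_off_contour_extends:
  fixes f :: "complex \<Rightarrow> complex"
  assumes "isCont f x" "isCont B x" "open U" "x \<in> U"
    "\<And>z. z \<in> U \<Longrightarrow> z \<noteq> x \<Longrightarrow> z \<notin> Sigma_all D \<Longrightarrow> cmod (f z) \<le> B z"
  shows "cmod (f x) \<le> B x"
proof (rule tendsto_le[where F = "at x within - Sigma_all D"])
  show "at x within - Sigma_all D \<noteq> bot"
    using islimpt_off_contour trivial_limit_within by blast
  show "(B \<longlongrightarrow> B x) (at x within - Sigma_all D)"
    using assms(2) unfolding isCont_def using tendsto_within_subset by blast
  show "((\<lambda>z. cmod (f z)) \<longlongrightarrow> cmod (f x)) (at x within - Sigma_all D)"
    using assms(1) unfolding isCont_def using tendsto_within_subset tendsto_norm by blast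
  show "\<forall>\<^sub>F z in at x within - Sigma_all D. cmod (f z) \<le> B z"
    unfolding eventually_at_topological using assms(3-5) by blast
qed

lemma nontangential_diff:
  assumes "has_nontangential_values D k s f b" "has_nontangential_values D k s g c"
  shows "has_nontangential_values D k s (\<lambda>z. f z - g z) (\<lambda>x. b x - c x)"
  unfolding has_nontangential_values_def Let_def
proof (intro allI impI)
  fix a :: real and K :: "complex set" and e :: real
  assume h: "0 < a \<and> a < 1 \<and> compact K \<and> K \<subseteq> Sigma_ray D k - {0} \<and> 0 < e"
  then have h2: "0 < a \<and> a < 1 \<and> compact K \<and> K \<subseteq> Sigma_ray D k - {0} \<and> 0 < e / 2" by simp
  obtain d1 where d1: "d1 > 0" "\<forall>x\<in>K. \<forall>z. 0 < cmod (z - x) \<and> cmod (z - x) < d1 \<and>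
      s * Im ((z - x) / (orient D k * ray_dir D (2 * k))) \<ge> a * cmod (z - x) \<longrightarrow> cmod (f z - b x) < e / 2"
    using assms(1)[unfolded has_nontangential_values_def Let_def, rule_format, OF h2] by blast
  obtain d2 where d2: "d2 > 0" "\<forall>x\<in>K. \<forall>z. 0 < cmod (z - x) \<and> cmod (z - x) < d2 \<and>
      s * Im ((z - x) / (orient D k * ray_dir D (2 * k))) \<ge> a * cmod (z - x) \<longrightarrow> cmod (g z - c x) < e / 2"
    using assms(2)[unfolded has_nontangential_values_def Let_def, rule_format, OF h2] by blast
  show "\<exists>d>0. \<forall>x\<in>K. \<forall>z. 0 < cmod (z - x) \<and> cmod (z - x) < d \<and>
      s * Im ((z - x) / (orient D k * ray_dir D (2 * k))) \<ge> a * cmod (z - x) \<longrightarrow>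
      cmod (f z - g z - (b x - c x)) < e"
  proof (intro exI[of _ "min d1 d2"] conjI ballI allI impI)
    fix x z assume x: "x \<in> K" and z: "0 < cmod (z - x) \<and> cmod (z - x) < min d1 d2 \<and>
      s * Im ((z - x) / (orient D k * ray_dir D (2 * k))) \<ge> a * cmod (z - x)"
    then have "cmod (f z - b x) < e / 2" "cmod (g z - c x) < e / 2" using d1(2) d2(2) by auto
    then show "cmod (f z - g z - (b x - c x)) < e"
      using norm_triangle_ineq4[of "f z - b x" "g z - c x"] by (simp add: algebra_simps)
  qed (use d1 d2 in auto)
qed

lemma nontangential_cong:
  assumes nt: "has_nontangential_values D k s f b" and eq: "\<And>x. x \<in> Sigma_ray D k - {0} \<Longrightarrow> b x = b' x"
  shows "has_nontangential_values D k s f b'"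
  unfolding has_nontangential_values_def Let_def
proof (intro allI impI)
  fix c :: real and K :: "complex set" and e :: real
  assume h: "0 < c \<and> c < 1 \<and> compact K \<and> K \<subseteq> Sigma_ray D k - {0} \<and> 0 < e"
  obtain d where d: "d > 0" "\<forall>x\<in>K. \<forall>z. 0 < cmod (z - x) \<and> cmod (z - x) < d \<and>
      s * Im ((z - x) / (orient D k * ray_dir D (2 * k))) \<ge> c * cmod (z - x) \<longrightarrow> cmod (f z - b x) < e"
    using nt[unfolded has_nontangential_values_def Let_def, rule_format, OF h] by blast
  have "b x = b' x" if "x \<in> K" for x using h that eq by blast
  with d show "\<exists>d>0. \<forall>x\<in>K. \<forall>z. 0 < cmod (z - x) \<and> cmod (z - x) < d \<and>
      s * Im ((z - x) / (orient D k * ray_dir D (2 * k))) \<ge> c * cmod (z - x) \<longrightarrow> cmod (f z - b' x) < e"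
    by (intro exI[of _ d]) simp
qed

text \<open>The boundary value is attained along the normal at \<open>x\<close>, which avoids the contour near \<open>x\<close>.\<close>

lemma nontangential_limit_of_continuous:
  assumes D: "D \<ge> 4" and k: "k < D" and s: "s = 1 \<or> s = -1"
    and nt: "has_nontangential_values D k s f b" and eq: "\<And>z. z \<notin> Sigma_all D \<Longrightarrow> f z = h z"
    and x: "x \<in> Sigma_ray D k" "x \<noteq> 0" and h: "isCont h x"
  shows "b x = h x"
proof (rule ccontr)
  assume "b x \<noteq> h x"
  define e where "e = cmod (b x - h x) / 2"
  have e: "e > 0" using \<open>b x \<noteq> h x\<close> by (simp add: e_def)
  define \<tau> where "\<tau> = orient D k * ray_dir D (2 * k)"
  have \<tau>: "cmod \<tau> = 1" using orient_cases[of D k] by (auto simp: \<tau>_def norm_mult)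
  then have \<tau>0: "\<tau> \<noteq> 0" by auto
  have hyp: "0 < (1/2::real) \<and> (1/2::real) < 1 \<and> compact {x} \<and> {x} \<subseteq> Sigma_ray D k - {0} \<and> 0 < e"
    using x e by auto
  obtain d1 where d1: "d1 > 0" "\<forall>y\<in>{x}. \<forall>z. 0 < cmod (z - y) \<and> cmod (z - y) < d1 \<and>
      s * Im ((z - y) / \<tau>) \<ge> 1/2 * cmod (z - y) \<longrightarrow> cmod (f z - b y) < e"
    using nt[unfolded has_nontangential_values_def Let_def, rule_format, OF hyp] unfolding \<tau>_def by blast
  obtain d2 where d2: "d2 > 0" "\<And>z. dist z x < d2 \<Longrightarrow> dist (h z) (h x) < e"
    using h e unfolding continuous_at_eps_delta by meson
  obtain d3 where d3: "d3 > 0" "ball x d3 \<subseteq> sector D k"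
    using open_sector[of D k] ray_in_sector[OF D x] by (meson openE)
  define \<epsilon> where "\<epsilon> = min d1 (min d2 d3) / 2"
  have \<epsilon>: "\<epsilon> > 0" "\<epsilon> < d1" "\<epsilon> < d2" "\<epsilon> < d3" using d1(1) d2(1) d3(1) by (auto simp: \<epsilon>_def)
  \<comment> \<open>A point on the normal at \<open>x\<close>, on the side with sign \<open>s\<close>.\<close>
  define z where "z = x + of_real (s * \<epsilon>) * \<i> * \<tau>"
  have zx: "(z - x) / \<tau> = of_real (s * \<epsilon>) * \<i>" using \<tau>0 by (simp add: z_def)
  have n: "cmod (z - x) = \<epsilon>" using s \<epsilon>(1) by (auto simp: z_def norm_mult \<tau>)
  have "s * Im ((z - x) / \<tau>) = \<epsilon>" unfolding zx using s by auto
  then have "1/2 * cmod (z - x) \<le> s * Im ((z - x) / \<tau>)" "0 < cmod (z - x)" "cmod (z - x) < d1"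
    using n \<epsilon> by simp_all
  then have 1: "cmod (f z - b x) < e" using d1(2) by blast
  have "Im (x / \<tau>) = 0" using x(1) orient_cases[of D k] unfolding mem_Sigma_ray \<tau>_def by auto
  then have "Im (z / \<tau>) = s * \<epsilon>" using zx by (simp add: diff_divide_distrib algebra_simps complex_eq_iff)
  then have "Im (z / ray_dir D (2 * k)) \<noteq> 0"
    using s \<epsilon>(1) orient_cases[of D k] unfolding \<tau>_def by auto
  moreover have "z \<in> sector D k" using d3(2) n \<epsilon> by (auto simp: dist_norm norm_minus_commute)
  ultimately have "f z = h z" using sector_off_ray[OF D k] eq by blast
  moreover have "dist (h z) (h x) < e" using d2(2) n \<epsilon> by (auto simp: dist_norm)
  ultimately have "cmod (b x - h x) < e + e"
    using 1 norm_triangle_ineq[of "b x - f z" "h z - h x"] by (simp add: dist_norm norm_minus_commute)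
  then show False by (simp add: e_def)
qed

text \<open>Uniformity of the limits on compact sets is essential here: a point near \<open>x0\<close> is compared with its
  own foot on the ray, along whose normal it lies, and not with \<open>x0\<close>, towards which it may approach
  tangentially.\<close>

lemma continuous_across_ray:
  assumes D: "D \<ge> 4" and k: "k < D" and b: "continuous_on (Sigma_all D - {0}) b"
    and nt: "has_nontangential_values D k 1 f b" "has_nontangential_values D k (-1) f b"
    and x0: "x0 \<in> Sigma_ray D k" "x0 \<noteq> 0"
  shows "isCont (\<lambda>z. if z \<in> Sigma_all D then b z else f z) x0"
  unfolding continuous_at_eps_delta
proof (intro allI impI)
  fix e :: real assume e: "e > 0"
  define d where "d = ray_dir D (2 * k)"
  have d: "d \<noteq> 0" "cmod d = 1" by (auto simp: d_def)
  obtain t0 where t0': "t0 \<ge> 0" "x0 = of_real t0 * d" using x0(1) unfolding Sigma_ray_def d_def by auto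
  with x0(2) have t0: "t0 > 0" by (cases "t0 = 0") auto
  \<comment> \<open>A compact piece of the ray that contains the feet of all points near \<open>x0\<close>.\<close>
  define K where "K = (\<lambda>t. of_real t * d) ` {t0 / 2..2 * t0}"
  have K: "compact K" unfolding K_def by (intro compact_continuous_image continuous_intros) auto
  have Kr: "K \<subseteq> Sigma_ray D k - {0}" unfolding K_def Sigma_ray_def d_def[symmetric] using t0 d by auto
  have h: "0 < (1/2::real) \<and> (1/2::real) < 1 \<and> compact K \<and> K \<subseteq> Sigma_ray D k - {0} \<and> 0 < e / 2"
    using K Kr e by auto
  obtain d1 where d1: "d1 > 0" "\<forall>x\<in>K. \<forall>z. 0 < cmod (z - x) \<and> cmod (z - x) < d1 \<and>
      1 * Im ((z - x) / (orient D k * ray_dir D (2 * k))) \<ge> 1/2 * cmod (z - x) \<longrightarrow> cmod (f z - b x) < e / 2"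
    using nt(1)[unfolded has_nontangential_values_def Let_def, rule_format, OF h] by blast
  obtain d2 where d2: "d2 > 0" "\<forall>x\<in>K. \<forall>z. 0 < cmod (z - x) \<and> cmod (z - x) < d2 \<and>
      - 1 * Im ((z - x) / (orient D k * ray_dir D (2 * k))) \<ge> 1/2 * cmod (z - x) \<longrightarrow> cmod (f z - b x) < e / 2"
    using nt(2)[unfolded has_nontangential_values_def Let_def, rule_format, OF h] by blast
  have x0S: "x0 \<in> Sigma_all D" using x0 k unfolding Sigma_all_def by auto
  obtain d3 where d3: "d3 > 0" "\<forall>x\<in>Sigma_all D - {0}. dist x x0 < d3 \<longrightarrow> dist (b x) (b x0) < e / 2"
    using b[unfolded continuous_on_iff, rule_format, of x0 "e / 2"] x0S x0(2) e by auto
  obtain d4 where d4: "d4 > 0" "ball x0 d4 \<subseteq> sector D k"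
    using open_sector[of D k] ray_in_sector[OF D x0] by (meson openE)
  define r where "r = Min {d1, d2, d3, d4, t0 / 2}"
  have r: "r > 0" "r \<le> d1" "r \<le> d2" "r \<le> d3" "r \<le> d4" "r \<le> t0 / 2"
    using d1(1) d2(1) d3(1) d4(1) t0 unfolding r_def by auto
  show "\<exists>r>0. \<forall>z. dist z x0 < r \<longrightarrow> dist (if z \<in> Sigma_all D then b z else f z)
          (if x0 \<in> Sigma_all D then b x0 else f x0) < e"
  proof (intro exI[of _ r] conjI allI impI)
    fix z assume z: "dist z x0 < r"
    define w where "w = z / d"
    define x where "x = of_real (Re w) * d"
    have wt: "cmod (w - of_real t0) < r"
    proof -
      have "w - of_real t0 = (z - x0) / d" using d by (simp add: w_def t0'(2) field_simps)
      then show ?thesis using z d by (simp add: norm_divide dist_norm)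
    qed
    have re: "\<bar>Re w - t0\<bar> < r" using abs_Re_le_cmod[of "w - of_real t0"] wt by simp
    have im: "\<bar>Im w\<bar> < r" using abs_Im_le_cmod[of "w - of_real t0"] wt by simp
    have xK: "x \<in> K" unfolding K_def x_def using re r(6) by (intro imageI) (auto simp: abs_less_iff)
    have xS: "x \<in> Sigma_all D - {0}" using xK Kr k unfolding Sigma_all_def by auto
    have "dist x x0 = \<bar>Re w - t0\<bar>"
      unfolding x_def t0'(2) dist_norm left_diff_distrib[symmetric] norm_mult d(2)
      by (simp flip: of_real_diff)
    then have bx: "dist (b x) (b x0) < e / 2" using d3(2) xS re r(4) by auto
    have zx: "z - x = \<i> * of_real (Im w) * d"
    proof -
      have "z - x = (w - of_real (Re w)) * d" using d by (simp add: w_def x_def field_simps)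
      also have "w - of_real (Re w) = \<i> * of_real (Im w)" by (simp add: complex_eq_iff)
      finally show ?thesis .
    qed
    show "dist (if z \<in> Sigma_all D then b z else f z)
          (if x0 \<in> Sigma_all D then b x0 else f x0) < e"
    proof (cases "Im w = 0")
      case True
      then have "z = x" using zx by simp
      then show ?thesis using bx xS x0S e by auto
    next
      case False
      have "z \<in> sector D k" using d4(2) z r(5) by (auto simp: dist_commute)
      then have zS: "z \<notin> Sigma_all D" using sector_off_ray[OF D k] False unfolding w_def d_def by auto
      have nzx: "cmod (z - x) = \<bar>Im w\<bar>" unfolding zx by (simp add: norm_mult d)
      have imx: "Im ((z - x) / (orient D k * ray_dir D (2 * k))) = Re (orient D k) * Im w"
        unfolding zx d_def using orient_cases[of D k] by auto
      have "cmod (f z - b x) < e / 2"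
      proof (cases "Re (orient D k) * Im w > 0")
        case True
        then show ?thesis
          using d1(2)[rule_format, OF xK, of z] nzx imx False im r(2) orient_cases[of D k] by auto
      next
        case neg: False
        then show ?thesis
          using d2(2)[rule_format, OF xK, of z] nzx imx False im r(3) orient_cases[of D k] by auto
      qed
      then have "dist (f z) (b x) < e / 2" by (simp add: dist_norm)
      then show ?thesis using bx zS x0S dist_triangle[of "f z" "b x0" "b x"] by simp
    qed
  qed (use r in auto)
qed

text \<open>Continuity across a line implies analyticity across it, and the origin is removable because the
  function is bounded there.\<close>

lemma paste_across_contour:
  assumes D: "D \<ge> 4" and f: "f holomorphic_on - Sigma_all D"
    and b: "continuous_on (Sigma_all D - {0}) b"
    and nt: "\<And>k. k < D \<Longrightarrow> has_nontangential_values D k 1 f b"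
            "\<And>k. k < D \<Longrightarrow> has_nontangential_values D k (-1) f b"
    and bd: "d > 0" "\<And>z. z \<in> ball 0 d - Sigma_all D \<Longrightarrow> cmod (f z) \<le> M"
  obtains g where "g holomorphic_on UNIV" "\<And>z. z \<notin> Sigma_all D \<Longrightarrow> g z = f z"
proof -
  define h where "h z = (if z \<in> Sigma_all D then b z else f z)" for z
  have op: "open (- Sigma_all D)" using closed_Sigma_all by auto
  have hoff: "h holomorphic_on - Sigma_all D"
    using f by (rule holomorphic_transform) (auto simp: h_def)
  have cont: "isCont h x" if "x \<noteq> 0" for x
  proof (cases "x \<in> Sigma_all D")
    case True
    then obtain k where "k < D" "x \<in> Sigma_ray D k" unfolding Sigma_all_def by auto
    then show ?thesis unfolding h_def[abs_def] using continuous_across_ray[OF D _ b nt] that by auto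
  next
    case False
    then show ?thesis using hoff op holomorphic_on_imp_continuous_on continuous_on_eq_continuous_at by blast
  qed
  have sec: "h holomorphic_on sector D k" if k: "k < D" for k
  proof (rule holomorphic_on_paste_across_line[where d = "\<i> * ray_dir D (2 * k)" and k = 0])
    have "sector D k \<inter> {z. Im (z / ray_dir D (2 * k)) \<noteq> 0} \<subseteq> - Sigma_all D"
      using sector_off_ray[OF D k] by auto
    then show "h holomorphic_on sector D k \<inter> {z. (\<i> * ray_dir D (2 * k)) \<bullet> z < 0}"
       "h holomorphic_on sector D k \<inter> {z. 0 < (\<i> * ray_dir D (2 * k)) \<bullet> z}"
      by (auto simp: inner_rotated intro!: holomorphic_on_subset[OF hoff])
    have "z \<noteq> 0" if "z \<in> sector D k" for z using sector_Re_pos[OF D that] by auto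
    then show "continuous_on (sector D k) h"
      using cont by (intro continuous_at_imp_continuous_on) auto
  qed (auto simp: open_sector)
  have hol: "h holomorphic_on UNIV - {0}"
  proof -
    have "h field_differentiable at z" if "z \<noteq> 0" for z
    proof (cases "z \<in> Sigma_all D")
      case True
      then obtain k where k: "k < D" "z \<in> Sigma_ray D k" unfolding Sigma_all_def by auto
      then show ?thesis using sec[OF k(1)] ray_in_sector[OF D k(2) that] open_sector
        holomorphic_on_imp_differentiable_at by blast
    next
      case False
      then show ?thesis using hoff op holomorphic_on_imp_differentiable_at by blast
    qed
    then show ?thesis unfolding holomorphic_on_def using field_differentiable_at_within by blast
  qed
  have "\<forall>\<^sub>F z in at 0. cmod (h z) \<le> M"
    unfolding eventually_at_topological
  proof (intro exI[of _ "ball 0 d"] conjI ballI impI)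
    fix z :: complex assume z: "z \<in> ball 0 d" "z \<noteq> 0"
    show "cmod (h z) \<le> M"
      by (rule bound_off_contour_extends[where U = "ball 0 d" and B = "\<lambda>_. M" and D = D and f = h and x = z])
         (use z cont bd(2) in \<open>auto simp: h_def\<close>)
  qed (use bd(1) in auto)
  then obtain g where g: "g holomorphic_on UNIV" "\<forall>z\<in>UNIV - {0}. g z = h z"
    using holomorphic_on_extend_bounded[of h UNIV 0] hol by auto
  show ?thesis
  proof (rule that[OF g(1)])
    fix z assume z: "z \<notin> Sigma_all D"
    show "g z = f z"
    proof (cases "z = 0")
      case True
      have "0 \<in> Sigma_all D" using D unfolding Sigma_all_def by (auto intro!: exI[of _ 0])
      then show ?thesis using z True by auto
    qed (use g(2) z in \<open>auto simp: h_def\<close>)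
  qed
qed

text \<open>The complement of the contour is dense.\<close>

lemma entire_bound_everywhere:
  assumes "g holomorphic_on UNIV" "continuous_on {z. A < cmod z} B"
    and "\<And>z. cmod z > A \<Longrightarrow> z \<notin> Sigma_all D \<Longrightarrow> cmod (g z) \<le> B z" "cmod z > A"
  shows "cmod (g z) \<le> B z"
proof (rule bound_off_contour_extends[where U = "{z. A < cmod z}" and D = D])
  show "isCont g z"
    using holomorphic_on_imp_continuous_on[OF assms(1)] continuous_on_eq_continuous_at by blast
  show op: "open {z::complex. A < cmod z}" by (intro open_Collect_less continuous_intros)
  then show "isCont B z" using assms(2,4) continuous_on_eq_continuous_at by blast
qed (use assms in auto)

lemma entire_polynomial_growth:
  assumes g: "g holomorphic_on UNIV"
    and bd: "\<And>z. cmod z > A \<Longrightarrow> z \<notin> Sigma_all D \<Longrightarrow> cmod (g z) \<le> B * cmod z ^ m"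
  obtains p where "degree p \<le> m" "\<And>z. g z = poly p z"
proof -
  have *: "cmod (g z) \<le> B * cmod z ^ m" if "A + 1 \<le> cmod z" for z
    by (rule entire_bound_everywhere[OF g _ bd, where A = A]) (use that in \<open>auto intro!: continuous_intros\<close>)
  define p where "p = (\<Sum>k\<le>m. Polynomial.monom ((deriv ^^ k) g 0 / fact k) k)"
  have "degree p \<le> m" unfolding p_def
    by (intro degree_sum_le) (auto intro: order_trans[OF degree_monom_le])
  moreover have "g z = poly p z" for z
    using Liouville_polynomial[OF g *, where \<xi> = z] unfolding p_def by (simp add: poly_sum poly_monom)
  ultimately show ?thesis using that by blast
qed

lemma entire_vanishing_at_infinity:
  assumes g: "g holomorphic_on UNIV"
    and bd: "\<And>z. cmod z > A \<Longrightarrow> z \<notin> Sigma_all D \<Longrightarrow> cmod (g z) \<le> B / cmod z"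
  shows "g z = 0"
proof -
  define A' where "A' = max A 1"
  have *: "cmod (g z) \<le> B / cmod z" if "A' < cmod z" for z
    by (rule entire_bound_everywhere[OF g _ bd, where A = A'])
       (use that in \<open>auto simp: A'_def intro!: continuous_intros\<close>)
  have "(g \<longlongrightarrow> 0) at_infinity"
  proof (rule Lim_null_comparison)
    show "\<forall>\<^sub>F z in at_infinity. cmod (g z) \<le> B / cmod z"
      unfolding eventually_at_infinity using * by (intro exI[of _ "A' + 1"]) auto
    show "((\<lambda>z::complex. B / cmod z) \<longlongrightarrow> 0) at_infinity"
      by (rule tendsto_divide_0[OF tendsto_const filterlim_at_top_imp_at_infinity[OF filterlim_norm_at_top]])
  qed
  with g show ?thesis using Liouville_weak_0 by blast
qed

section \<open>The weight and the Sibuya solutions along their rays\<close>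

lemma decays_tendsto_0:
  assumes "decays d f" shows "((\<lambda>t. f (of_real t * d)) \<longlongrightarrow> 0) at_top"
proof -
  obtain M where M: "\<And>t. t \<ge> 0 \<Longrightarrow> t ^ 1 * cmod (f (of_real t * d)) \<le> M" using decaysE[OF assms, of 1] by metis
  show ?thesis
  proof (rule Lim_null_comparison)
    show "\<forall>\<^sub>F t in at_top. norm (f (of_real t * d)) \<le> M / t"
      using eventually_gt_at_top[of 0] by eventually_elim (use M in \<open>auto simp: field_simps\<close>)
    show "((\<lambda>t. M / t) \<longlongrightarrow> 0) at_top" by real_asymp
  qed
qed

text \<open>The fundamental theorem of calculus along a ray, with no contribution from infinity.\<close>

lemma ray_integral_deriv:
  assumes G: "\<And>z. (G has_field_derivative G' z) (at z)" and dec: "decays (ray_dir D k) G" "rapid (ray_dir D k) G'"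
  shows "ray_integral D k G' = - G 0"
proof -
  define d where "d = ray_dir D k"
  have vd: "((\<lambda>t. G (of_real t * d)) has_vector_derivative d * G' (of_real t * d)) (at t)" for t
  proof -
    have "((\<lambda>t. of_real t * d) has_vector_derivative d) (at t)"
      by (auto intro!: derivative_eq_intros simp: has_vector_derivative_def scaleR_conv_of_real)
    from field_vector_diff_chain_at[OF this G] show ?thesis by (simp add: o_def)
  qed
  have ct: "continuous (at z) (\<lambda>t::real. h (of_real t * d))" if "h holomorphic_on UNIV" for h z
  proof -
    have "continuous_on UNIV (\<lambda>t::real. h (of_real t * d))"
      by (rule continuous_on_compose2[OF holomorphic_on_imp_continuous_on[OF that]]) (auto intro!: continuous_intros)
    then show ?thesis using continuous_on_eq_continuous_at by blast
  qed
  have hG: "G holomorphic_on UNIV"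
    using G by (auto simp: holomorphic_on_def field_differentiable_def intro: has_field_derivative_at_within)
  have I: "set_integrable lborel {0..} (\<lambda>t. d * G' (of_real t * d))"
    unfolding d_def by (intro set_integrable_mult_right rapid_set_integrable dec)
  have "(LBINT t=0..\<infinity>. d * G' (of_real t * d)) = 0 - G (of_real 0 * d)"
  proof (rule interval_integral_FTC_integrable)
    show "set_integrable lborel (einterval 0 \<infinity>) (\<lambda>t. d * G' (of_real t * d))"
      by (rule set_integrable_subset[OF I]) (auto simp: einterval_def zero_ereal_def)
    have "((\<lambda>t. G (of_real t * d)) \<longlongrightarrow> G (of_real 0 * d)) (at_right 0)"
      using ct[OF hG, of 0] unfolding continuous_def by (simp add: filterlim_at_split)
    then show "(((\<lambda>t. G (of_real t * d)) \<circ> real_of_ereal) \<longlongrightarrow> G (of_real 0 * d)) (at_right 0)"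
      unfolding zero_ereal_def ereal_tendsto_simps .
    show "(((\<lambda>t. G (of_real t * d)) \<circ> real_of_ereal) \<longlongrightarrow> 0) (at_left \<infinity>)"
      unfolding ereal_tendsto_simps using decays_tendsto_0[OF dec(1)] by (simp add: d_def)
    show "isCont (\<lambda>t. d * G' (of_real t * d)) x" for x
      by (intro continuous_intros ct rapid_holo[OF dec(2)])
  qed (auto intro: vd)
  also have "(LBINT t=0..\<infinity>. d * G' (of_real t * d)) = (LBINT t:{0<..}. d * G' (of_real t * d))"
    unfolding zero_ereal_def by (rule interval_integral_to_infinity_eq)
  also have "\<dots> = (LBINT t:{0..}. d * G' (of_real t * d))"
  proof (rule set_integral_cong_set)
    show "AE x in lborel. (x \<in> {0::real..}) = (x \<in> {0<..})"
      using AE_lborel_singleton[of "0::real"] by eventually_elim auto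
    show "set_borel_measurable lborel {0<..} (\<lambda>t. d * G' (of_real t * d))"
      "set_borel_measurable lborel {0..} (\<lambda>t. d * G' (of_real t * d))"
      unfolding set_borel_measurable_def d_def using rapid_measurable[OF dec(2)] by measurable
  qed
  finally show ?thesis unfolding ray_integral_def d_def by simp
qed

lemma bounded_on_half_line:
  fixes f :: "real \<Rightarrow> 'a::real_normed_vector"
  assumes "continuous_on {0..} f" "\<And>t. t \<ge> T \<Longrightarrow> norm (f t) \<le> M"
  obtains M' where "\<And>t. t \<ge> 0 \<Longrightarrow> norm (f t) \<le> M'"
proof -
  have "compact (f ` {0..T})"
    by (intro compact_continuous_image continuous_on_subset[OF assms(1)]) auto
  then obtain B where B: "\<forall>t\<in>{0..T}. norm (f t) \<le> B"
    using compact_imp_bounded[THEN bounded_iff[THEN iffD1]] by (metis imageI)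
  show ?thesis
    by (rule that[of "max B M"]) (metis B assms(2) atLeastAtMost_iff le_max_iff_disj linorder_linear)
qed

lemma ray_direction_power:
  assumes "D > 0" shows "ray_dir D (2 * j) ^ D = 1"
proof -
  have "ray_dir D (2 * j) ^ D = cis (real D * (pi * real (2 * j) / real D))"
    unfolding ray_dir_def by (rule Complex.DeMoivre)
  also have "real D * (pi * real (2 * j) / real D) = 2 * pi * real j" using assms by simp
  also have "cis \<dots> = 1" by (rule cis_multiple_2pi) auto
  finally show ?thesis .
qed

abbreviation potential_weight :: "real poly \<Rightarrow> complex \<Rightarrow> complex" where
  "potential_weight V z \<equiv> exp (- cpoly V z)"

lemma map_poly_of_real_coeffs:
  "degree (map_poly complex_of_real p) = degree p" "lead_coeff (map_poly complex_of_real p) = of_real (lead_coeff p)"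
  by (auto simp: degree_map_poly coeff_map_poly)

text \<open>For \<open>d\<^sup>D = 1\<close> the leading term of \<open>V (t d)\<close> is \<open>g t\<^sup>D\<close>, so the real part of \<open>V\<close> eventually exceeds
  \<open>g t / 2\<close>.\<close>

lemma decays_potential_weight:
  assumes d: "d ^ D = 1" "cmod d = 1" and V: "degree V = D" "lead_coeff V > 0" "D \<ge> 1"
  shows "decays d (potential_weight V)"
  unfolding decays_def
proof
  fix m
  define g where "g = lead_coeff V"
  define W where "W = map_poly complex_of_real V"
  have W: "degree W = D" "lead_coeff W = of_real g"
    unfolding W_def g_def using map_poly_of_real_coeffs[of V] V by auto
  have g: "g > 0" using V by (simp add: g_def)
  have "((\<lambda>z. poly W z / z ^ D) \<longlongrightarrow> of_real g) at_infinity"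
    using poly_divide_tendsto_aux[of W] unfolding W(2) unfolding W(1) .
  then have "\<forall>\<^sub>F z in at_infinity. dist (poly W z / z ^ D) (of_real g) < g / 2"
    using g by (intro tendstoD) auto
  then obtain A where A: "\<And>z. cmod z \<ge> A \<Longrightarrow> dist (poly W z / z ^ D) (of_real g) < g / 2"
    unfolding eventually_at_infinity by auto
  have Re: "Re (poly W (of_real t * d)) \<ge> g / 2 * t" if t: "t \<ge> max A 1" for t
  proof -
    have "(of_real t * d) ^ D = of_real (t ^ D)" using d(1) by (simp add: power_mult_distrib)
    moreover have "cmod (of_real t * d) \<ge> A" using t d(2) by (simp add: norm_mult)
    ultimately have "dist (poly W (of_real t * d) / of_real (t ^ D)) (of_real g) < g / 2"
      using A[of "of_real t * d"] by simp
    then have "\<bar>Re (poly W (of_real t * d) / of_real (t ^ D)) - g\<bar> < g / 2"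
      using abs_Re_le_cmod[of "poly W (of_real t * d) / of_real (t ^ D) - of_real g"] by (simp add: dist_norm)
    then have "Re (poly W (of_real t * d)) / t ^ D > g / 2"
      unfolding Re_divide_of_real by linarith
    then have "Re (poly W (of_real t * d)) > g / 2 * t ^ D" using t by (simp add: field_simps)
    moreover have "t ^ 1 \<le> t ^ D" using t V(3) by (intro power_increasing) auto
    then have "g / 2 * t \<le> g / 2 * t ^ D" using g by (intro mult_left_mono) auto
    ultimately show ?thesis by linarith
  qed
  have "((\<lambda>t. t ^ m * exp (- (g / 2 * t))) \<longlongrightarrow> 0) at_top" using g by real_asymp
  then have "\<forall>\<^sub>F t in at_top. dist (t ^ m * exp (- (g / 2 * t))) 0 < 1" by (rule tendstoD) auto
  then obtain B where B: "\<And>t. t \<ge> B \<Longrightarrow> \<bar>t ^ m * exp (- (g / 2 * t))\<bar> < 1"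
    unfolding eventually_at_top_linorder by auto
  have "\<exists>M. \<forall>t\<ge>0. norm (of_real (t ^ m) * potential_weight V (of_real t * d)) \<le> M"
  proof (rule bounded_on_half_line)
    show "continuous_on {0..} (\<lambda>t. of_real (t ^ m) * potential_weight V (of_real t * d))"
      by (auto intro!: continuous_intros)
    fix t assume t: "t \<ge> max B (max A 1)"
    have "norm (of_real (t ^ m) * potential_weight V (of_real t * d)) = t ^ m * exp (- Re (poly W (of_real t * d)))"
      using t by (simp add: norm_mult norm_power W_def)
    also have "\<dots> \<le> t ^ m * exp (- (g / 2 * t))" using Re[of t] t by (intro mult_left_mono) auto
    also have "\<dots> \<le> 1" using B[of t] t by auto
    finally show "norm (of_real (t ^ m) * potential_weight V (of_real t * d)) \<le> 1" .
  qed blast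
  then show "\<exists>M. \<forall>t\<ge>0. t ^ m * cmod (potential_weight V (of_real t * d)) \<le> M"
    by (auto simp: norm_mult norm_power intro!: exI)
qed

lemma cpoly_pderiv: "poly (pderiv (map_poly complex_of_real p)) z = cpoly (pderiv p) z"
proof -
  have "pderiv (map_poly complex_of_real p) = map_poly complex_of_real (pderiv p)"
    by (rule poly_eqI) (simp add: coeff_pderiv coeff_map_poly)
  then show ?thesis by simp
qed

lemma deriv_potential_weight:
  "(potential_weight V has_field_derivative - cpoly (pderiv V) z * potential_weight V z) (at z)"
proof -
  have "(cpoly V has_field_derivative cpoly (pderiv V) z) (at z)"
    using poly_DERIV[of "map_poly complex_of_real V" z] unfolding cpoly_pderiv .
  from DERIV_chain2[OF DERIV_exp DERIV_minus[OF this]] show ?thesis by (simp add: mult.commute)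
qed

text \<open>Since \<open>phi z / z\<close> tends to \<open>1\<close>, the argument of \<open>phi z\<close> at a point \<open>z\<close> at distance at most \<open>1\<close> from
  \<open>t d\<close> is close to that of \<open>d\<close>, the direction in the middle of the region. Full discs are needed
  for the Cauchy estimate of the derivative.\<close>

lemma sibuya_region_contains_ray:
  assumes D: "D > 0" and ch: "sibuya_chart D g V rho phi psi"
  obtains T where "T \<ge> 2" "\<And>t z. t \<ge> T \<Longrightarrow> cmod (z - of_real t * ray_dir D k) \<le> 1 \<Longrightarrow> z \<in> Omega D rho psi k"
proof -
  define d where "d = ray_dir D k"
  have d: "d \<noteq> 0" "cmod d = 1" by (auto simp: d_def)
  have rho: "rho > 0" using ch unfolding sibuya_chart_def by auto
  have half: "cmod z / 2 \<le> cmod (phi z)" if "cmod z \<ge> rho" for z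
    using ch that unfolding sibuya_chart_def by auto
  obtain B where B: "\<And>z. cmod z \<ge> B \<Longrightarrow> psi (phi z) = z"
    using ch unfolding sibuya_chart_def eventually_at_infinity by auto
  have "(\<lambda>z. phi z / z - 1) \<in> O[at_infinity](\<lambda>z. 1 / z)" using ch unfolding sibuya_chart_def by auto
  then obtain c where c: "c > 0" "\<forall>\<^sub>F z in at_infinity. cmod (phi z / z - 1) \<le> c * cmod (1 / z)"
    by (rule landau_o.bigE)
  then obtain A where A: "\<And>z. cmod z \<ge> A \<Longrightarrow> cmod (phi z / z - 1) \<le> c * cmod (1 / z)"
    unfolding eventually_at_infinity by auto
  have "isCont Ln 1" by (intro continuous_at_Ln) auto
  then obtain e where e: "e > 0" "\<And>u. dist u 1 < e \<Longrightarrow> dist (Ln u) (Ln 1) < pi / D"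
    unfolding continuous_at_eps_delta using D by (metis divide_pos_pos of_nat_0_less_iff pi_gt_zero)
  \<comment> \<open>Both factors of \<open>u = a b\<close> below are within \<open>\<epsilon>\<close> of \<open>1\<close>; then \<open>u\<close> is within \<open>3 \<epsilon> < e\<close> of \<open>1\<close>.\<close>
  define \<epsilon> where "\<epsilon> = min (1/4) (e / 4)"
  have \<epsilon>: "\<epsilon> > 0" "\<epsilon> \<le> 1/4" "\<epsilon> \<le> e / 4" using e by (auto simp: \<epsilon>_def)
  define T where "T = Max {2, A + 1, B + 1, 2 * rho + 1, 1 / \<epsilon>, c / \<epsilon> + 1}"
  have T: "2 \<le> T" "A + 1 \<le> T" "B + 1 \<le> T" "2 * rho + 1 \<le> T" "1 / \<epsilon> \<le> T" "c / \<epsilon> + 1 \<le> T"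
    unfolding T_def by (auto intro: Max_ge)
  show ?thesis
  proof (rule that[OF T(1)])
    fix t z assume t: "t \<ge> T" and z: "cmod (z - of_real t * ray_dir D k) \<le> 1"
    have t2: "t \<ge> 2" using t T by linarith
    have nz: "cmod z \<ge> t - 1"
      using norm_triangle_ineq2[of "of_real t * d" z] z t2 by (simp add: d_def norm_mult norm_minus_commute)
    have z0: "z \<noteq> 0" using nz t2 by auto
    define a where "a = phi z / z"
    define b where "b = z / (of_real t * d)"
    have a1: "cmod (a - 1) \<le> \<epsilon>"
    proof -
      have "cmod (a - 1) \<le> c / cmod z" using A[of z] nz t T(2) by (simp add: a_def norm_divide)
      also have "\<dots> \<le> c / (t - 1)" using nz t2 c by (intro divide_left_mono mult_pos_pos) auto
      also have "\<dots> \<le> \<epsilon>"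
      proof -
        have "c / \<epsilon> \<le> t - 1" using t T(6) by linarith
        then show ?thesis using \<epsilon>(1) t2 by (simp add: field_simps)
      qed
      finally show ?thesis .
    qed
    have b1: "cmod (b - 1) \<le> \<epsilon>"
    proof -
      have "b - 1 = (z - of_real t * d) / (of_real t * d)" using d t2 by (simp add: b_def diff_divide_distrib)
      then have "cmod (b - 1) \<le> 1 / t" using z t2 d by (simp add: norm_divide norm_mult d_def divide_right_mono)
      also have "\<dots> \<le> \<epsilon>"
      proof -
        have "1 / \<epsilon> \<le> t" using t T(5) by linarith
        then show ?thesis using \<epsilon>(1) t2 by (simp add: field_simps)
      qed
      finally show ?thesis .
    qed
    define u where "u = a * b"
    have "u - 1 = (a - 1) * (b - 1) + (a - 1) + (b - 1)" by (simp add: u_def algebra_simps)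
    then have "cmod (u - 1) \<le> cmod (a - 1) * cmod (b - 1) + cmod (a - 1) + cmod (b - 1)"
      by (metis norm_mult norm_triangle_le norm_triangle_ineq add_mono order_refl)
    also have "\<dots> \<le> 1 * \<epsilon> + \<epsilon> + \<epsilon>" using a1 b1 \<epsilon> by (intro add_mono mult_mono) auto
    finally have u1: "cmod (u - 1) \<le> 3 * \<epsilon>" by simp
    then have "dist u 1 < e" using \<epsilon> by (simp add: dist_norm)
    then have "cmod (Ln u) < pi / D" using e(2)[of u] by (simp add: dist_norm)
    then have im: "\<bar>Im (Ln u)\<bar> \<le> pi / D" using abs_Im_le_cmod[of "Ln u"] by linarith
    have u0: "u \<noteq> 0" using u1 \<epsilon> by auto
    have phiz: "phi z = of_real t * d * u" using z0 t2 d by (simp add: u_def a_def b_def)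
    have "u = of_real (cmod u) * cis (Im (Ln u))"
      using rcis_cmod_Arg[of u] u0 by (simp add: rcis_def Arg_eq_Im_Ln)
    then have "phi z = of_real (cmod (phi z)) * cis (pi * real k / real D + Im (Ln u))"
      unfolding phiz d_def ray_dir_def using t2
      by (simp add: norm_mult cis_mult[symmetric] mult_ac)
    moreover have "pi * (real k - 1) / real D \<le> pi * real k / real D + Im (Ln u)"
      "pi * real k / real D + Im (Ln u) \<le> pi * (real k + 1) / real D"
      using im by (auto simp: abs_le_iff right_diff_distrib distrib_left diff_divide_distrib add_divide_distrib)
    moreover have "cmod (phi z) \<ge> rho" using half[of z] nz t T(4) rho by linarith
    ultimately have "phi z \<in> {w. cmod w \<ge> rho \<and> (\<exists>t. pi * (real k - 1) / real D \<le> t \<and> t \<le> pi * (real k + 1) / real D \<and>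
                    w = of_real (cmod w) * cis t)}" by blast
    moreover have "psi (phi z) = z" using B[of z] nz t T(3) by auto
    ultimately show "z \<in> Omega D rho psi k" unfolding Omega_def by (metis (no_types, lifting) imageI)
  qed
qed

text \<open>The asymptotic condition bounds the solution on discs of radius \<open>1\<close> about points of the ray, and
  Cauchy's inequality then bounds its derivative.\<close>

lemma sibuya_on_ray:
  assumes D: "D \<ge> 4" and ch: "sibuya_chart D g V rho phi psi" and f: "is_sibuya_solution D V lam rho psi k f"
  shows "\<exists>M. \<forall>t\<ge>0. cmod (f (of_real t * ray_dir D k)) \<le> M"
    "\<exists>M. \<forall>t\<ge>0. cmod (deriv f (of_real t * ray_dir D k)) \<le> M"
    "((\<lambda>t. f (of_real t * ray_dir D k)) \<longlongrightarrow> 1) at_top"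
proof -
  define d where "d = ray_dir D k"
  have d: "cmod d = 1" by (auto simp: d_def)
  have hol: "f holomorphic_on UNIV" using f unfolding is_sibuya_solution_def by auto
  obtain T where T: "T \<ge> 2" "\<And>t z. t \<ge> T \<Longrightarrow> cmod (z - of_real t * d) \<le> 1 \<Longrightarrow> z \<in> Omega D rho psi k"
    using sibuya_region_contains_ray[OF _ ch, of k] D unfolding d_def by (metis not_gr_zero not_numeral_le_zero)
  have "(\<lambda>z. f z - 1) \<in> O[inf at_infinity (principal (Omega D rho psi k))](\<lambda>z. of_real (cmod z powi (2 - int D)))"
    using f unfolding is_sibuya_solution_def by auto
  then obtain c where c: "c > 0" "\<forall>\<^sub>F z in inf at_infinity (principal (Omega D rho psi k)).
      cmod (f z - 1) \<le> c * cmod (of_real (cmod z powi (2 - int D)) :: complex)"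
    by (rule landau_o.bigE)
  then obtain A where A: "\<And>z. cmod z \<ge> A \<Longrightarrow> z \<in> Omega D rho psi k \<Longrightarrow> cmod (f z - 1) \<le> c * (cmod z powi (2 - int D))"
    unfolding eventually_inf_principal eventually_at_infinity by (auto simp: norm_power_int)
  define T' where "T' = max T (A + 1)"
  have near: "cmod (f z - 1) \<le> c / (t - 1)" if t: "t \<ge> T'" and z: "cmod (z - of_real t * d) \<le> 1" for t z
  proof -
    have nz: "cmod z \<ge> t - 1"
      using norm_triangle_ineq2[of "of_real t * d" z] z t T(1) by (simp add: T'_def d norm_mult norm_minus_commute)
    have z1: "cmod z \<ge> 1" using nz t T(1) by (simp add: T'_def)
    have "cmod (f z - 1) \<le> c * (cmod z powi (2 - int D))"
      using A[of z] T(2)[OF _ z] t nz by (auto simp: T'_def)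
    also have "cmod z powi (2 - int D) \<le> cmod z powi (- 1)"
      using z1 D by (intro power_int_increasing) auto
    then have "c * (cmod z powi (2 - int D)) \<le> c / cmod z" using c by (simp add: divide_inverse power_int_minus)
    also have "c / cmod z \<le> c / (t - 1)"
      using nz t T(1) c by (intro divide_left_mono mult_pos_pos) (auto simp: T'_def)
    finally show ?thesis .
  qed
  have near2: "cmod (f z) \<le> 1 + c" if t: "t \<ge> T'" and z: "cmod (z - of_real t * d) \<le> 1" for t z
  proof -
    have "c / (t - 1) \<le> c / 1" using t T(1) c by (intro divide_left_mono) (auto simp: T'_def)
    then show ?thesis using near[OF t z] norm_triangle_ineq2[of "f z" 1] by simp
  qed
  have cont: "continuous_on {0..} (\<lambda>t. h (of_real t * d))" if "h holomorphic_on UNIV" for h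
    by (rule continuous_on_compose2[OF holomorphic_on_imp_continuous_on[OF that]]) (auto intro!: continuous_intros)
  show "\<exists>M. \<forall>t\<ge>0. cmod (f (of_real t * ray_dir D k)) \<le> M"
    using bounded_on_half_line[OF cont[OF hol], of T' "1 + c"] near2 unfolding d_def[symmetric]
    by (metis cmod_eq_Im cmod_le diff_self norm_zero zero_le_one)
  have "cmod (deriv f (of_real t * d)) \<le> 1 + c" if t: "t \<ge> T'" for t
    using Cauchy_inequality[of f "of_real t * d" 1 "1 + c" 1] near2[OF t] holomorphic_on_subset[OF hol]
      holomorphic_on_imp_continuous_on[OF holomorphic_on_subset[OF hol]]
    by (auto simp: norm_minus_commute)
  then show "\<exists>M. \<forall>t\<ge>0. cmod (deriv f (of_real t * ray_dir D k)) \<le> M"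
    using bounded_on_half_line[OF cont[OF holomorphic_deriv[OF hol open_UNIV]]] unfolding d_def[symmetric]
    by metis
  have "((\<lambda>t. f (of_real t * d) - 1) \<longlongrightarrow> 0) at_top"
  proof (rule Lim_null_comparison)
    show "\<forall>\<^sub>F t in at_top. cmod (f (of_real t * d) - 1) \<le> c / (t - 1)"
      using eventually_ge_at_top[of T'] by eventually_elim (rule near, auto)
    show "((\<lambda>t. c / (t - 1)) \<longlongrightarrow> 0) at_top" by real_asymp
  qed
  then show "((\<lambda>t. f (of_real t * ray_dir D k)) \<longlongrightarrow> 1) at_top"
    unfolding d_def[symmetric] using LIM_zero_iff by blast
qed

section \<open>The connection formula and the dual polynomials\<close>

text \<open>The operator \<open>L\<close>; the dual polynomials are \<open>\<nu>\<^sub>n L P\<^sub>n\<close>.\<close>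

definition dual_op :: "real poly \<Rightarrow> real \<Rightarrow> complex poly \<Rightarrow> complex poly" where
  "dual_op V lam p = map_poly of_real (pderiv V) * pderiv p - pderiv (pderiv p)
     + Polynomial.smult (of_real (inverse lam)) p"

text \<open>Equals \<open>exp (-V) F k\<close> up to a constant when \<open>k\<close> is even.\<close>

definition weighted_sol :: "real poly \<Rightarrow> real \<Rightarrow> (nat \<Rightarrow> complex \<Rightarrow> complex) \<Rightarrow> nat \<Rightarrow> complex \<Rightarrow> complex" where
  "weighted_sol V lam F k z = Yfun V lam F k z * exp (- (cpoly V z / 2))"

lemma exp_minus_half_square: "exp (- (w / 2)) * exp (- (w / 2)) = exp (- (w::complex))"
  by (simp flip: exp_add)

lemma cpoly_of_real: "cpoly p (of_real x) = of_real (poly p x)"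
  by (induction p) (auto simp: map_poly_pCons)

text \<open>By the differential equation, \<open>exp (-V) d f' f\<^sup>*\<close> has along the ray in direction \<open>d = \<plusminus> 1\<close> a
  derivative with positive real part wherever \<open>f \<noteq> 0\<close>, so its real part increases to its limit \<open>0\<close>;
  it is strictly negative at the origin because \<open>f\<close> tends to \<open>1\<close>.\<close>

lemma log_derivative_sign:
  fixes f :: "complex \<Rightarrow> complex" and V :: "real poly"
  assumes lam: "lam > 0" and d: "d = 1 \<or> d = (-1 :: complex)"
    and hol: "f holomorphic_on UNIV"
    and ode: "\<And>z. deriv (deriv f) z = cpoly (pderiv V) z * deriv f z + inverse (of_real lam) * f z"
    and dec: "decays d (\<lambda>z. potential_weight V z * deriv f z)"
    and bd: "\<And>t. t \<ge> 0 \<Longrightarrow> cmod (f (of_real t * d)) \<le> M"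
    and lim: "((\<lambda>t. f (of_real t * d)) \<longlongrightarrow> 1) at_top"
  shows "Re (d * deriv f 0 * cnj (f 0)) < 0"
proof -
  define r where "r t = exp (- poly V (Re (of_real t * d)))" for t
  have r: "potential_weight V (of_real t * d) = of_real (r t)" "r t > 0" for t
  proof -
    have "of_real t * d = of_real (Re (of_real t * d))" using d by (auto simp: complex_eq_iff)
    then have "cpoly V (of_real t * d) = of_real (poly V (Re (of_real t * d)))"
      by (metis cpoly_of_real)
    then show "potential_weight V (of_real t * d) = of_real (r t)" "r t > 0"
      unfolding r_def by (simp_all flip: exp_of_real)
  qed
  have dr: "cnj d = d" "d * d = 1" using d by auto
  have D1: "(f has_field_derivative deriv f z) (at z)" for z
    using hol holomorphic_derivI[of f UNIV z] by auto
  have D2: "(deriv f has_field_derivative deriv (deriv f) z) (at z)" for z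
    using holomorphic_derivI[OF holomorphic_deriv[OF hol open_UNIV] open_UNIV, of z] by auto
  have vd: "((\<lambda>t. of_real t * d) has_vector_derivative d) (at t)" for t
    by (auto intro!: derivative_eq_intros simp: has_vector_derivative_def scaleR_conv_of_real)
  define u where "u z = potential_weight V z * deriv f z" for z
  have Du: "(u has_field_derivative potential_weight V z * f z * inverse (of_real lam)) (at z)" for z
    unfolding u_def
    using DERIV_mult[OF deriv_potential_weight[of V z] D2[of z]]
    by (rule DERIV_cong) (simp add: ode algebra_simps)
  define m where "m t = Re (d * u (of_real t * d) * cnj (f (of_real t * d)))" for t
  have Dm: "(m has_real_derivative r t * (cmod (f (of_real t * d)) ^ 2 / lam + cmod (deriv f (of_real t * d)) ^ 2)) (at t)" for t
  proof -
    let ?z = "of_real t * d"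
    have 1: "((\<lambda>t. u (of_real t * d)) has_vector_derivative d * (potential_weight V ?z * f ?z * inverse (of_real lam))) (at t)"
      using field_vector_diff_chain_at[OF vd Du] by (simp add: o_def)
    have "((\<lambda>t. f (of_real t * d)) has_vector_derivative d * deriv f ?z) (at t)"
      using field_vector_diff_chain_at[OF vd D1] by (simp add: o_def)
    then have 2: "((\<lambda>t. cnj (f (of_real t * d))) has_vector_derivative cnj (d * deriv f ?z)) (at t)"
      by (rule bounded_linear.has_vector_derivative[OF bounded_linear_cnj])
    have "((\<lambda>t. d * (u (of_real t * d) * cnj (f (of_real t * d)))) has_vector_derivative
       d * (u ?z * cnj (d * deriv f ?z) + d * (potential_weight V ?z * f ?z * inverse (of_real lam)) * cnj (f ?z))) (at t)"
      by (intro has_vector_derivative_mult_right has_vector_derivative_mult 1 2)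
    then have A: "(m has_vector_derivative
       Re (d * (u ?z * cnj (d * deriv f ?z) + d * (potential_weight V ?z * f ?z * inverse (of_real lam)) * cnj (f ?z)))) (at t)"
      unfolding m_def[abs_def] mult.assoc by (rule bounded_linear.has_vector_derivative[OF bounded_linear_Re])
    have B: "d * (u ?z * cnj (d * deriv f ?z) + d * (potential_weight V ?z * f ?z * inverse (of_real lam)) * cnj (f ?z))
       = of_real (r t * (cmod (f ?z) ^ 2 / lam + cmod (deriv f ?z) ^ 2))"
    proof -
      have "d * (u ?z * cnj (d * deriv f ?z) + d * (potential_weight V ?z * f ?z * inverse (of_real lam)) * cnj (f ?z))
        = (d * d) * (of_real (r t) * (f ?z * cnj (f ?z) * inverse (of_real lam) + deriv f ?z * cnj (deriv f ?z)))"
        unfolding u_def r(1) by (simp add: dr(1) algebra_simps)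
      then show ?thesis unfolding dr(2) complex_norm_square[symmetric] by (simp add: divide_inverse)
    qed
    show ?thesis
      using A unfolding B Re_complex_of_real has_real_derivative_iff_has_vector_derivative .
  qed
  have mono: "m s \<le> m t" if "s \<le> t" for s t
    using that
  proof (rule DERIV_nonneg_imp_nondecreasing)
    fix t
    have "0 \<le> r t * (cmod (f (of_real t * d)) ^ 2 / lam + cmod (deriv f (of_real t * d)) ^ 2)"
      using less_imp_le[OF r(2)] lam by (intro mult_nonneg_nonneg add_nonneg_nonneg) auto
    then show "\<exists>y. (m has_real_derivative y) (at t) \<and> 0 \<le> y" using Dm by blast
  qed
  have "decays d (\<lambda>z. cnj (f z) * u z)"
    by (rule decays_bounded_mult[where C = M]) (use dec bd in \<open>auto simp: u_def[abs_def]\<close>)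
  then have "((\<lambda>t. cnj (f (of_real t * d)) * u (of_real t * d)) \<longlongrightarrow> 0) at_top" by (rule decays_tendsto_0)
  then have "((\<lambda>t. Re (d * (cnj (f (of_real t * d)) * u (of_real t * d)))) \<longlongrightarrow> Re (d * 0)) at_top"
    by (intro tendsto_intros)
  then have m0: "(m \<longlongrightarrow> 0) at_top" unfolding m_def[abs_def] by (simp add: mult_ac)
  have mle: "m t \<le> 0" for t
  proof -
    have "\<forall>\<^sub>F s in at_top. m t \<le> m s"
      using eventually_ge_at_top[of t] by eventually_elim (rule mono)
    then show ?thesis by (rule tendsto_lowerbound[OF m0]) simp
  qed
  have "\<forall>\<^sub>F t in at_top. dist (f (of_real t * d)) 1 < 1" using lim by (rule tendstoD) auto
  then obtain T where T: "\<And>t. t \<ge> T \<Longrightarrow> dist (f (of_real t * d)) 1 < 1"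
    unfolding eventually_at_top_linorder by auto
  \<comment> \<open>Beyond \<open>s\<close> the solution has no zeros, so \<open>m\<close> increases strictly there.\<close>
  define s where "s = max T 0"
  have "m s < m (s + 1)"
  proof (rule DERIV_pos_imp_increasing[of s "s + 1" m])
    fix t assume t: "s \<le> t" "t \<le> s + 1"
    have "f (of_real t * d) \<noteq> 0" using T[of t] t by (auto simp: s_def)
    then have "0 < r t * (cmod (f (of_real t * d)) ^ 2 / lam + cmod (deriv f (of_real t * d)) ^ 2)"
      using r(2)[of t] lam by (intro mult_pos_pos add_pos_nonneg) auto
    then show "\<exists>y. (m has_real_derivative y) (at t) \<and> 0 < y" using Dm by blast
  qed simp
  then have "m 0 < 0" using mono[of 0 s] mle[of "s + 1"] by (simp add: s_def)
  moreover have "m 0 = r 0 * Re (d * deriv f 0 * cnj (f 0))"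
    using r(1)[of 0] by (simp add: m_def u_def algebra_simps)
  ultimately show ?thesis using r(2)[of 0] by (simp add: mult_less_0_iff)
qed

text \<open>The hypotheses of the theorem that concern the potential and the Sibuya solutions.\<close>

locale sibuya_setting =
  fixes D :: nat and lam g rho :: real and V :: "real poly"
    and phi psi :: "complex \<Rightarrow> complex" and F :: "nat \<Rightarrow> complex \<Rightarrow> complex"
  assumes D4: "D \<ge> 4" and even_D: "even D" and lam_pos: "lam > 0"
    and degree_V: "degree V = D" and lead_V: "lead_coeff V = g" and g_pos: "g > 0"
    and chart: "sibuya_chart D g V rho phi psi"
    and sibuya: "\<And>k. k < 2 * D \<Longrightarrow> is_sibuya_solution D V lam rho psi k (F k)"
begin

abbreviation "w \<equiv> potential_weight V"
abbreviation "Y \<equiv> Yfun V lam F"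
abbreviation "G \<equiv> weighted_sol V lam F"

definition Yfactor :: "nat \<Rightarrow> complex" where
  "Yfactor k = \<i> ^ k * exp (- \<i> * of_real pi / 4)"

lemma Yfactor_nz: "Yfactor k \<noteq> 0" by (simp add: Yfactor_def)

lemma F_holomorphic: "k < 2 * D \<Longrightarrow> F k holomorphic_on UNIV"
  using sibuya[of k] unfolding is_sibuya_solution_def by blast

lemma F_deriv: "k < 2 * D \<Longrightarrow> (F k has_field_derivative deriv (F k) z) (at z)"
  using F_holomorphic holomorphic_derivI[of "F k" UNIV z] by auto

lemma F_deriv2: "k < 2 * D \<Longrightarrow> (deriv (F k) has_field_derivative deriv (deriv (F k)) z) (at z)"
  using holomorphic_derivI[OF holomorphic_deriv[OF F_holomorphic open_UNIV] open_UNIV, of k z] by auto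

lemma F_ode:
  assumes "k < 2 * D" "even k"
  shows "deriv (deriv (F k)) z = cpoly (pderiv V) z * deriv (F k) z + inverse (of_real lam) * F k z"
proof -
  have "(-1) ^ k * cpoly (pderiv V) z * deriv (F k) z - deriv (deriv (F k)) z + inverse (of_real lam) * F k z = 0"
    using sibuya[OF assms(1)] unfolding is_sibuya_solution_def by blast
  then show ?thesis using assms(2) by (simp add: algebra_simps)
qed

lemma weight_F_deriv:
  assumes "k < 2 * D"
  shows "((\<lambda>z. w z * F k z) has_field_derivative w z * deriv (F k) z - cpoly (pderiv V) z * (w z * F k z)) (at z)"
  using DERIV_mult[OF deriv_potential_weight[of V z] F_deriv[OF assms, of z]]
  by (rule DERIV_cong) (simp add: algebra_simps)

lemma weight_F'_deriv:
  assumes "k < 2 * D" "even k"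
  shows "((\<lambda>z. w z * deriv (F k) z) has_field_derivative inverse (of_real lam) * (w z * F k z)) (at z)"
  using DERIV_mult[OF deriv_potential_weight[of V z] F_deriv2[OF assms(1), of z]]
  by (rule DERIV_cong) (simp add: F_ode[OF assms] algebra_simps)

lemma decays_weight: "decays (ray_dir D (2 * j)) w"
  using D4 degree_V lead_V g_pos by (intro decays_potential_weight[where D = D] ray_direction_power) auto

lemma rapid_weight: "rapid (ray_dir D (2 * j)) w"
proof (rule rapidI[OF deriv_potential_weight])
  have "decays (ray_dir D (2 * j)) (\<lambda>z. (- 1) * (poly (map_poly of_real (pderiv V)) z * w z))"
    by (intro decays_cmult decays_poly decays_weight)
  then show "decays (ray_dir D (2 * j)) (\<lambda>z. - cpoly (pderiv V) z * w z)" by simp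
qed (rule decays_weight)

lemma decays_weight_F:
  assumes "j < D"
  shows "decays (ray_dir D (2 * j)) (\<lambda>z. w z * F (2 * j) z)"
    "decays (ray_dir D (2 * j)) (\<lambda>z. w z * deriv (F (2 * j)) z)"
proof -
  have s: "is_sibuya_solution D V lam rho psi (2 * j) (F (2 * j))" using sibuya assms by auto
  obtain M where M: "\<And>t. t \<ge> 0 \<Longrightarrow> cmod (F (2 * j) (of_real t * ray_dir D (2 * j))) \<le> M"
    using sibuya_on_ray(1)[OF D4 chart s] by blast
  obtain N where N: "\<And>t. t \<ge> 0 \<Longrightarrow> cmod (deriv (F (2 * j)) (of_real t * ray_dir D (2 * j))) \<le> N"
    using sibuya_on_ray(2)[OF D4 chart s] by blast
  show "decays (ray_dir D (2 * j)) (\<lambda>z. w z * F (2 * j) z)"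
    "decays (ray_dir D (2 * j)) (\<lambda>z. w z * deriv (F (2 * j)) z)"
    using decays_bounded_mult[where u = "F (2 * j)", OF decays_weight M]
      decays_bounded_mult[where u = "deriv (F (2 * j))", OF decays_weight N]
    by (simp_all add: mult.commute)
qed

lemma rapid_weight_F:
  assumes "j < D"
  shows "rapid (ray_dir D (2 * j)) (\<lambda>z. w z * F (2 * j) z)"
proof (rule rapidI[OF weight_F_deriv])
  have "decays (ray_dir D (2 * j)) (\<lambda>z. w z * deriv (F (2 * j)) z
     + (- 1) * (poly (map_poly of_real (pderiv V)) z * (w z * F (2 * j) z)))"
    by (intro decays_add decays_cmult decays_poly decays_weight_F assms)
  then show "decays (ray_dir D (2 * j)) (\<lambda>z. w z * deriv (F (2 * j)) z - cpoly (pderiv V) z * (w z * F (2 * j) z))"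
    by simp
qed (use assms decays_weight_F in auto)

lemma G_eq: "G (2 * j) z = Yfactor (2 * j) * (w z * F (2 * j) z)"
  unfolding weighted_sol_def Yfun_def Yfactor_def exp_minus_half_square[of "cpoly V z", symmetric] by simp

lemma rapid_G: "j < D \<Longrightarrow> rapid (ray_dir D (2 * j)) (G (2 * j))"
  unfolding G_eq[abs_def] by (intro rapid_cmult rapid_weight_F)

lemma Y_deriv:
  assumes "j < D"
  shows "deriv (Y (2 * j)) z = Yfactor (2 * j) * exp (- (cpoly V z / 2)) *
     (deriv (F (2 * j)) z - cpoly (pderiv V) z / 2 * F (2 * j) z)"
proof (rule DERIV_imp_deriv)
  have "(cpoly V has_field_derivative cpoly (pderiv V) z) (at z)"
    using poly_DERIV[of "map_poly complex_of_real V" z] unfolding cpoly_pderiv .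
  from DERIV_chain2[OF DERIV_exp DERIV_minus[OF DERIV_cdivide[OF this, of 2]]]
  have "((\<lambda>z. exp (- (cpoly V z / 2))) has_field_derivative exp (- (cpoly V z / 2)) * - (cpoly (pderiv V) z / 2)) (at z)" .
  note E = this
  have k: "2 * j < 2 * D" using assms by simp
  have "((\<lambda>z. Yfactor (2 * j) * (exp (- (cpoly V z / 2)) * F (2 * j) z)) has_field_derivative
     Yfactor (2 * j) * exp (- (cpoly V z / 2)) * (deriv (F (2 * j)) z - cpoly (pderiv V) z / 2 * F (2 * j) z)) (at z)"
    by (rule DERIV_cong[OF DERIV_cmult[OF DERIV_mult[OF E F_deriv[OF k]]]]) (simp add: algebra_simps)
  moreover have "Y (2 * j) = (\<lambda>z. Yfactor (2 * j) * (exp (- (cpoly V z / 2)) * F (2 * j) z))"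
    by (simp add: Yfun_def Yfactor_def fun_eq_iff)
  ultimately show "(Y (2 * j) has_field_derivative
     Yfactor (2 * j) * exp (- (cpoly V z / 2)) * (deriv (F (2 * j)) z - cpoly (pderiv V) z / 2 * F (2 * j) z)) (at z)"
    by simp
qed

lemma Y_eq: "Y (2 * j) z = Yfactor (2 * j) * exp (- (cpoly V z / 2)) * F (2 * j) z"
  by (simp add: Yfun_def Yfactor_def)

definition half :: nat where "half = D div 2"

lemma half: "2 * half = D" "half < D" "half \<noteq> 0"
  using even_D D4 by (auto simp: half_def)

lemma F_log_derivative_signs:
  "Re (deriv (F 0) 0 * cnj (F 0 0)) < 0" "Re (deriv (F D) 0 * cnj (F D 0)) > 0"
proof -
  have *: "Re (ray_dir D (2 * j) * deriv (F (2 * j)) 0 * cnj (F (2 * j) 0)) < 0"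
    if j: "j < D" "ray_dir D (2 * j) = 1 \<or> ray_dir D (2 * j) = -1" for j
  proof -
    have s: "is_sibuya_solution D V lam rho psi (2 * j) (F (2 * j))" using sibuya j by auto
    obtain M where M: "\<And>t. t \<ge> 0 \<Longrightarrow> cmod (F (2 * j) (of_real t * ray_dir D (2 * j))) \<le> M"
      using sibuya_on_ray(1)[OF D4 chart s] by blast
    show ?thesis
      by (rule log_derivative_sign[OF lam_pos j(2) _ F_ode decays_weight_F(2) M sibuya_on_ray(3)[OF D4 chart s]])
         (use j F_holomorphic in auto)
  qed
  have "ray_dir D (2 * 0) = 1" by (simp add: ray_dir_def)
  then show "Re (deriv (F 0) 0 * cnj (F 0 0)) < 0" using *[of 0] D4 by simp
  have "ray_dir D (2 * half) = -1" using half D4 by (simp add: ray_dir_def)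
  then show "Re (deriv (F D) 0 * cnj (F D 0)) > 0" using *[of half] half by simp
qed

text \<open>A vanishing Wronskian would make the logarithmic derivatives of \<open>F 0\<close> and \<open>F D\<close> at the origin equal,
  but their real parts have opposite signs.\<close>

lemma wronskian_nonzero: "wronskian (Y 0) (Y D) 0 \<noteq> 0"
proof
  define e where "e = exp (- (cpoly V 0 / 2))"
  assume "wronskian (Y 0) (Y D) 0 = 0"
  moreover have "Y 0 0 = Yfactor 0 * e * F 0 0" "Y D 0 = Yfactor D * e * F D 0"
    using Y_eq[of 0 0] Y_eq[of half 0] unfolding half e_def by simp_all
  moreover have "deriv (Y 0) 0 = Yfactor 0 * e * (deriv (F 0) 0 - cpoly (pderiv V) 0 / 2 * F 0 0)"
    "deriv (Y D) 0 = Yfactor D * e * (deriv (F D) 0 - cpoly (pderiv V) 0 / 2 * F D 0)"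
    using Y_deriv[of 0 0] Y_deriv[of half 0] half D4 unfolding e_def by simp_all
  ultimately have "(Yfactor 0 * e * Yfactor D * e) * (F 0 0 * deriv (F D) 0 - deriv (F 0) 0 * F D 0) = 0"
    unfolding wronskian_def by (simp only:) (simp only: algebra_simps, simp?)
  then have W: "F 0 0 * deriv (F D) 0 = deriv (F 0) 0 * F D 0"
    using Yfactor_nz by (simp add: e_def)
  have re: "Re (x * of_real b) = Re x * b" for x b by simp
  have nz: "F 0 0 \<noteq> 0" "F D 0 \<noteq> 0" using F_log_derivative_signs by auto
  have "deriv (F D) 0 * cnj (F D 0) * (cmod (F 0 0))\<^sup>2 = deriv (F 0) 0 * cnj (F 0 0) * (cmod (F D 0))\<^sup>2"
    unfolding complex_norm_square using W by (simp add: algebra_simps)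
  then have "Re (deriv (F D) 0 * cnj (F D 0) * of_real ((cmod (F 0 0))\<^sup>2))
      = Re (deriv (F 0) 0 * cnj (F 0 0) * of_real ((cmod (F D 0))\<^sup>2))" by simp
  then have "Re (deriv (F D) 0 * cnj (F D 0)) * (cmod (F 0 0))\<^sup>2
      = Re (deriv (F 0) 0 * cnj (F 0 0)) * (cmod (F D 0))\<^sup>2"
    unfolding re .
  moreover have "Re (deriv (F D) 0 * cnj (F D 0)) * (cmod (F 0 0))\<^sup>2 > 0"
    using F_log_derivative_signs nz by (intro mult_pos_pos) auto
  moreover have "Re (deriv (F 0) 0 * cnj (F 0 0)) * (cmod (F D 0))\<^sup>2 < 0"
    using F_log_derivative_signs nz by (intro mult_neg_pos) auto
  ultimately show False by linarith
qed

abbreviation "\<beta> \<equiv> beta D V lam F"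
abbreviation "\<kappa> \<equiv> kappa D V lam F"

text \<open>Cramer's rule for the expansion of \<open>Y\<^sub>2\<^sub>j\<close> in \<open>Y\<^sub>0\<close> and \<open>Y\<^sub>D\<close>. Equality of the Cauchy data at the
  origin is all that the boundary terms below involve.\<close>

lemma connection_at_0:
  "Y (2 * j) 0 = \<beta> j * Y 0 0 + \<kappa> j * Y D 0"
  "deriv (Y (2 * j)) 0 = \<beta> j * deriv (Y 0) 0 + \<kappa> j * deriv (Y D) 0"
proof -
  define W where "W = wronskian (Y 0) (Y D) 0"
  have W: "W \<noteq> 0" "Y 0 0 * deriv (Y D) 0 - deriv (Y 0) 0 * Y D 0 = W"
    using wronskian_nonzero by (auto simp: W_def wronskian_def)
  have cramer: "x = (- (c * y' - c' * y) / W) * a + ((b * y' - b' * y) / W) * d"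
    if "(- (c * y' - c' * y)) * a + (b * y' - b' * y) * d = x * W" for x y y' a b b' c c' d
  proof -
    have "(- (c * y' - c' * y) / W) * a + ((b * y' - b' * y) / W) * d
      = ((- (c * y' - c' * y)) * a + (b * y' - b' * y) * d) / W"
      by (simp only: times_divide_eq_left add_divide_distrib)
    then show ?thesis unfolding that using W(1) by simp
  qed
  show "Y (2 * j) 0 = \<beta> j * Y 0 0 + \<kappa> j * Y D 0"
    unfolding beta_def kappa_def W_def[symmetric] wronskian_def[of _ "Y (2 * j)"]
    by (rule cramer) (simp add: W(2)[symmetric] algebra_simps)
  show "deriv (Y (2 * j)) 0 = \<beta> j * deriv (Y 0) 0 + \<kappa> j * deriv (Y D) 0"
    unfolding beta_def kappa_def W_def[symmetric] wronskian_def[of _ "Y (2 * j)"]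
    by (rule cramer) (simp add: W(2)[symmetric] algebra_simps)
qed

text \<open>The operator \<open>L\<close> is formally self-adjoint with weight \<open>exp (-V)\<close> and annihilates \<open>F\<close>, so the
  integrand is the derivative of \<open>exp (-V) (p F' - p' F)\<close> up to a constant factor; the result is the
  boundary term at the origin.\<close>

lemma ray_integral_dual:
  assumes j: "j < D"
  shows "ray_integral D (2 * j) (\<lambda>z. G (2 * j) z * poly (dual_op V lam p) z)
    = exp (- (cpoly V 0 / 2)) * (poly (pderiv p) 0 * Y (2 * j) 0 -
        poly p 0 * (deriv (Y (2 * j)) 0 + cpoly (pderiv V) 0 / 2 * Y (2 * j) 0))"
proof -
  define c where "c = Yfactor (2 * j)"
  define H where "H z = c * (poly p z * (w z * deriv (F (2 * j)) z)) + (- c) * (poly (pderiv p) z * (w z * F (2 * j) z))" for z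
  have k: "2 * j < 2 * D" "even (2 * j)" using j by auto
  have D0: "(H has_field_derivative G (2 * j) z * poly (dual_op V lam p) z) (at z)" for z
    unfolding H_def
    by (rule DERIV_cong[OF DERIV_add[OF DERIV_cmult[OF DERIV_mult[OF poly_DERIV weight_F'_deriv[OF k]]]
          DERIV_cmult[OF DERIV_mult[OF poly_DERIV weight_F_deriv[OF k(1)]]]]])
       (unfold G_eq dual_op_def c_def, simp add: algebra_simps)
  have "decays (ray_dir D (2 * j)) H" unfolding H_def[abs_def]
    by (intro decays_add decays_cmult decays_poly decays_weight_F j)
  moreover have "rapid (ray_dir D (2 * j)) (\<lambda>z. G (2 * j) z * poly (dual_op V lam p) z)"
    using rapid_poly[OF rapid_G[OF j]] by (simp add: mult.commute)
  ultimately have "ray_integral D (2 * j) (\<lambda>z. G (2 * j) z * poly (dual_op V lam p) z) = - H 0"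
    by (rule ray_integral_deriv[OF D0])
  also have "\<dots> = exp (- (cpoly V 0 / 2)) * (poly (pderiv p) 0 * Y (2 * j) 0 -
        poly p 0 * (deriv (Y (2 * j)) 0 + cpoly (pderiv V) 0 / 2 * Y (2 * j) 0))"
    unfolding H_def Y_deriv[OF j] Y_eq exp_minus_half_square[of "cpoly V 0", symmetric] c_def by (simp add: algebra_simps)
  finally show ?thesis .
qed

lemma Theta_eq:
  "Theta D V lam F j Q = 1 / (2 * of_real pi * \<i>) *
     (- ray_integral D (2 * j) (\<lambda>z. G (2 * j) z * poly Q z)
      + \<beta> j * ray_integral D 0 (\<lambda>z. G 0 z * poly Q z)
      + \<kappa> j * ray_integral D D (\<lambda>z. G D z * poly Q z))"
  by (simp add: Theta_def weighted_sol_def)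

text \<open>The boundary terms are linear in the Cauchy data of \<open>Y\<^sub>2\<^sub>j\<close>, \<open>Y\<^sub>0\<close> and \<open>Y\<^sub>D\<close>, and these satisfy the
  connection formula.\<close>

lemma Theta_dual:
  assumes j: "j < D"
  shows "Theta D V lam F j (dual_op V lam p) = 0"
proof -
  have r0: "ray_integral D 0 (\<lambda>z. G 0 z * poly (dual_op V lam p) z)
    = exp (- (cpoly V 0 / 2)) * (poly (pderiv p) 0 * Y 0 0 -
        poly p 0 * (deriv (Y 0) 0 + cpoly (pderiv V) 0 / 2 * Y 0 0))"
    using ray_integral_dual[of 0 p] D4 by simp
  have rD: "ray_integral D D (\<lambda>z. G D z * poly (dual_op V lam p) z)
    = exp (- (cpoly V 0 / 2)) * (poly (pderiv p) 0 * Y D 0 -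
        poly p 0 * (deriv (Y D) 0 + cpoly (pderiv V) 0 / 2 * Y D 0))"
    using ray_integral_dual[OF half(2), of p] unfolding half .
  have alg: "- (e * (p' * (b * x + k * y) - p0 * ((b * x' + k * y') + v * (b * x + k * y))))
     + b * (e * (p' * x - p0 * (x' + v * x))) + k * (e * (p' * y - p0 * (y' + v * y))) = 0"
    for e p' p0 b k x x' y y' v :: complex
    by (simp add: algebra_simps)
  show ?thesis
    unfolding Theta_eq ray_integral_dual[OF j] r0 rD connection_at_0[of j] alg by simp
qed

end

section \<open>Densities and moments\<close>

lemma ray_integral_cong:
  assumes "\<And>x. x \<in> Sigma_ray D k \<Longrightarrow> x \<noteq> 0 \<Longrightarrow> f x = h x"
  shows "ray_integral D (2 * k) f = ray_integral D (2 * k) h"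
proof -
  have *: "(LBINT t:{0..}. u t) = (LBINT t:{0<..}. u t)" for u :: "real \<Rightarrow> complex"
    by (rule set_integral_discrete_difference[where X = "{0}"]) auto
  have "(LBINT t:{0<..}. f (of_real t * ray_dir D (2 * k))) = (LBINT t:{0<..}. h (of_real t * ray_dir D (2 * k)))"
  proof (rule set_lebesgue_integral_cong)
    show "\<forall>t. t \<in> {0<..} \<longrightarrow> f (of_real t * ray_dir D (2 * k)) = h (of_real t * ray_dir D (2 * k))"
      using assms unfolding Sigma_ray_def by fastforce
  qed auto
  then show ?thesis unfolding ray_integral_def * by simp
qed

lemma set_integrable_reflect_half_line:
  fixes f :: "real \<Rightarrow> complex"
  assumes "set_integrable lborel {0..} (\<lambda>t. f (- t))"
  shows "set_integrable lborel {..0} f"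
proof -
  have "integrable lborel (\<lambda>t. indicator {0..} t *\<^sub>R f (- t))"
    using assms unfolding set_integrable_def .
  then have "integrable lborel (\<lambda>t. indicator {0..} (- t) *\<^sub>R f (- (- t)))"
    using lborel_integrable_real_affine[of "\<lambda>t. indicator {0..} t *\<^sub>R f (- t)" "-1" 0] by simp
  moreover have "(\<lambda>t. indicator {0..} (- t) *\<^sub>R f (- (- t))) = (\<lambda>t. indicator {..0} t *\<^sub>R f t)"
    by (auto simp: indicator_def fun_eq_iff)
  ultimately show ?thesis unfolding set_integrable_def by simp
qed

lemma integrable_real_line:
  fixes f :: "real \<Rightarrow> complex"
  assumes "set_integrable lborel {0..} f" "set_integrable lborel {0..} (\<lambda>t. f (- t))"
  shows "integrable lborel f"
proof -
  have "set_integrable lborel ({0..} \<union> {..0}) f"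
    by (intro set_integrable_Un assms(1) set_integrable_reflect_half_line[OF assms(2)]) auto
  moreover have "{0..} \<union> {..0} = (UNIV :: real set)" by auto
  ultimately show ?thesis by (simp add: set_integrable_def)
qed

lemma integral_real_line_split:
  fixes f :: "real \<Rightarrow> complex"
  assumes "set_integrable lborel {0..} f" "set_integrable lborel {0..} (\<lambda>t. f (- t))"
  shows "(LBINT x. f x) = (LBINT t:{0..}. f t) + (LBINT t:{0..}. f (- t))"
proof -
  have neg: "set_integrable lborel {..<0} f"
    by (rule set_integrable_subset[OF set_integrable_reflect_half_line[OF assms(2)]]) auto
  have "{0..} \<union> {..<0} = (UNIV :: real set)" by auto
  then have "(LBINT x. f x) = (LBINT x:{0..} \<union> {..<0}. f x)"
    by (simp add: set_lebesgue_integral_def)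
  also have "\<dots> = (LBINT x:{0..}. f x) + (LBINT x:{..<0}. f x)"
    by (rule set_integral_Un) (use assms(1) neg in auto)
  also have "(LBINT x:{..<0}. f x) = (LBINT x:{..0}. f x)"
    by (rule set_integral_discrete_difference[where X = "{0}"]) auto
  also have "\<dots> = (LBINT t:{0..}. f (- t))"
    using set_integral_reflect[of "{..0}" f] by (simp add: atLeast_def)
  finally show ?thesis .
qed

lemma sum_rays_eq:
  assumes "S \<subseteq> {..<D}" "\<And>k. k \<notin> S \<Longrightarrow> X k = 0"
  shows "(\<Sum>k<D. orient D k * X k) = (\<Sum>k\<in>S. orient D k * X k)"
  using assms by (intro sum.mono_neutral_right) auto

lemma Xi_shift: "Xi V k q = Xi V 0 (q * Polynomial.monom 1 k)"
  by (simp add: Xi_def poly_monom mult_ac)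

context sibuya_setting
begin

lemma ray_dir_0 [simp]: "ray_dir D 0 = 1" by (simp add: ray_dir_def)

lemma ray_dir_D [simp]: "ray_dir D D = - 1" using D4 by (simp add: ray_dir_def)

lemma orient_values: "orient D 0 = 1" "orient D half = -1" "j \<noteq> half \<Longrightarrow> orient D j = 1"
  using half by (auto simp: orient_def half_def)

lemma weight_indexD:
  assumes "j \<in> weight_indices D" shows "j < D" "j \<noteq> 0" "j \<noteq> half"
  using assms D4 by (auto simp: weight_indices_def half_def)

text \<open>The real line consists of the rays \<open>0\<close> and \<open>half\<close>.\<close>

definition real_density :: "complex poly \<Rightarrow> nat \<Rightarrow> complex \<Rightarrow> complex" where
  "real_density q k x = (if k = 0 \<or> k = half then poly q x * w x else 0)"

text \<open>The \<open>k\<close>-th component is the entire function to which \<open>poly q\<close> times the \<open>j\<close>-th weight restricts on the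
  \<open>k\<close>-th ray.\<close>

definition omega_density :: "nat \<Rightarrow> complex poly \<Rightarrow> nat \<Rightarrow> complex \<Rightarrow> complex" where
  "omega_density j q k x = (if k = j then poly q x * G (2 * j) x
     else if k = 0 then - \<beta> j * (poly q x * G 0 x)
     else if k = half then \<kappa> j * (poly q x * G D x) else 0)"

lemma rapid_real_density: "rapid_densities D (real_density q)"
  unfolding rapid_densities_def real_density_def
proof (intro allI impI)
  fix k show "rapid (ray_dir D (2 * k)) (\<lambda>x. if k = 0 \<or> k = half then poly q x * w x else 0)"
    using rapid_poly[OF rapid_weight] rapid_zero by (cases "k = 0 \<or> k = half") auto
qed

lemma rapid_omega_density:
  assumes "j < D" shows "rapid_densities D (omega_density j q)"
  unfolding rapid_densities_def
proof (intro allI impI)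
  fix k assume k: "k < D"
  have *: "rapid (ray_dir D (2 * l)) (\<lambda>x. poly q x * G (2 * l) x)" if "l < D" for l
    using rapid_poly[OF rapid_G[OF that]] .
  consider "k = j" | "k \<noteq> j" "k = 0" | "k \<noteq> j" "k \<noteq> 0" "k = half" | "k \<noteq> j" "k \<noteq> 0" "k \<noteq> half" by blast
  then show "rapid (ray_dir D (2 * k)) (omega_density j q k)"
  proof cases
    case 1
    then show ?thesis using *[OF k] by (simp add: omega_density_def[abs_def])
  next
    case 2
    then show ?thesis using rapid_cmult[OF *[of 0], of "- \<beta> j"] D4 by (simp add: omega_density_def[abs_def])
  next
    case 3
    then show ?thesis using rapid_cmult[OF *[OF k], of "\<kappa> j"] half by (simp add: omega_density_def[abs_def])
  next
    case 4
    then show ?thesis using rapid_zero by (simp add: omega_density_def[abs_def])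
  qed
qed

lemma real_density_balanced: "(\<Sum>k<D. orient D k * real_density q k 0) = 0"
proof -
  have "(\<Sum>k<D. orient D k * real_density q k 0) = (\<Sum>k\<in>{0, half}. orient D k * real_density q k 0)"
    using half D4 by (intro sum_rays_eq) (auto simp: real_density_def)
  also have "\<dots> = 0" using half orient_values by (simp add: real_density_def)
  finally show ?thesis .
qed

lemma sum_three_rays:
  assumes j: "j \<in> weight_indices D" and X: "\<And>k. k \<notin> {0, half, j} \<Longrightarrow> X k = 0"
  shows "(\<Sum>k<D. orient D k * X k) = X 0 - X half + X j"
proof -
  have "(\<Sum>k<D. orient D k * X k) = (\<Sum>k\<in>{0, half, j}. orient D k * X k)"
    using half D4 X weight_indexD(1)[OF j] by (intro sum_rays_eq) auto
  also have "\<dots> = X 0 - X half + X j"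
    using half orient_values weight_indexD[OF j] by simp
  finally show ?thesis .
qed

text \<open>The connection formula at the origin: the term with \<open>\<kappa>\<close> enters with a minus sign because the negative
  real axis is oriented towards the origin.\<close>

lemma omega_density_balanced:
  assumes j: "j \<in> weight_indices D" shows "(\<Sum>k<D. orient D k * omega_density j q k 0) = 0"
proof -
  have "(\<Sum>k<D. orient D k * omega_density j q k 0)
     = poly q 0 * exp (- (cpoly V 0 / 2)) * (Y (2 * j) 0 - (\<beta> j * Y 0 0 + \<kappa> j * Y D 0))"
    using sum_three_rays[OF j, of "\<lambda>k. omega_density j q k 0"] weight_indexD[OF j] half
    by (simp add: omega_density_def weighted_sol_def algebra_simps)
  then show ?thesis unfolding connection_at_0 by simp
qed

lemma real_line_eq_rays:
  assumes "set_integrable lborel {0..} (\<lambda>t. h (of_real t))" "set_integrable lborel {0..} (\<lambda>t. h (- of_real t))"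
  shows "(LBINT x. h (of_real x)) = ray_integral D 0 h - ray_integral D D h"
  using integral_real_line_split[of "\<lambda>t. h (of_real t)"] assms by (simp add: ray_integral_def)

lemma cauchy_real_eq:
  assumes z: "z \<notin> Sigma_all D"
  shows "cauchy_real (\<lambda>x. exp (- cpoly V x) * poly q x) z = contour_cauchy D (real_density q) z"
proof -
  define h where "h x = poly q x * w x / (x - z)" for x
  have r: "rapid (ray_dir D (2 * k)) (\<lambda>x. poly q x * w x)" for k by (intro rapid_poly rapid_weight)
  have "z \<notin> Sigma_ray D 0" "z \<notin> Sigma_ray D half" using z half D4 by (auto simp: Sigma_all_def)
  then have "(LBINT x. h (of_real x)) = ray_integral D 0 h - ray_integral D D h"
    using ray_cauchy_integrable[OF r, of z 0] ray_cauchy_integrable[OF r, of z half] half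
    by (intro real_line_eq_rays) (simp_all add: h_def)
  moreover have "(\<Sum>k<D. orient D k * ray_cauchy D k (real_density q k) z)
     = (\<Sum>k\<in>{0, half}. orient D k * ray_cauchy D k (real_density q k) z)"
    using half D4 by (intro sum_rays_eq) (auto simp: real_density_def ray_cauchy_def ray_integral_def set_lebesgue_integral_def)
  moreover have "\<dots> = ray_integral D 0 h - ray_integral D D h"
    using half orient_values by (simp add: real_density_def[abs_def] ray_cauchy_def h_def[abs_def])
  ultimately have "(LBINT x. h (of_real x)) = (\<Sum>k<D. orient D k * ray_cauchy D k (real_density q k) z)"
    by simp
  then show ?thesis unfolding cauchy_real_def contour_cauchy_def h_def by (simp add: mult.commute)
qed

lemma omega_on_ray:
  assumes j: "j \<in> weight_indices D" and k: "k < D" and x: "x \<in> Sigma_ray D k" "x \<noteq> 0"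
  shows "poly q x * omega D V lam F j x = omega_density j q k x"
proof -
  have ind: "indicator (Sigma_ray D l) x = (if k = l then 1 else 0 :: complex)" if "l < D" for l
    using rays_disjoint[OF D4 k that x(1) _ x(2)] x(1) by (auto simp: indicator_def)
  have D0: "0 < D" using D4 by simp
  show ?thesis
    unfolding omega_def ind[OF weight_indexD(1)[OF j]] ind[OF D0] ind[OF half(2), unfolded half_def]
    using weight_indexD[OF j] half
    by (auto simp: omega_density_def weighted_sol_def half_def[symmetric])
qed

lemma cauchy_Sigma_eq:
  assumes j: "j \<in> weight_indices D"
  shows "cauchy_Sigma D (\<lambda>x. poly q x * omega D V lam F j x) z = contour_cauchy D (omega_density j q) z"
proof -
  have "ray_integral D (2 * k) (\<lambda>x. poly q x * omega D V lam F j x / (x - z)) = ray_cauchy D k (omega_density j q k) z"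
    if "k < D" for k
    unfolding ray_cauchy_def by (rule ray_integral_cong) (simp add: omega_on_ray[OF j that])
  then show ?thesis unfolding cauchy_Sigma_def Sigma_integral_def contour_cauchy_def by simp
qed

lemma Xi_eq_mass: "Xi V m q = contour_mass D (\<lambda>k x. x ^ m * real_density q k x)"
proof -
  define h where "h x = x ^ m * (poly q x * w x)" for x
  have h: "h = (\<lambda>x. poly (Polynomial.monom 1 m * q) x * w x)" by (simp add: h_def fun_eq_iff poly_monom)
  have r: "rapid (ray_dir D (2 * k)) h" for k unfolding h by (intro rapid_poly rapid_weight)
  have "(LBINT x. h (of_real x)) = ray_integral D 0 h - ray_integral D D h"
    using rapid_set_integrable[OF r, of 0] rapid_set_integrable[OF r, of half] half
    by (intro real_line_eq_rays) simp_all
  moreover have "contour_mass D (\<lambda>k x. x ^ m * real_density q k x)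
     = (\<Sum>k\<in>{0, half}. orient D k * ray_integral D (2 * k) (\<lambda>x. x ^ m * real_density q k x))"
    unfolding contour_mass_def
    using half D4 by (intro sum_rays_eq) (auto simp: real_density_def ray_integral_def set_lebesgue_integral_def)
  moreover have "\<dots> = ray_integral D 0 h - ray_integral D D h"
    using half orient_values by (simp add: real_density_def[abs_def] h_def[abs_def])
  moreover have "Xi V m q = (LBINT x. h (of_real x))"
    unfolding Xi_def h_def cpoly_of_real by (simp add: mult_ac exp_of_real[symmetric])
  ultimately show ?thesis by simp
qed

lemma Theta_eq_mass:
  assumes j: "j \<in> weight_indices D"
  shows "contour_mass D (omega_density j q) = - (2 * of_real pi * \<i>) * Theta D V lam F j q"
proof -
  have "contour_mass D (omega_density j q) = - \<beta> j * ray_integral D 0 (\<lambda>x. poly q x * G 0 x)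
      - \<kappa> j * ray_integral D D (\<lambda>x. poly q x * G D x) + ray_integral D (2 * j) (\<lambda>x. poly q x * G (2 * j) x)"
    unfolding contour_mass_def
  proof (subst sum_three_rays[OF j])
    show "ray_integral D (2 * k) (omega_density j q k) = 0" if "k \<notin> {0, half, j}" for k
      using that by (simp add: omega_density_def[abs_def] ray_integral_def set_lebesgue_integral_def)
  qed (use weight_indexD[OF j] half ray_integral_cmult[of D 0 "- \<beta> j" "\<lambda>x. poly q x * G 0 x"]
        in \<open>simp add: omega_density_def[abs_def] ray_integral_cmult\<close>)
  then show ?thesis unfolding Theta_eq by (simp add: mult.commute algebra_simps)
qed

lemma Xi_eq_rays:
  "Xi V 0 q = ray_integral D (2 * 0) (\<lambda>x. poly q x * w x) - ray_integral D (2 * half) (\<lambda>x. poly q x * w x)"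
proof -
  have "Xi V 0 q = (\<Sum>k\<in>{0, half}. orient D k * ray_integral D (2 * k) (real_density q k))"
    unfolding Xi_eq_mass contour_mass_def
    using half D4 by (subst sum_rays_eq[where S = "{0, half}"])
      (auto simp: real_density_def ray_integral_def set_lebesgue_integral_def)
  then show ?thesis using half orient_values by (simp add: real_density_def[abs_def])
qed

lemma Xi_add: "Xi V k (p + q) = Xi V k p + Xi V k q"
proof -
  have "Xi V 0 (p + q) = Xi V 0 p + Xi V 0 q" for p q
    unfolding Xi_eq_rays poly_add distrib_right
    by (subst (1 2) ray_integral_add) (intro rapid_poly rapid_weight | simp)+
  then show ?thesis by (simp add: Xi_shift[of V k] distrib_right)
qed

lemma Xi_smult: "Xi V k (Polynomial.smult c p) = c * Xi V k p"
proof -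
  have "Xi V 0 (Polynomial.smult c p) = c * Xi V 0 p" for p
    unfolding Xi_eq_rays poly_smult mult.assoc ray_integral_cmult by (simp add: right_diff_distrib)
  then show ?thesis by (simp add: Xi_shift[of V k])
qed

lemma Theta_add:
  assumes j: "j < D"
  shows "Theta D V lam F j (p + q) = Theta D V lam F j p + Theta D V lam F j q"
proof -
  have *: "ray_integral D (2 * l) (\<lambda>z. G (2 * l) z * poly (p + q) z) =
     ray_integral D (2 * l) (\<lambda>z. G (2 * l) z * poly p z) + ray_integral D (2 * l) (\<lambda>z. G (2 * l) z * poly q z)"
    if "l < D" for l
    unfolding poly_add distrib_left
    by (rule ray_integral_add) (use rapid_poly[OF rapid_G[OF that]] in \<open>simp_all add: mult.commute\<close>)
  show ?thesis unfolding Theta_eq using *[OF j] *[of 0] *[OF half(2)] half D4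
    by (simp add: algebra_simps)
qed

lemma Theta_smult: "Theta D V lam F j (Polynomial.smult c p) = c * Theta D V lam F j p"
proof -
  have *: "ray_integral D l (\<lambda>z. G l z * poly (Polynomial.smult c p) z) = c * ray_integral D l (\<lambda>z. G l z * poly p z)" for l
    unfolding ray_integral_cmult[symmetric] by (simp add: mult_ac)
  show ?thesis unfolding Theta_eq * by (simp add: algebra_simps)
qed

text \<open>The integrand \<open>(r' - V' r) exp (-V)\<close> is the derivative of \<open>r exp (-V)\<close>.\<close>

lemma Xi_total_derivative: "Xi V 0 (pderiv r - map_poly of_real (pderiv V) * r) = 0"
proof -
  have *: "ray_integral D (2 * k) (\<lambda>x. poly (pderiv r - map_poly of_real (pderiv V) * r) x * w x) = - (poly r 0 * w 0)" for k
  proof (rule ray_integral_deriv[where G = "\<lambda>x. poly r x * w x"])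
    show "((\<lambda>x. poly r x * w x) has_field_derivative
        poly (pderiv r - map_poly of_real (pderiv V) * r) z * w z) (at z)" for z
      by (rule DERIV_cong[OF DERIV_mult[OF poly_DERIV deriv_potential_weight]]) (simp add: algebra_simps)
    show "decays (ray_dir D (2 * k)) (\<lambda>x. poly r x * w x)" by (intro decays_poly decays_weight)
  qed (intro rapid_poly rapid_weight)
  show ?thesis unfolding Xi_eq_rays * by simp
qed

definition sobolev_form :: "complex poly \<Rightarrow> complex poly \<Rightarrow> complex" where
  "sobolev_form p q = Xi V 0 (p * q) + of_real lam * Xi V 0 (pderiv p * pderiv q)"

lemma sobolev_form_add: "sobolev_form p (q + r) = sobolev_form p q + sobolev_form p r"
  by (simp add: sobolev_form_def pderiv_add distrib_left Xi_add)

lemma sobolev_form_smult: "sobolev_form p (Polynomial.smult c q) = c * sobolev_form p q"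
  by (simp add: sobolev_form_def pderiv_smult Xi_smult algebra_simps)

lemma sobolev_form_of_real:
  "sobolev_form (map_poly of_real p) (map_poly of_real q) = of_real (sobolev_ip V lam p q)"
proof -
  have "Xi V 0 (map_poly of_real p * map_poly of_real q) = of_real (LBINT x. poly p x * poly q x * exp (- poly V x))" for p q
    unfolding Xi_def poly_mult cpoly_of_real by (simp flip: integral_complex_of_real)
  moreover have "pderiv (map_poly of_real p) = (map_poly of_real (pderiv p) :: complex poly)" for p :: "real poly"
    by (rule poly_eqI) (simp add: coeff_pderiv coeff_map_poly)
  ultimately show ?thesis unfolding sobolev_form_def sobolev_ip_def by simp
qed

text \<open>Integration by parts shows that \<open>L\<close> represents the Sobolev form in the space with weight
  \<open>exp (-V)\<close>.\<close>

lemma Xi_dual: "Xi V 0 (dual_op V lam p * q) = inverse (of_real lam) * sobolev_form p q"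
proof -
  let ?V' = "map_poly of_real (pderiv V) :: complex poly"
  have "dual_op V lam p * q = Polynomial.smult (- 1) (pderiv (pderiv p * q) - ?V' * (pderiv p * q))
     + (pderiv p * pderiv q + Polynomial.smult (inverse (of_real lam)) (p * q))"
    unfolding dual_op_def pderiv_mult by (simp add: algebra_simps)
  then have "Xi V 0 (dual_op V lam p * q) = Xi V 0 (pderiv p * pderiv q) + inverse (of_real lam) * Xi V 0 (p * q)"
    by (simp only: Xi_add Xi_smult Xi_total_derivative) simp
  then show ?thesis unfolding sobolev_form_def using lam_pos by (simp add: field_simps)
qed

end

section \<open>Moments determine the polynomial\<close>

lemma linear_functional_expansion:
  fixes \<phi> :: "complex poly \<Rightarrow> complex"
  assumes add: "\<And>p q. \<phi> (p + q) = \<phi> p + \<phi> q" and smult: "\<And>c p. \<phi> (Polynomial.smult c p) = c * \<phi> p"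
    and deg: "degree p < N"
  shows "\<phi> p = (\<Sum>j<N. \<phi> (Polynomial.monom 1 j) * coeff p j)"
proof -
  have z: "\<phi> 0 = 0" using smult[of 0 0] by simp
  have sum: "\<phi> (sum f A) = (\<Sum>x\<in>A. \<phi> (f x))" if "finite A" for f :: "nat \<Rightarrow> complex poly" and A
    using that by (induction A rule: finite_induct) (simp_all add: z add)
  have "p = (\<Sum>j\<le>N - 1. Polynomial.monom (coeff p j) j)"
    using deg by (intro poly_as_sum_of_monoms'[symmetric]) auto
  also have "{..N - 1} = {..<N}" using deg by auto
  also have "(\<Sum>j<N. Polynomial.monom (coeff p j) j) = (\<Sum>j<N. Polynomial.smult (coeff p j) (Polynomial.monom 1 j))"
    by (simp add: smult_monom)
  finally have "\<phi> p = \<phi> (\<Sum>j<N. Polynomial.smult (coeff p j) (Polynomial.monom 1 j))" by simp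
  then show ?thesis by (simp add: sum smult mult.commute)
qed

text \<open>The matrix of the functionals in the monomial basis, multiplied by the coefficient matrix of the
  polynomials \<open>b\<close>, is triangular with nonzero determinant; hence the former is invertible.\<close>

lemma triangular_functionals_separate:
  fixes \<phi> :: "nat \<Rightarrow> complex poly \<Rightarrow> complex" and b :: "nat \<Rightarrow> complex poly"
  assumes add: "\<And>i p q. i < N \<Longrightarrow> \<phi> i (p + q) = \<phi> i p + \<phi> i q"
    and smult: "\<And>i c p. i < N \<Longrightarrow> \<phi> i (Polynomial.smult c p) = c * \<phi> i p"
    and deg: "\<And>l. l < N \<Longrightarrow> degree (b l) < N" and degd: "degree d < N"
    and upper: "\<And>i l. i < l \<Longrightarrow> l < N \<Longrightarrow> \<phi> i (b l) = 0"
    and diag: "\<And>i. i < N \<Longrightarrow> \<phi> i (b i) \<noteq> 0"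
    and zero: "\<And>i. i < N \<Longrightarrow> \<phi> i d = 0"
  shows "d = 0"
proof -
  define M where "M = Matrix.mat N N (\<lambda>(i, j). \<phi> i (Polynomial.monom 1 j))"
  define S where "S = Matrix.mat N N (\<lambda>(j, l). coeff (b l) j)"
  define v where "v = Matrix.vec N (coeff d)"
  have car: "M \<in> carrier_mat N N" "S \<in> carrier_mat N N" "v \<in> carrier_vec N"
    by (auto simp: M_def S_def v_def)
  have exp: "\<phi> i p = (\<Sum>j<N. \<phi> i (Polynomial.monom 1 j) * coeff p j)" if "i < N" "degree p < N" for i p
    by (rule linear_functional_expansion) (use add smult that in auto)
  have MS: "(M * S) $$ (i, l) = \<phi> i (b l)" if "i < N" "l < N" for i l
    using that exp[OF that(1) deg[OF that(2)]]
    by (simp add: M_def S_def scalar_prod_def lessThan_atLeast0)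
  have "Determinant.det (M * S) = prod_list (diag_mat (M * S))"
    by (rule det_lower_triangular[of N]) (use car in \<open>auto simp: MS upper simp del: index_mult_mat\<close>)
  also have "\<dots> \<noteq> 0"
    unfolding prod_list_zero_iff diag_mat_def using car by (auto simp: MS diag simp del: index_mult_mat(1))
  finally have "Determinant.det M \<noteq> 0" using det_mult[OF car(1,2)] by auto
  moreover have "M *\<^sub>v v = 0\<^sub>v N"
  proof (rule eq_vecI)
    fix i assume "i < dim_vec (0\<^sub>v N :: complex Matrix.vec)"
    then have i: "i < N" by simp
    show "(M *\<^sub>v v) $ i = 0\<^sub>v N $ i"
      using i exp[OF i degd] zero[OF i] by (simp add: M_def v_def scalar_prod_def lessThan_atLeast0)
  qed (simp add: M_def)
  ultimately have "v = 0\<^sub>v N" using det_0_iff_vec_prod_zero_field[OF car(1)] car(3) by blast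
  then have "coeff d j = 0" if "j < N" for j
    using that unfolding v_def by (metis index_vec index_zero_vec(1))
  then show ?thesis using degd leading_coeff_0_iff by blast
qed

lemma slot_properties:
  assumes D: "D \<ge> 4" "even D"
  shows "2 \<le> i \<Longrightarrow> i < D \<Longrightarrow> slot D i \<in> weight_indices D"
    "2 \<le> i \<Longrightarrow> i < D \<Longrightarrow> 2 \<le> j \<Longrightarrow> j < D \<Longrightarrow> slot D i = slot D j \<longleftrightarrow> i = j"
  using D by (auto simp: slot_def weight_indices_def split: if_splits)

locale rhp_setting = sibuya_setting +
  fixes P :: "nat \<Rightarrow> real poly" and n :: nat and R :: "nat \<Rightarrow> complex poly"
  assumes ops: "is_monic_sobolev_op V lam P" and n1: "n \<ge> 1"
    and R: "\<And>s. s \<in> weight_indices D \<Longrightarrow> is_R_poly D V lam F n s (R s)"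
begin

abbreviation cP :: "nat \<Rightarrow> complex poly" where "cP m \<equiv> map_poly of_real (P m)"

definition Psi :: "nat \<Rightarrow> complex poly" where
  "Psi m = map_poly of_real (dual_Psi D g V lam P m)"

abbreviation h :: "nat \<Rightarrow> real" where "h m \<equiv> sobolev_h V lam P m"

lemma degree_P: "degree (P m) = m" "coeff (P m) m = 1"
  using ops unfolding is_monic_sobolev_op_def by (metis+)

lemma cP_coeff: "i > m \<Longrightarrow> coeff (cP m) i = 0" "coeff (cP m) m = 1"
  using degree_P[of m] by (simp_all add: coeff_map_poly coeff_eq_0)

text \<open>The polynomials \<open>P\<^sub>0, \<dots>, P\<^sub>l\<^sub>-\<^sub>1\<close> span the polynomials of degree below \<open>l\<close>. Stated with complex \<open>q\<close>,
  and with vanishing coefficients in place of a degree bound so that \<open>l = 0\<close> makes sense.\<close>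

lemma sobolev_orthogonal:
  assumes "l \<le> m" "\<And>i. i \<ge> l \<Longrightarrow> coeff q i = 0"
  shows "sobolev_form (cP m) q = 0"
  using assms
proof (induction l arbitrary: q)
  case 0
  then have "q = 0" by (intro poly_eqI) simp
  then show ?case using sobolev_form_smult[of "cP m" 0 0] by simp
next
  case (Suc l)
  define r where "r = q - Polynomial.smult (coeff q l) (cP l)"
  have "coeff r i = 0" if "i \<ge> l" for i
  proof (cases "i = l")
    case True then show ?thesis by (simp add: r_def cP_coeff)
  next
    case False
    then show ?thesis using Suc.prems(2)[of i] that by (simp add: r_def cP_coeff)
  qed
  then have "sobolev_form (cP m) r = 0" using Suc by simp
  moreover have "sobolev_form (cP m) (cP l) = 0"
    unfolding sobolev_form_of_real using ops Suc.prems(1) unfolding is_monic_sobolev_op_def by auto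
  moreover have "q = r + Polynomial.smult (coeff q l) (cP l)" by (simp add: r_def)
  ultimately show ?case by (metis add_0 mult_zero_right sobolev_form_add sobolev_form_smult)
qed

lemma Psi_eq: "Psi m = Polynomial.smult (of_real (nu D g lam m)) (dual_op V lam (cP m))"
  unfolding Psi_def dual_Psi_def dual_op_def
  by (rule poly_eqI) (simp add: coeff_map_poly coeff_pderiv coeff_mult)

text \<open>By \<open>Xi_dual\<close>, these are Sobolev products of \<open>P\<^sub>m\<close> with \<open>x\<^sup>k\<close>; for \<open>k = m\<close> the monomial differs from
  \<open>P\<^sub>m\<close> by a polynomial of lower degree.\<close>

lemma Xi_Psi:
  "k < m \<Longrightarrow> Xi V k (Psi m) = 0"
  "Xi V m (Psi m) = of_real (nu D g lam m * h m / lam)"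
proof -
  have *: "Xi V k (Psi m) = of_real (nu D g lam m) * (inverse (of_real lam) * sobolev_form (cP m) (Polynomial.monom 1 k))" for k
    unfolding Psi_eq Xi_smult by (simp add: Xi_shift[of V k] Xi_dual)
  show "Xi V k (Psi m) = 0" if "k < m"
    unfolding * using sobolev_orthogonal[of "Suc k" m "Polynomial.monom 1 k"] that by simp
  have "sobolev_form (cP m) (Polynomial.monom 1 m - cP m) = 0"
    by (rule sobolev_orthogonal[OF order_refl]) (use cP_coeff in \<open>auto simp: le_less\<close>)
  then have "sobolev_form (cP m) ((Polynomial.monom 1 m - cP m) + cP m) = of_real (h m)"
    unfolding sobolev_form_add sobolev_form_of_real sobolev_h_def by simp
  then show "Xi V m (Psi m) = of_real (nu D g lam m * h m / lam)"
    unfolding * by (simp add: divide_inverse)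
qed

lemma h_pos: "h m > 0"
proof -
  have nn: "0 \<le> (LBINT x. poly p x * poly p x * exp (- poly V x))" for p
    by (intro Bochner_Integration.integral_nonneg) auto
  have int: "integrable lborel (\<lambda>x. poly (P m) x * poly (P m) x * exp (- poly V x))"
  proof -
    let ?q = "cP m * cP m"
    have r: "rapid (ray_dir D (2 * k)) (\<lambda>x. poly ?q x * w x)" for k by (intro rapid_poly rapid_weight)
    have "set_integrable lborel {0..} (\<lambda>t. poly ?q (of_real t) * w (of_real t))"
      using rapid_set_integrable[OF r, of 0] by simp
    moreover have "set_integrable lborel {0..} (\<lambda>t. poly ?q (of_real (- t)) * w (of_real (- t)))"
      using rapid_set_integrable[OF r, of half] half by simp
    ultimately have "integrable lborel (\<lambda>x. poly ?q (of_real x) * w (of_real x))"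
      by (rule integrable_real_line)
    moreover have "poly ?q (of_real x) * w (of_real x) = of_real (poly (P m) x * poly (P m) x * exp (- poly V x))" for x
      unfolding poly_mult cpoly_of_real by (simp flip: exp_of_real)
    ultimately show ?thesis by (simp only: complex_of_real_integrable_eq)
  qed
  have "(LBINT x. poly (P m) x * poly (P m) x * exp (- poly V x)) \<noteq> 0"
  proof
    assume "(LBINT x. poly (P m) x * poly (P m) x * exp (- poly V x)) = 0"
    then have ae: "AE x in lborel. poly (P m) x * poly (P m) x * exp (- poly V x) = 0"
      using integral_nonneg_eq_0_iff_AE[OF int] by simp
    have "P m \<noteq> 0" using degree_P[of m] by auto
    then have "finite {x. poly (P m) x = 0}" by (rule poly_roots_finite)
    then have "AE x in lborel. x \<notin> {x. poly (P m) x = 0}"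
      by (intro AE_not_in) (auto intro!: finite_imp_null_set_lborel)
    with ae have "AE x in (lborel :: real measure). False" by eventually_elim auto
    then have "(UNIV :: real set) \<in> null_sets lborel"
      using AE_iff_null_sets[of "UNIV :: real set" lborel] by simp
    then show False by (simp add: null_sets_def emeasure_lborel_UNIV)
  qed
  then have "0 < (LBINT x. poly (P m) x * poly (P m) x * exp (- poly V x))" using nn[of "P m"] by linarith
  moreover have "0 \<le> lam * (LBINT x. poly (pderiv (P m)) x * poly (pderiv (P m)) x * exp (- poly V x))"
    using nn[of "pderiv (P m)"] lam_pos by (intro mult_nonneg_nonneg) auto
  ultimately show ?thesis unfolding sobolev_h_def sobolev_ip_def by linarith
qed

lemma nu_pos: "nu D g lam m > 0"
  using lam_pos g_pos D4 by (simp add: nu_def)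

lemma Theta_Psi: "j < D \<Longrightarrow> Theta D V lam F j (Psi m) = 0"
  unfolding Psi_eq Theta_smult by (simp add: Theta_dual)

text \<open>The factor \<open>m D g\<close> comes from the leading terms of \<open>V'\<close> and \<open>P\<^sub>m'\<close>, and \<open>\<nu>\<^sub>m\<close> is its inverse. Since
  \<open>D \<ge> 4\<close>, the other two terms of \<open>L\<close> have smaller degree.\<close>

lemma dual_op_cP_coeff:
  assumes "m \<ge> 1"
  shows "coeff (dual_op V lam (cP m)) (m + D - 2) = of_real (real D * g * real m)"
    "i > m + D - 2 \<Longrightarrow> coeff (dual_op V lam (cP m)) i = 0"
proof -
  let ?V' = "map_poly of_real (pderiv V) :: complex poly"
  let ?p = "pderiv (cP m)"
  have degV': "degree ?V' = D - 1"
    using degree_pderiv[of V] degree_V by (simp add: degree_map_poly)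
  have degp: "degree ?p = m - 1"
    using degree_pderiv[of "cP m"] degree_P[of m] by (simp add: degree_map_poly)
  have lo: "coeff (pderiv ?p) i = 0" "coeff (cP m) i = 0" if "i \<ge> m + D - 2" for i
    using that assms D4 by (simp_all add: coeff_pderiv cP_coeff)
  have "m + D - 2 = (D - 1) + (m - 1)" using assms D4 by simp
  then have "coeff (?V' * ?p) (m + D - 2) = coeff ?V' (D - 1) * coeff ?p (m - 1)"
    using coeff_mult_degree_sum[of ?V' ?p] unfolding degV' degp by simp
  moreover have "coeff ?V' (D - 1) = of_real (real D * g)"
    using D4 degree_V lead_V by (simp add: coeff_map_poly coeff_pderiv of_nat_diff)
  moreover have "coeff ?p (m - 1) = of_nat m" using assms by (simp add: coeff_pderiv cP_coeff)
  ultimately show "coeff (dual_op V lam (cP m)) (m + D - 2) = of_real (real D * g * real m)"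
    unfolding dual_op_def by (simp add: lo)
  show "coeff (dual_op V lam (cP m)) i = 0" if "i > m + D - 2"
  proof -
    have "degree (?V' * ?p) \<le> m + D - 2"
      using degree_mult_le[of ?V' ?p] degV' degp assms D4 by linarith
    then have "coeff (?V' * ?p) i = 0" using that by (intro coeff_eq_0) auto
    then show ?thesis unfolding dual_op_def using that by (simp add: lo)
  qed
qed

lemma degree_Psi: "m \<ge> 1 \<Longrightarrow> degree (Psi m) \<le> m + D - 2" "m \<ge> 1 \<Longrightarrow> coeff (Psi m) (m + D - 2) = 1"
    "m < n \<Longrightarrow> degree (Psi m) \<le> n + D - 3"
proof -
  show 1: "degree (Psi m) \<le> m + D - 2" if "m \<ge> 1" for m
    by (rule degree_le) (use dual_op_cP_coeff(2)[OF that] in \<open>simp add: Psi_eq\<close>)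
  show "coeff (Psi m) (m + D - 2) = 1" if "m \<ge> 1"
    unfolding Psi_eq using dual_op_cP_coeff(1)[OF that] that D4 g_pos by (simp add: nu_def)
  show "degree (Psi m) \<le> n + D - 3" if m: "m < n"
  proof (cases "m = 0")
    case True
    have "degree (cP 0) = 0" using degree_P[of 0] by (simp add: degree_map_poly)
    then have "pderiv (cP 0) = 0" by (metis pderiv_eq_0_iff)
    then have "degree (Psi 0) \<le> 0" unfolding Psi_eq dual_op_def using \<open>degree (cP 0) = 0\<close>
      by (simp add: degree_smult_le)
    then show ?thesis using True by simp
  next
    case False
    then show ?thesis using 1[of m] m by simp
  qed
qed

lemma R_properties:
  assumes "s \<in> weight_indices D"
  shows "degree (R s) \<le> n + D - 3" "k < n \<Longrightarrow> Xi V k (R s) = 0"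
    "j \<in> weight_indices D \<Longrightarrow> Theta D V lam F j (R s) = (if j = s then 1 else 0)"
  using R[OF assms] unfolding is_R_poly_def by auto

text \<open>The functionals \<open>\<Xi>\<^sub>0, \<dots>, \<Xi>\<^sub>n\<^sub>-\<^sub>1\<close> followed by the \<open>\<Theta>\<^sub>j\<close> are tested on \<open>\<Psi>\<^sub>0, \<dots>, \<Psi>\<^sub>n\<^sub>-\<^sub>1\<close> followed by
  the \<open>R\<^sub>n\<close>. The \<open>\<Xi>\<close>-block is triangular by orthogonality and the \<open>\<Theta>\<close>-block is the identity; both
  off-diagonal blocks vanish.\<close>

lemma moments_determine_polynomial:
  assumes deg: "degree d \<le> n + D - 3" and X: "\<And>k. k < n \<Longrightarrow> Xi V k d = 0"
    and T: "\<And>j. j \<in> weight_indices D \<Longrightarrow> Theta D V lam F j d = 0"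
  shows "d = 0"
proof -
  define N where "N = n + D - 2"
  \<comment> \<open>The shift by \<open>n - 2\<close> lines up the indices from \<open>n\<close> on with the columns \<open>2, \<dots>, D - 1\<close>.\<close>
  define \<phi> where "\<phi> i = (if i < n then Xi V i else Theta D V lam F (slot D (i - n + 2)))" for i
  define b where "b l = (if l < n then Psi l else R (slot D (l - n + 2)))" for l
  have N: "N = Suc (n + D - 3)" using D4 n1 by (simp add: N_def)
  have sl: "slot D (i - n + 2) \<in> weight_indices D" if "i < N" "\<not> i < n" for i
    using slot_properties(1)[OF D4 even_D, of "i - n + 2"] that D4 by (simp add: N_def)
  have slD: "slot D (i - n + 2) < D" if "i < N" "\<not> i < n" for i
    using weight_indexD(1)[OF sl[OF that]] .
  show ?thesis
  proof (rule triangular_functionals_separate[of N \<phi> b])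
    show "\<phi> i (p + q) = \<phi> i p + \<phi> i q" if "i < N" for i p q
      using Xi_add Theta_add[OF slD[OF that]] by (auto simp: \<phi>_def)
    show "\<phi> i (Polynomial.smult c p) = c * \<phi> i p" for i c p
      by (auto simp: \<phi>_def Xi_smult Theta_smult)
    show "degree (b l) < N" if "l < N" for l
      using degree_Psi(3)[of l] R_properties(1)[OF sl[OF that]] unfolding b_def N by (auto simp: less_Suc_eq_le)
    show "degree d < N" using deg unfolding N by simp
    show "\<phi> i (b l) = 0" if il: "i < l" "l < N" for i l
    proof -
      consider "l < n" | "i < n" "\<not> l < n" | "\<not> i < n" "\<not> l < n" using il by linarith
      then show ?thesis
      proof cases
        case 1 then show ?thesis using Xi_Psi(1)[OF il(1)] il by (simp add: \<phi>_def b_def)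
      next
        case 2 then show ?thesis using R_properties(2)[OF sl[OF il(2) 2(2)]] by (simp add: \<phi>_def b_def)
      next
        case 3
        have "slot D (i - n + 2) \<noteq> slot D (l - n + 2)"
          using slot_properties(2)[OF D4 even_D, of "i - n + 2" "l - n + 2"] 3 il D4 by (simp add: N_def)
        then show ?thesis
          using R_properties(3)[OF sl[OF il(2) 3(2)] sl[OF _ 3(1)]] 3 il by (simp add: \<phi>_def b_def)
      qed
    qed
    show "\<phi> i (b i) \<noteq> 0" if "i < N" for i
    proof (cases "i < n")
      case True
      then show ?thesis using Xi_Psi(2)[of i] h_pos[of i] nu_pos[of i] lam_pos by (simp add: \<phi>_def b_def)
    next
      case False
      then show ?thesis using R_properties(3)[OF sl[OF that False] sl[OF that False]] by (simp add: \<phi>_def b_def)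
    qed
    show "\<phi> i d = 0" if "i < N" for i
      using X T sl[OF that] by (auto simp: \<phi>_def)
  qed
qed

end

section \<open>Expansion at infinity\<close>

lemma rapid_densities_power:
  "rapid_densities D f \<Longrightarrow> rapid_densities D (\<lambda>k x. x ^ m * f k x)"
proof (induction m)
  case (Suc m)
  then show ?case using rapid_densities_times_z[of D "\<lambda>k x. x ^ m * f k x"] by (simp add: mult.assoc)
qed simp

lemma contour_cauchy_moments:
  assumes f: "rapid_densities D f" and z: "z \<notin> Sigma_all D"
    and van: "\<And>l. l < m \<Longrightarrow> contour_mass D (\<lambda>k x. x ^ l * f k x) = 0"
  shows "z ^ m * contour_cauchy D f z = contour_cauchy D (\<lambda>k x. x ^ m * f k x) z"
  using van
proof (induction m)
  case (Suc m)
  then have "z ^ Suc m * contour_cauchy D f z = z * contour_cauchy D (\<lambda>k x. x ^ m * f k x) z"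
    by (simp add: mult.assoc)
  also have "\<dots> = contour_cauchy D (\<lambda>k x. x * (x ^ m * f k x)) z"
    using contour_cauchy_shift[OF rapid_densities_power[OF f] z, of m] Suc.prems[of m] by simp
  finally show ?case by (simp add: mult.assoc)
qed simp

text \<open>The expansion of the Cauchy integral at infinity to the order of the moment \<open>m\<close>, with a remainder that is again a Cauchy integral and hence of order \<open>1 / z\<close> up to the contour.\<close>

lemma contour_cauchy_leading_term:
  assumes f: "rapid_densities D f" and z: "z \<notin> Sigma_all D"
    and van: "\<And>l. l < m \<Longrightarrow> contour_mass D (\<lambda>k x. x ^ l * f k x) = 0"
  shows "z ^ Suc m * contour_cauchy D f z = contour_cauchy D (\<lambda>k x. x ^ Suc m * f k x) z
     - 1 / (2 * of_real pi * \<i>) * contour_mass D (\<lambda>k x. x ^ m * f k x)"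
proof -
  have "z ^ Suc m * contour_cauchy D f z = z * contour_cauchy D (\<lambda>k x. x ^ m * f k x) z"
    using contour_cauchy_moments[OF f z van] by (simp add: mult.assoc)
  also have "\<dots> = contour_cauchy D (\<lambda>k x. x * (x ^ m * f k x)) z
     - 1 / (2 * of_real pi * \<i>) * contour_mass D (\<lambda>k x. x ^ m * f k x)"
    by (rule contour_cauchy_shift[OF rapid_densities_power[OF f] z])
  finally show ?thesis by (simp add: mult.assoc)
qed

lemma contour_cauchy_decay:
  assumes f: "rapid_densities D f"
  obtains M where "\<And>z. z \<notin> Sigma_all D \<Longrightarrow> cmod z \<ge> 2 \<Longrightarrow> cmod (contour_cauchy D f z) \<le> M / cmod z"
proof -
  obtain M where M: "\<And>z. z \<notin> Sigma_all D \<Longrightarrow> cmod z \<ge> 2 \<Longrightarrow> cmod (contour_cauchy D (\<lambda>k x. x * f k x) z) \<le> M"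
    using contour_cauchy_bounded_far[OF rapid_densities_times_z[OF f]] by metis
  let ?m = "1 / (2 * of_real pi * \<i>) * contour_mass D f"
  show ?thesis
  proof (rule that[of "M + cmod ?m"])
    fix z assume z: "z \<notin> Sigma_all D" "cmod z \<ge> 2"
    have "cmod (z * contour_cauchy D f z) \<le> M + cmod ?m"
      unfolding contour_cauchy_shift[OF f z(1)] using M[OF z]
        norm_triangle_ineq4[of "contour_cauchy D (\<lambda>k x. x * f k x) z" ?m] by linarith
    then show "cmod (contour_cauchy D f z) \<le> (M + cmod ?m) / cmod z"
      using z(2) by (subst pos_le_divide_eq) (auto simp: norm_mult mult.commute)
  qed
qed

text \<open>A nonzero moment of lowest order would be the leading coefficient at infinity; it is a constant that
  tends to \<open>0\<close>.\<close>

lemma moments_vanish_of_decay: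
  assumes f: "rapid_densities D f"
    and bd: "\<And>z. cmod z > r \<Longrightarrow> z \<notin> Sigma_all D \<Longrightarrow> cmod (contour_cauchy D f z) \<le> c / cmod z ^ Suc N"
  shows "m < N \<Longrightarrow> contour_mass D (\<lambda>k x. x ^ m * f k x) = 0"
proof (induction m rule: less_induct)
  case (less m)
  let ?c = "1 / (2 * of_real pi * \<i>) * contour_mass D (\<lambda>k x. x ^ m * f k x)"
  obtain M where M: "\<And>z. z \<notin> Sigma_all D \<Longrightarrow> cmod z \<ge> 2 \<Longrightarrow>
      cmod (contour_cauchy D (\<lambda>k x. x ^ Suc m * f k x) z) \<le> M / cmod z"
    using contour_cauchy_decay[OF rapid_densities_power[OF f]] by metis
  have "?c = 0"
  proof (rule entire_vanishing_at_infinity[where A = "max r 2" and D = D and B = "M + \<bar>c\<bar>" and g = "\<lambda>_. ?c" and z = 0])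
    fix z assume z: "cmod z > max r 2" "z \<notin> Sigma_all D"
    have z0: "cmod z \<ge> 2" using z by simp
    have "?c = contour_cauchy D (\<lambda>k x. x ^ Suc m * f k x) z - z ^ Suc m * contour_cauchy D f z"
      using contour_cauchy_leading_term[OF f z(2), of m] less.IH less.prems by simp
    then have "cmod ?c \<le> cmod (contour_cauchy D (\<lambda>k x. x ^ Suc m * f k x) z) + cmod (z ^ Suc m * contour_cauchy D f z)"
      by (simp only: norm_triangle_ineq4)
    also have "\<dots> \<le> M / cmod z + \<bar>c\<bar> / cmod z"
    proof (rule add_mono)
      have "cmod (z ^ Suc m * contour_cauchy D f z) \<le> cmod z ^ Suc m * (\<bar>c\<bar> / cmod z ^ Suc N)"
        unfolding norm_mult norm_power using z
        by (intro mult_left_mono order_trans[OF bd] divide_right_mono) auto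
      also have "\<dots> \<le> cmod z ^ N * (\<bar>c\<bar> / cmod z ^ Suc N)"
        using less.prems z0 by (intro mult_right_mono power_increasing) auto
      also have "\<dots> = \<bar>c\<bar> / cmod z" using z0 by (simp add: field_simps)
      finally show "cmod (z ^ Suc m * contour_cauchy D f z) \<le> \<bar>c\<bar> / cmod z" .
    qed (use M[OF z(2) z0] in simp)
    finally show "cmod ?c \<le> (M + \<bar>c\<bar>) / cmod z" by (simp add: add_divide_distrib)
  qed auto
  then show ?case by simp
qed

lemma poly_lower_order:
  fixes p :: "complex poly"
  assumes "\<And>i. i \<ge> N \<Longrightarrow> coeff p i = 0"
  obtains c where "\<And>z. cmod z \<ge> 1 \<Longrightarrow> cmod (poly p z) \<le> c / cmod z * cmod (z ^ N)"
proof -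
  have "cmod (poly p z) \<le> (\<Sum>i\<le>degree p. cmod (coeff p i)) / cmod z * cmod (z ^ N)" if z: "cmod z \<ge> 1" for z
  proof -
    have "cmod (poly p z) \<le> (\<Sum>i\<le>degree p. cmod (coeff p i) / cmod z * cmod (z ^ N))"
      unfolding poly_altdef
    proof (rule sum_norm_le)
      fix i
      show "cmod (coeff p i * z ^ i) \<le> cmod (coeff p i) / cmod z * cmod (z ^ N)"
      proof (cases "i < N")
        case True
        have "cmod z * cmod z ^ i \<le> cmod z ^ N"
          using power_increasing[of "Suc i" N "cmod z"] True z by simp
        then have "cmod z ^ i \<le> cmod z ^ N / cmod z" using z by (subst pos_le_divide_eq) (auto simp: mult.commute)
        then have "cmod (coeff p i) * cmod z ^ i \<le> cmod (coeff p i) * (cmod z ^ N / cmod z)"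
          by (rule mult_left_mono) auto
        then show ?thesis by (simp add: norm_mult norm_power)
      qed (use assms in simp)
    qed
    then show ?thesis by (simp add: sum_divide_distrib sum_distrib_right)
  qed
  then show ?thesis using that by blast
qed

context sibuya_setting
begin

definition column_density :: "complex poly \<Rightarrow> nat \<Rightarrow> nat \<Rightarrow> complex \<Rightarrow> complex" where
  "column_density q j = (if j = 1 then real_density q else omega_density (slot D j) q)"

lemma slot_index: "1 \<le> j \<Longrightarrow> j < D \<Longrightarrow> j \<noteq> 1 \<Longrightarrow> slot D j \<in> weight_indices D"
  using slot_properties(1)[OF D4 even_D] by simp

lemma rapid_column_density: "1 \<le> j \<Longrightarrow> j < D \<Longrightarrow> rapid_densities D (column_density q j)"
  unfolding column_density_def using rapid_real_density rapid_omega_density weight_indexD(1)[OF slot_index] by simp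

lemma column_density_balanced: "1 \<le> j \<Longrightarrow> j < D \<Longrightarrow> (\<Sum>k<D. orient D k * column_density q j k 0) = 0"
  unfolding column_density_def using real_density_balanced omega_density_balanced[OF slot_index] by simp

lemma RHP_row_eq:
  assumes "z \<notin> Sigma_all D" "j < D"
  shows "RHP_row D V lam F (poly q) j z = (if j = 0 then poly q z else contour_cauchy D (column_density q j) z)"
  using assms cauchy_real_eq[OF assms(1)] cauchy_Sigma_eq[OF slot_index] by (simp add: RHP_row_def column_density_def)

lemma real_on_ray_iff:
  assumes "k < D" "x \<in> Sigma_ray D k" "x \<noteq> 0"
  shows "x \<in> \<real> \<longleftrightarrow> k = 0 \<or> k = half"
proof
  assume "x \<in> \<real>"
  then obtain y where y: "x = of_real y" by (auto elim: Reals_cases)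
  have "ray_dir D (2 * half) = -1" using half by simp
  then have "x \<in> Sigma_ray D 0 \<or> x \<in> Sigma_ray D half"
    unfolding mem_Sigma_ray y by auto
  then show "k = 0 \<or> k = half"
    using rays_disjoint[OF D4 assms(1) _ assms(2) _ assms(3)] half D4 by auto
next
  assume "k = 0 \<or> k = half"
  then have "ray_dir D (2 * k) = 1 \<or> ray_dir D (2 * k) = -1" using half by auto
  then show "x \<in> \<real>" using assms(2) unfolding Sigma_ray_def by auto
qed

lemma column_density_jump:
  assumes k: "k < D" "x \<in> Sigma_ray D k" "x \<noteq> 0" and j: "1 \<le> j" "j < D"
  shows "column_density q j k x = poly q x * jump_matrix D V lam F x $$ (0, j)"
proof (cases "j = 1")
  case True
  then show ?thesis using real_on_ray_iff[OF k] j by (auto simp: column_density_def jump_matrix_def real_density_def indicator_def)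
next
  case False
  then show ?thesis using omega_on_ray[OF slot_index[OF j False] k] j by (simp add: column_density_def jump_matrix_def)
qed

lemma column_density_first_moments:
  "contour_mass D (\<lambda>k x. x ^ m * column_density q 1 k x) = Xi V m q"
  "2 \<le> j \<Longrightarrow> j < D \<Longrightarrow> contour_mass D (\<lambda>k x. x ^ 0 * column_density q j k x) = - (2 * of_real pi * \<i>) * Theta D V lam F (slot D j) q"
  using Xi_eq_mass Theta_eq_mass[OF slot_index] by (simp_all add: column_density_def)

end

section \<open>The problem row by row\<close>

text \<open>The local part of the conditions that a solution of the problem imposes on one matrix entry.\<close>

definition boundary_data ::
  "nat \<Rightarrow> (complex \<Rightarrow> complex) \<Rightarrow> (complex \<Rightarrow> complex) \<Rightarrow> (complex \<Rightarrow> complex) \<Rightarrow> bool" where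
  "boundary_data D f bp bm \<longleftrightarrow>
     continuous_on (Sigma_all D - {0}) bp \<and> continuous_on (Sigma_all D - {0}) bm \<and>
     (\<forall>k<D. has_nontangential_values D k 1 f bp \<and> has_nontangential_values D k (-1) f bm)"

lemma boundary_dataI:
  assumes "D \<ge> 4" "\<And>k s. k < D \<Longrightarrow> s = 1 \<or> s = -1 \<Longrightarrow> local_extension D k s f (b s)"
  shows "boundary_data D f (b 1) (b (-1))"
  unfolding boundary_data_def
  using local_extension_continuous[OF assms(1) assms(2)] local_extension_nontangential[OF assms(2)] by simp

lemma boundary_data_diff:
  assumes "boundary_data D f bp bm" "boundary_data D g cp cm"
  shows "boundary_data D (\<lambda>z. f z - g z) (\<lambda>x. bp x - cp x) (\<lambda>x. bm x - cm x)"
  using assms nontangential_diff unfolding boundary_data_def by (auto intro!: continuous_intros)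

text \<open>Brings a function with equal boundary values into the form that \<open>paste_boundary_data\<close> takes.\<close>

lemma boundary_data_no_jump:
  assumes b: "boundary_data D f bp bm" and eq: "\<And>x. x \<in> Sigma_all D - {0} \<Longrightarrow> bp x = bm x"
  shows "boundary_data D f bp bp"
proof -
  have "has_nontangential_values D k (-1) f bp" if "k < D" for k
  proof (rule nontangential_cong)
    show "has_nontangential_values D k (-1) f bm" using b that unfolding boundary_data_def by blast
    fix x assume "x \<in> Sigma_ray D k - {0}"
    then have "x \<in> Sigma_all D - {0}" using that unfolding Sigma_all_def by auto
    then show "bm x = bp x" using eq by simp
  qed
  then show ?thesis using b unfolding boundary_data_def by blast
qed

text \<open>Neighbourhoods of infinity with the contour removed.\<close>

abbreviation far :: "nat \<Rightarrow> complex filter" where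
  "far D \<equiv> inf at_infinity (principal (- Sigma_all D))"

lemma eventually_far: "eventually Q (far D) \<longleftrightarrow> (\<exists>r. \<forall>z. cmod z > r \<longrightarrow> z \<notin> Sigma_all D \<longrightarrow> Q z)"
proof -
  have "eventually Q (far D) \<longleftrightarrow> (\<exists>r. \<forall>z. cmod z \<ge> r \<longrightarrow> z \<notin> Sigma_all D \<longrightarrow> Q z)"
    by (auto simp: eventually_inf_principal eventually_at_infinity)
  also have "\<dots> \<longleftrightarrow> (\<exists>r. \<forall>z. cmod z > r \<longrightarrow> z \<notin> Sigma_all D \<longrightarrow> Q z)"
    by (metis gt_ex less_imp_le less_le_trans)
  finally show ?thesis .
qed

lemma growth_matrix_mult:
  assumes "X \<in> carrier_mat D D" "i < D" "j < D"
  shows "(X * growth_matrix D n z) $$ (i, j) = X $$ (i, j) * growth_matrix D n z $$ (j, j)"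
proof -
  have "(X * growth_matrix D n z) $$ (i, j) = (\<Sum>k<D. X $$ (i, k) * growth_matrix D n z $$ (k, j))"
    using assms by (simp add: growth_matrix_def scalar_prod_def lessThan_atLeast0)
  also have "\<dots> = (\<Sum>k\<in>{j}. X $$ (i, k) * growth_matrix D n z $$ (k, j))"
    using assms by (intro sum.mono_neutral_right) (auto simp: growth_matrix_def)
  finally show ?thesis by simp
qed

lemma growth_matrix_diag:
  assumes "j < D"
  shows "growth_matrix D n z $$ (j, j) =
    (if j = 0 then z ^ (n + D - 2) else if j = 1 then 1 / z ^ n else 1 / z)"
  using assms by (auto simp: growth_matrix_def power_int_minus divide_inverse)

abbreviation col_growth :: "nat \<Rightarrow> nat \<Rightarrow> nat \<Rightarrow> complex \<Rightarrow> complex" where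
  "col_growth D n j z \<equiv> growth_matrix D n z $$ (j, j)"

text \<open>The conditions on one row \<open>r\<close> of a solution. The vector \<open>\<epsilon>\<close> stands for the corresponding row of the
  identity in the normalisation; with \<open>\<epsilon> = 0\<close> one obtains the homogeneous problem, satisfied by
  differences of solutions.\<close>

definition rhp_row ::
  "nat \<Rightarrow> real poly \<Rightarrow> real \<Rightarrow> (nat \<Rightarrow> complex \<Rightarrow> complex) \<Rightarrow> nat \<Rightarrow> (nat \<Rightarrow> complex)
     \<Rightarrow> (nat \<Rightarrow> complex \<Rightarrow> complex) \<Rightarrow> bool" where
  "rhp_row D V lam F n \<epsilon> r \<longleftrightarrow>
     (\<forall>j<D. r j holomorphic_on - Sigma_all D) \<and>
     (\<exists>bp bm. (\<forall>j<D. boundary_data D (r j) (bp j) (bm j)) \<and>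
        (\<forall>x\<in>Sigma_all D - {0}. \<forall>j<D. bp j x =
           (if j = 0 then bm 0 x else bm j x + bm 0 x * jump_matrix D V lam F x $$ (0, j)))) \<and>
     (\<forall>j<D. \<exists>M. \<forall>\<^sub>F z in at 0 within - Sigma_all D. cmod (r j z) \<le> M) \<and>
     (\<forall>j<D. \<exists>c. \<forall>\<^sub>F z in far D.
        cmod (r j z - \<epsilon> j * col_growth D n j z) \<le> c / cmod z * cmod (col_growth D n j z))"

lemma rhp_row_diff:
  assumes r: "rhp_row D V lam F n \<epsilon> r" and r': "rhp_row D V lam F n \<epsilon>' r'"
  shows "rhp_row D V lam F n (\<lambda>j. \<epsilon> j - \<epsilon>' j) (\<lambda>j z. r j z - r' j z)"
  unfolding rhp_row_def
proof (intro conjI allI impI)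
  fix j assume j: "j < D"
  show "(\<lambda>z. r j z - r' j z) holomorphic_on - Sigma_all D"
    using r r' j unfolding rhp_row_def by (auto intro!: holomorphic_intros)
  obtain M M' where "\<forall>\<^sub>F z in at 0 within - Sigma_all D. cmod (r j z) \<le> M"
    "\<forall>\<^sub>F z in at 0 within - Sigma_all D. cmod (r' j z) \<le> M'"
    using r r' j unfolding rhp_row_def by meson
  then have "\<forall>\<^sub>F z in at 0 within - Sigma_all D. cmod (r j z - r' j z) \<le> M + M'"
    by eventually_elim (rule norm_triangle_le_diff, rule add_mono)
  then show "\<exists>M. \<forall>\<^sub>F z in at 0 within - Sigma_all D. cmod (r j z - r' j z) \<le> M" by blast
  obtain c c' where
    "\<forall>\<^sub>F z in far D. cmod (r j z - \<epsilon> j * col_growth D n j z) \<le> c / cmod z * cmod (col_growth D n j z)"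
    "\<forall>\<^sub>F z in far D. cmod (r' j z - \<epsilon>' j * col_growth D n j z) \<le> c' / cmod z * cmod (col_growth D n j z)"
    using r r' j unfolding rhp_row_def by meson
  then have "\<forall>\<^sub>F z in far D. cmod (r j z - r' j z - (\<epsilon> j - \<epsilon>' j) * col_growth D n j z)
      \<le> (c + c') / cmod z * cmod (col_growth D n j z)"
  proof eventually_elim
    case (elim z)
    have "r j z - r' j z - (\<epsilon> j - \<epsilon>' j) * col_growth D n j z
      = (r j z - \<epsilon> j * col_growth D n j z) - (r' j z - \<epsilon>' j * col_growth D n j z)"
      by (simp add: algebra_simps)
    then have "cmod (r j z - r' j z - (\<epsilon> j - \<epsilon>' j) * col_growth D n j z)
      \<le> cmod (r j z - \<epsilon> j * col_growth D n j z) + cmod (r' j z - \<epsilon>' j * col_growth D n j z)"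
      by (simp only: norm_triangle_ineq4)
    also have "\<dots> \<le> c / cmod z * cmod (col_growth D n j z) + c' / cmod z * cmod (col_growth D n j z)"
      by (intro add_mono elim)
    finally show ?case by (simp only: add_divide_distrib distrib_right)
  qed
  then show "\<exists>c. \<forall>\<^sub>F z in far D. cmod (r j z - r' j z - (\<epsilon> j - \<epsilon>' j) * col_growth D n j z)
      \<le> c / cmod z * cmod (col_growth D n j z)" by blast
next
  obtain bp bm cp cm where b: "\<forall>j<D. boundary_data D (r j) (bp j) (bm j)" "\<forall>j<D. boundary_data D (r' j) (cp j) (cm j)"
    and J: "\<forall>x\<in>Sigma_all D - {0}. \<forall>j<D. bp j x =
           (if j = 0 then bm 0 x else bm j x + bm 0 x * jump_matrix D V lam F x $$ (0, j))"
      "\<forall>x\<in>Sigma_all D - {0}. \<forall>j<D. cp j x =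
           (if j = 0 then cm 0 x else cm j x + cm 0 x * jump_matrix D V lam F x $$ (0, j))"
    using r r' unfolding rhp_row_def by (elim conjE exE)
  show "\<exists>bp bm. (\<forall>j<D. boundary_data D (\<lambda>z. r j z - r' j z) (bp j) (bm j)) \<and>
        (\<forall>x\<in>Sigma_all D - {0}. \<forall>j<D. bp j x =
           (if j = 0 then bm 0 x else bm j x + bm 0 x * jump_matrix D V lam F x $$ (0, j)))"
  proof (rule exI[of _ "\<lambda>j x. bp j x - cp j x"], rule exI[of _ "\<lambda>j x. bm j x - cm j x"], intro conjI ballI allI impI)
    fix x j assume x: "x \<in> Sigma_all D - {0}" and j: "j < D"
    show "bp j x - cp j x = (if j = 0 then bm 0 x - cm 0 x
       else bm j x - cm j x + (bm 0 x - cm 0 x) * jump_matrix D V lam F x $$ (0, j))"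
      using J(1)[rule_format, OF x j] J(2)[rule_format, OF x j] by (simp add: algebra_simps)
  qed (use b in \<open>auto intro: boundary_data_diff\<close>)
qed

lemma jump_matrix_mult:
  assumes "X \<in> carrier_mat D D" "i < D" "j < D"
  shows "(X * jump_matrix D V lam F x) $$ (i, j) =
    (if j = 0 then X $$ (i, 0) else X $$ (i, j) + X $$ (i, 0) * jump_matrix D V lam F x $$ (0, j))"
proof -
  have "(X * jump_matrix D V lam F x) $$ (i, j) = (\<Sum>k<D. X $$ (i, k) * jump_matrix D V lam F x $$ (k, j))"
    using assms by (simp add: jump_matrix_def scalar_prod_def lessThan_atLeast0)
  also have "\<dots> = (\<Sum>k\<in>{0, j}. X $$ (i, k) * jump_matrix D V lam F x $$ (k, j))"
    using assms by (intro sum.mono_neutral_right) (auto simp: jump_matrix_def)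
  finally show ?thesis using assms by (auto simp: jump_matrix_def)
qed

lemma jump_matrix_mult_iff:
  assumes X: "X \<in> carrier_mat D D" and Z: "Z \<in> carrier_mat D D"
  shows "Z = X * jump_matrix D V lam F x \<longleftrightarrow> (\<forall>i<D. \<forall>j<D. Z $$ (i, j) =
    (if j = 0 then X $$ (i, 0) else X $$ (i, j) + X $$ (i, 0) * jump_matrix D V lam F x $$ (0, j)))"
proof
  show "Z = X * jump_matrix D V lam F x \<Longrightarrow> \<forall>i<D. \<forall>j<D. Z $$ (i, j) =
    (if j = 0 then X $$ (i, 0) else X $$ (i, j) + X $$ (i, 0) * jump_matrix D V lam F x $$ (0, j))"
    using jump_matrix_mult[OF X] by simp
next
  assume "\<forall>i<D. \<forall>j<D. Z $$ (i, j) =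
    (if j = 0 then X $$ (i, 0) else X $$ (i, j) + X $$ (i, 0) * jump_matrix D V lam F x $$ (0, j))"
  then show "Z = X * jump_matrix D V lam F x"
    using X Z jump_matrix_mult[OF X] by (intro eq_matI) (auto simp: jump_matrix_def simp del: index_mult_mat(1))
qed

text \<open>Entrywise, the normalisation compares each entry with the growth of its own column because the
  growth matrix is diagonal.\<close>

lemma growth_matrix_mult_iff:
  assumes A: "A \<in> carrier_mat D D" and E: "E \<in> carrier_mat D D"
  shows "A = (1\<^sub>m D + E) * growth_matrix D n z \<longleftrightarrow>
    (\<forall>i<D. \<forall>j<D. A $$ (i, j) - (if i = j then 1 else 0) * col_growth D n j z = E $$ (i, j) * col_growth D n j z)"
proof -
  have *: "((1\<^sub>m D + E) * growth_matrix D n z) $$ (i, j) = ((if i = j then 1 else 0) + E $$ (i, j)) * col_growth D n j z"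
    if "i < D" "j < D" for i j
    using that E by (subst growth_matrix_mult) auto
  show ?thesis
  proof
    assume "A = (1\<^sub>m D + E) * growth_matrix D n z"
    then show "\<forall>i<D. \<forall>j<D. A $$ (i, j) - (if i = j then 1 else 0) * col_growth D n j z = E $$ (i, j) * col_growth D n j z"
      using * by (simp add: algebra_simps)
  next
    assume e: "\<forall>i<D. \<forall>j<D. A $$ (i, j) - (if i = j then 1 else 0) * col_growth D n j z = E $$ (i, j) * col_growth D n j z"
    show "A = (1\<^sub>m D + E) * growth_matrix D n z"
    proof (rule eq_matI)
      fix i j assume "i < dim_row ((1\<^sub>m D + E) * growth_matrix D n z)" "j < dim_col ((1\<^sub>m D + E) * growth_matrix D n z)"
      then have ij: "i < D" "j < D" using E by (auto simp: growth_matrix_def)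
      then have "A $$ (i, j) - (if i = j then 1 else 0) * col_growth D n j z = E $$ (i, j) * col_growth D n j z" using e by simp
      then show "A $$ (i, j) = ((1\<^sub>m D + E) * growth_matrix D n z) $$ (i, j)"
        unfolding *[OF ij] by (simp add: algebra_simps)
    qed (use A E in \<open>auto simp: growth_matrix_def\<close>)
  qed
qed

lemma solves_RHP_carrier: "solves_RHP D V lam F n A \<Longrightarrow> z \<notin> Sigma_all D \<Longrightarrow> A z \<in> carrier_mat D D"
  unfolding solves_RHP_def by (drule conjunct1) blast

lemma solves_RHP_imp_row:
  assumes A: "solves_RHP D V lam F n A" and i: "i < D"
  shows "rhp_row D V lam F n (\<lambda>j. if i = j then 1 else 0) (\<lambda>j z. A z $$ (i, j))"
  unfolding rhp_row_def
proof (intro conjI allI impI)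
  note A' = A[unfolded solves_RHP_def]
  fix j assume j: "j < D"
  show "(\<lambda>z. A z $$ (i, j)) holomorphic_on - Sigma_all D"
    using A'[THEN conjunct2, THEN conjunct1] i j by blast
  obtain d M where "d > 0" "\<forall>z\<in>ball 0 d - Sigma_all D. \<forall>i<D. \<forall>j<D. cmod (A z $$ (i, j)) \<le> M"
    using A' by (elim conjE exE)
  then show "\<exists>M. \<forall>\<^sub>F z in at 0 within - Sigma_all D. cmod (A z $$ (i, j)) \<le> M"
    using i j by (intro exI[of _ M]) (auto simp: eventually_at intro!: exI[of _ d])
  obtain E where E: "\<forall>i<D. \<forall>j<D. (\<lambda>z. E z $$ (i, j)) \<in> O[far D](\<lambda>z. 1 / z)"
    and eqn: "\<forall>\<^sub>F z in far D. E z \<in> carrier_mat D D \<and> A z = (1\<^sub>m D + E z) * growth_matrix D n z"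
    using A' by (elim conjE exE)
  obtain c where "\<forall>\<^sub>F z in far D. cmod (E z $$ (i, j)) \<le> c * cmod (1 / z)"
    using E[rule_format, OF i j] by (rule landau_o.bigE)
  moreover have "\<forall>\<^sub>F z in far D. z \<in> - Sigma_all D" by (auto simp: eventually_inf_principal)
  ultimately have "\<forall>\<^sub>F z in far D. cmod (A z $$ (i, j) - (if i = j then 1 else 0) * col_growth D n j z)
      \<le> c / cmod z * cmod (col_growth D n j z)"
    using eqn
  proof eventually_elim
    case (elim z)
    have "A z $$ (i, j) - (if i = j then 1 else 0) * col_growth D n j z = E z $$ (i, j) * col_growth D n j z"
      using growth_matrix_mult_iff[of "A z" D "E z" n z] solves_RHP_carrier[OF A, of z] elim i j by blast
    moreover have "cmod (E z $$ (i, j)) \<le> c / cmod z" using elim by (simp add: norm_divide)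
    ultimately show ?case using mult_right_mono[of _ _ "cmod (col_growth D n j z)"] by (simp only: norm_mult norm_ge_zero)
  qed
  then show "\<exists>c. \<forall>\<^sub>F z in far D. cmod (A z $$ (i, j) - (if i = j then 1 else 0) * col_growth D n j z)
      \<le> c / cmod z * cmod (col_growth D n j z)" by blast
next
  obtain Ap Am where car: "\<forall>x\<in>Sigma_all D - {0}. Ap x \<in> carrier_mat D D \<and> Am x \<in> carrier_mat D D"
    and nt: "\<forall>i<D. \<forall>j<D.
           continuous_on (Sigma_all D - {0}) (\<lambda>x. Ap x $$ (i, j)) \<and>
           continuous_on (Sigma_all D - {0}) (\<lambda>x. Am x $$ (i, j)) \<and>
           (\<forall>k<D.
              has_nontangential_values D k 1 (\<lambda>z. A z $$ (i, j)) (\<lambda>x. Ap x $$ (i, j)) \<and>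
              has_nontangential_values D k (-1) (\<lambda>z. A z $$ (i, j)) (\<lambda>x. Am x $$ (i, j)))"
    and jump: "\<forall>x\<in>Sigma_all D - {0}. Ap x = Am x * jump_matrix D V lam F x"
    using A[unfolded solves_RHP_def] by (elim exE conjE)
  show "\<exists>bp bm. (\<forall>j<D. boundary_data D (\<lambda>z. A z $$ (i, j)) (bp j) (bm j)) \<and>
        (\<forall>x\<in>Sigma_all D - {0}. \<forall>j<D. bp j x =
           (if j = 0 then bm 0 x else bm j x + bm 0 x * jump_matrix D V lam F x $$ (0, j)))"
  proof (rule exI[of _ "\<lambda>j x. Ap x $$ (i, j)"], rule exI[of _ "\<lambda>j x. Am x $$ (i, j)"], intro conjI ballI allI impI)
    fix x j assume x: "x \<in> Sigma_all D - {0}" and j: "j < D"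
    show "Ap x $$ (i, j) = (if j = 0 then Am x $$ (i, 0) else Am x $$ (i, j) + Am x $$ (i, 0) * jump_matrix D V lam F x $$ (0, j))"
      using jump_matrix_mult_iff[of "Am x" D "Ap x" V lam F x] bspec[OF car x] bspec[OF jump x] i j by blast
  next
    fix j assume j: "j < D"
    show "boundary_data D (\<lambda>z. A z $$ (i, j)) (\<lambda>x. Ap x $$ (i, j)) (\<lambda>x. Am x $$ (i, j))"
      unfolding boundary_data_def by (rule nt[THEN spec, THEN mp, OF i, THEN spec, THEN mp, OF j])
  qed
qed

text \<open>The bounds for the finitely many entries are merged into one; the error matrix is obtained by
  dividing each entry by the growth of its column.\<close>

lemma rows_imp_solves_RHP:
  assumes car: "\<And>z. z \<notin> Sigma_all D \<Longrightarrow> A z \<in> carrier_mat D D"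
    and rows: "\<And>i. i < D \<Longrightarrow> rhp_row D V lam F n (\<lambda>j. if i = j then 1 else 0) (\<lambda>j z. A z $$ (i, j))"
  shows "solves_RHP D V lam F n A"
  unfolding solves_RHP_def
proof (intro conjI)
  show "\<forall>z\<in>- Sigma_all D. A z \<in> carrier_mat D D" using car by auto
  show "\<forall>i<D. \<forall>j<D. (\<lambda>z. A z $$ (i, j)) holomorphic_on - Sigma_all D"
    using rows unfolding rhp_row_def by blast
  have "\<forall>i\<in>{..<D}. \<exists>bp bm. (\<forall>j<D. boundary_data D (\<lambda>z. A z $$ (i, j)) (bp j) (bm j)) \<and>
        (\<forall>x\<in>Sigma_all D - {0}. \<forall>j<D. bp j x =
           (if j = 0 then bm 0 x else bm j x + bm 0 x * jump_matrix D V lam F x $$ (0, j)))"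
    using rows unfolding rhp_row_def by blast
  then obtain bp bm where b: "\<forall>i\<in>{..<D}. (\<forall>j<D. boundary_data D (\<lambda>z. A z $$ (i, j)) (bp i j) (bm i j)) \<and>
        (\<forall>x\<in>Sigma_all D - {0}. \<forall>j<D. bp i j x =
           (if j = 0 then bm i 0 x else bm i j x + bm i 0 x * jump_matrix D V lam F x $$ (0, j)))"
    by metis
  define B where "B b x = Matrix.mat D D (\<lambda>(i, j). b i j x)" for b :: "nat \<Rightarrow> nat \<Rightarrow> complex \<Rightarrow> complex" and x
  have Bij: "(\<lambda>x. B b x $$ (i, j)) = b i j" if "i < D" "j < D" for b i j
    using that by (simp add: B_def fun_eq_iff)
  show "\<exists>Ap Am.
        (\<forall>x\<in>Sigma_all D - {0}. Ap x \<in> carrier_mat D D \<and> Am x \<in> carrier_mat D D) \<and>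
        (\<forall>i<D. \<forall>j<D.
           continuous_on (Sigma_all D - {0}) (\<lambda>x. Ap x $$ (i, j)) \<and>
           continuous_on (Sigma_all D - {0}) (\<lambda>x. Am x $$ (i, j)) \<and>
           (\<forall>k<D.
              has_nontangential_values D k 1 (\<lambda>z. A z $$ (i, j)) (\<lambda>x. Ap x $$ (i, j)) \<and>
              has_nontangential_values D k (-1) (\<lambda>z. A z $$ (i, j)) (\<lambda>x. Am x $$ (i, j)))) \<and>
        (\<forall>x\<in>Sigma_all D - {0}. Ap x = Am x * jump_matrix D V lam F x)"
    unfolding boundary_data_def[symmetric]
  proof (rule exI[of _ "B bp"], rule exI[of _ "B bm"], intro conjI)
    have Bc: "B b x \<in> carrier_mat D D" for b x by (simp add: B_def)
    then show "\<forall>x\<in>Sigma_all D - {0}. B bp x \<in> carrier_mat D D \<and> B bm x \<in> carrier_mat D D" by blast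
    show "\<forall>i<D. \<forall>j<D. boundary_data D (\<lambda>z. A z $$ (i, j)) (\<lambda>x. B bp x $$ (i, j)) (\<lambda>x. B bm x $$ (i, j))"
      using b Bij by simp
    show "\<forall>x\<in>Sigma_all D - {0}. B bp x = B bm x * jump_matrix D V lam F x"
    proof
      fix x assume x: "x \<in> Sigma_all D - {0}"
      show "B bp x = B bm x * jump_matrix D V lam F x"
        unfolding jump_matrix_mult_iff[OF Bc Bc]
      proof (intro allI impI)
        fix i j assume ij: "i < D" "j < D"
        then have "bp i j x = (if j = 0 then bm i 0 x else bm i j x + bm i 0 x * jump_matrix D V lam F x $$ (0, j))"
          using b x by blast
        then show "B bp x $$ (i, j) = (if j = 0 then B bm x $$ (i, 0)
            else B bm x $$ (i, j) + B bm x $$ (i, 0) * jump_matrix D V lam F x $$ (0, j))"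
          using ij by (simp add: B_def)
      qed
    qed
  qed
  have "\<forall>i\<in>{..<D}. \<forall>j\<in>{..<D}. \<exists>M. \<forall>\<^sub>F z in at 0 within - Sigma_all D. cmod (A z $$ (i, j)) \<le> M"
    using rows unfolding rhp_row_def by blast
  then obtain M where "\<forall>i\<in>{..<D}. \<forall>j\<in>{..<D}. \<forall>\<^sub>F z in at 0 within - Sigma_all D. cmod (A z $$ (i, j)) \<le> M i j"
    by metis
  then have ev: "\<forall>\<^sub>F z in at 0 within - Sigma_all D. \<forall>i\<in>{..<D}. \<forall>j\<in>{..<D}. cmod (A z $$ (i, j)) \<le> M i j"
    by (intro eventually_ball_finite finite_lessThan ballI) blast
  have le: "M i j \<le> (\<Sum>i<D. \<Sum>j<D. \<bar>M i j\<bar>)" if "i < D" "j < D" for i j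
  proof -
    have "M i j \<le> \<bar>M i j\<bar>" by simp
    also have "\<dots> \<le> (\<Sum>j<D. \<bar>M i j\<bar>)" using that by (intro member_le_sum) auto
    also have "\<dots> \<le> (\<Sum>i<D. \<Sum>j<D. \<bar>M i j\<bar>)"
      using that by (intro member_le_sum[of i _ "\<lambda>i. \<Sum>j<D. \<bar>M i j\<bar>"] sum_nonneg) auto
    finally show ?thesis .
  qed
  obtain d where d: "d > 0" "\<And>z. z \<in> - Sigma_all D \<Longrightarrow> z \<noteq> 0 \<Longrightarrow> dist z 0 < d \<Longrightarrow>
      \<forall>i\<in>{..<D}. \<forall>j\<in>{..<D}. cmod (A z $$ (i, j)) \<le> M i j"
    using ev unfolding eventually_at by blast
  show "\<exists>d>0. \<exists>M. \<forall>z\<in>ball 0 d - Sigma_all D. \<forall>i<D. \<forall>j<D. cmod (A z $$ (i, j)) \<le> M"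
  proof (rule exI[of _ d], rule conjI, rule d(1), rule exI[of _ "\<Sum>i<D. \<Sum>j<D. \<bar>M i j\<bar>"], intro ballI allI impI)
    fix z i j assume z: "z \<in> ball 0 d - Sigma_all D" and ij: "i < D" "j < D"
    have "0 \<in> Sigma_all D" using ij unfolding Sigma_all_def by auto
    then have "cmod (A z $$ (i, j)) \<le> M i j" using d(2)[of z] z ij by force
    then show "cmod (A z $$ (i, j)) \<le> (\<Sum>i<D. \<Sum>j<D. \<bar>M i j\<bar>)" using le[OF ij] by linarith
  qed
  define E where "E z = Matrix.mat D D (\<lambda>(i, j). A z $$ (i, j) / col_growth D n j z - (if i = j then 1 else 0))" for z
  have g0: "col_growth D n j z \<noteq> 0" if "j < D" "z \<noteq> 0" for j z
    using that by (simp add: growth_matrix_diag)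
  have Ec: "E z \<in> carrier_mat D D" for z by (simp add: E_def)
  have Eij: "A z $$ (i, j) - (if i = j then 1 else 0) * col_growth D n j z = E z $$ (i, j) * col_growth D n j z"
    if "i < D" "j < D" "z \<noteq> 0" for i j z
    using that g0 by (simp add: E_def left_diff_distrib)
  have nz: "\<forall>\<^sub>F z in far D. z \<noteq> 0 \<and> z \<notin> Sigma_all D"
    unfolding eventually_far by (rule exI[of _ 0]) auto
  show "\<exists>E. (\<forall>i<D. \<forall>j<D. (\<lambda>z. E z $$ (i, j)) \<in> O[far D](\<lambda>z. 1 / z)) \<and>
          (\<forall>\<^sub>F z in far D. E z \<in> carrier_mat D D \<and> A z = (1\<^sub>m D + E z) * growth_matrix D n z)"
  proof (intro exI[of _ E] conjI allI impI)
    show "\<forall>\<^sub>F z in far D. E z \<in> carrier_mat D D \<and> A z = (1\<^sub>m D + E z) * growth_matrix D n z"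
      using nz
    proof eventually_elim
      case (elim z)
      then show ?case using growth_matrix_mult_iff[OF car Ec, of z z n z] Ec Eij by blast
    qed
    fix i j assume ij: "i < D" "j < D"
    obtain c where c: "\<forall>\<^sub>F z in far D. cmod (A z $$ (i, j) - (if i = j then 1 else 0) * col_growth D n j z)
        \<le> c / cmod z * cmod (col_growth D n j z)"
      using rows[OF ij(1)] ij(2) unfolding rhp_row_def by blast
    show "(\<lambda>z. E z $$ (i, j)) \<in> O[far D](\<lambda>z. 1 / z)"
    proof (rule bigoI[of _ c])
      show "\<forall>\<^sub>F z in far D. norm (E z $$ (i, j)) \<le> c * norm (1 / z)"
        using c nz
      proof eventually_elim
        case (elim z)
        then have "cmod (E z $$ (i, j)) * cmod (col_growth D n j z) \<le> c / cmod z * cmod (col_growth D n j z)"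
          unfolding norm_mult[symmetric] using Eij[OF ij, of z] by metis
        moreover have "cmod (col_growth D n j z) > 0" using g0[OF ij(2)] elim by simp
        ultimately have "cmod (E z $$ (i, j)) \<le> c / cmod z" by (rule mult_right_le_imp_le)
        then show ?case by (simp add: norm_divide)
      qed
    qed
  qed
qed

lemma paste_boundary_data:
  assumes D: "D \<ge> 4" and f: "f holomorphic_on - Sigma_all D" and b: "boundary_data D f b b"
    and bd: "\<forall>\<^sub>F z in at 0 within - Sigma_all D. cmod (f z) \<le> M"
  obtains g where "g holomorphic_on UNIV" "\<And>z. z \<notin> Sigma_all D \<Longrightarrow> g z = f z"
proof -
  have S0: "0 \<in> Sigma_all D" using D unfolding Sigma_all_def by (auto intro!: exI[of _ 0])
  obtain d where d: "d > 0" "\<And>z. z \<in> - Sigma_all D \<Longrightarrow> z \<noteq> 0 \<Longrightarrow> dist z 0 < d \<Longrightarrow> cmod (f z) \<le> M"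
    using bd unfolding eventually_at by blast
  have dM: "cmod (f z) \<le> M" if "z \<in> ball 0 d - Sigma_all D" for z
    using d(2)[of z] that S0 by (cases "z = 0") auto
  show ?thesis
    by (rule paste_across_contour[OF D f _ _ _ d(1) dM])
       (use b that in \<open>auto simp: boundary_data_def\<close>)
qed

section \<open>Existence and uniqueness\<close>

context sibuya_setting
begin

lemma contour_cauchy_boundary_data:
  "1 \<le> j \<Longrightarrow> j < D \<Longrightarrow> boundary_data D (contour_cauchy D (column_density q j))
     (contour_bdry D (column_density q j) 1) (contour_bdry D (column_density q j) (-1))"
  by (rule boundary_dataI[OF D4 contour_cauchy_local_extension[OF D4 rapid_column_density]])

lemma column_jump:
  assumes j: "1 \<le> j" "j < D" and x: "x \<in> Sigma_all D - {0}"
  shows "contour_bdry D (column_density q j) 1 x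
    = contour_bdry D (column_density q j) (-1) x + poly q x * jump_matrix D V lam F x $$ (0, j)"
proof -
  obtain k where k: "k < D" "x \<in> Sigma_ray D k" "x \<noteq> 0" using x unfolding Sigma_all_def by auto
  show ?thesis
    using contour_bdry_jump[OF D4 rapid_column_density[OF j] k] column_density_jump[OF k j] by (simp add: algebra_simps)
qed

lemma contour_cauchy_near_0:
  assumes "1 \<le> j" "j < D"
  obtains M where "\<forall>\<^sub>F z in at 0 within - Sigma_all D. cmod (contour_cauchy D (column_density q j) z) \<le> M"
proof -
  obtain M where M: "\<And>z. z \<notin> Sigma_all D \<Longrightarrow> cmod z \<le> 1 / 2 \<Longrightarrow> cmod (contour_cauchy D (column_density q j) z) \<le> M"
    using contour_cauchy_bounded_near_origin[OF rapid_column_density column_density_balanced] assms by blast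
  show ?thesis
    by (rule that[of M]) (use M in \<open>auto simp: eventually_at intro!: exI[of _ "1/2"]\<close>)
qed

text \<open>The conditions on \<open>q\<close> are exactly those that the normalisation imposes: column \<open>0\<close> prescribes the
  degree, column \<open>1\<close> the moments up to order \<open>n - 1\<close>, and each further column one value of \<open>\<Theta>\<close>.\<close>

lemma polynomial_row:
  assumes n1: "n \<ge> 1"
    and r: "\<And>z j. z \<notin> Sigma_all D \<Longrightarrow> j < D \<Longrightarrow> r j z = (if j = 0 then poly q z else contour_cauchy D (column_density q j) z)"
    and q: "\<And>k. k \<ge> n + D - 2 \<Longrightarrow> coeff q k = (if k = n + D - 2 then \<epsilon> 0 else 0)"
    and X: "\<And>k. k < n - 1 \<Longrightarrow> Xi V k q = 0"
    and X1: "Xi V (n - 1) q = - (2 * of_real pi * \<i>) * \<epsilon> 1"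
    and T: "\<And>j. 2 \<le> j \<Longrightarrow> j < D \<Longrightarrow> Theta D V lam F (slot D j) q = \<epsilon> j"
  shows "rhp_row D V lam F n \<epsilon> r"
  unfolding rhp_row_def
proof (intro conjI allI impI)
  fix j assume j: "j < D"
  let ?r = "\<lambda>z. if j = 0 then poly q z else contour_cauchy D (column_density q j) z"
  have "?r holomorphic_on - Sigma_all D"
    using contour_cauchy_holomorphic[OF rapid_column_density] j by (cases "j = 0") (auto intro!: holomorphic_intros)
  then show "r j holomorphic_on - Sigma_all D"
    by (rule holomorphic_transform) (use r j in auto)
  have "\<exists>M. \<forall>\<^sub>F z in at 0 within - Sigma_all D. cmod (?r z) \<le> M"
  proof (cases "j = 0")
    case True
    have "((\<lambda>z. cmod (poly q z)) \<longlongrightarrow> cmod (poly q 0)) (at 0 within - Sigma_all D)" by (intro tendsto_intros)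
    then have "\<forall>\<^sub>F z in at 0 within - Sigma_all D. cmod (poly q z) < cmod (poly q 0) + 1"
      by (rule order_tendstoD) simp
    then show ?thesis using True by (auto intro!: exI[of _ "cmod (poly q 0) + 1"] elim: eventually_mono)
  next
    case False
    then have "1 \<le> j" by simp
    from contour_cauchy_near_0[OF this j, of q] obtain M
      where "\<forall>\<^sub>F z in at 0 within - Sigma_all D. cmod (contour_cauchy D (column_density q j) z) \<le> M" .
    then show ?thesis using False by auto
  qed
  then obtain M where "\<forall>\<^sub>F z in at 0 within - Sigma_all D. cmod (?r z) \<le> M" by blast
  moreover have "\<forall>\<^sub>F z in at 0 within - Sigma_all D. z \<in> - Sigma_all D" by (auto simp: eventually_at_filter)
  ultimately have "\<forall>\<^sub>F z in at 0 within - Sigma_all D. cmod (r j z) \<le> M"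
    by eventually_elim (simp add: r j)
  then show "\<exists>M. \<forall>\<^sub>F z in at 0 within - Sigma_all D. cmod (r j z) \<le> M" by blast
  have "\<exists>c. \<forall>\<^sub>F z in far D. cmod (?r z - \<epsilon> j * col_growth D n j z) \<le> c / cmod z * cmod (col_growth D n j z)"
  proof (cases "j = 0")
    case True
    define p where "p = q - Polynomial.monom (\<epsilon> 0) (n + D - 2)"
    have "coeff p k = 0" if "k \<ge> n + D - 2" for k using q[OF that] by (simp add: p_def)
    then obtain c where c: "\<And>z. cmod z \<ge> 1 \<Longrightarrow> cmod (poly p z) \<le> c / cmod z * cmod (z ^ (n + D - 2))"
      using poly_lower_order by blast
    have "poly p z = poly q z - \<epsilon> 0 * z ^ (n + D - 2)" for z by (simp add: p_def poly_monom)
    then show ?thesis unfolding eventually_far using c True j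
      by (intro exI[of _ c] exI[of _ 1]) (simp add: growth_matrix_diag)
  next
    case False
    then have j1: "1 \<le> j" by simp
    \<comment> \<open>The order of the moment that the normalisation of column \<open>j\<close> prescribes.\<close>
    define m where "m = (if j = 1 then n - 1 else 0)"
    have gr: "col_growth D n j z = 1 / z ^ Suc m" for z
    proof -
      have "Suc m = (if j = 1 then n else 1)" using n1 by (simp add: m_def)
      then show ?thesis using False j by (simp add: growth_matrix_diag del: power_Suc)
    qed
    note rd = rapid_column_density[OF j1 j]
    have van: "contour_mass D (\<lambda>k x. x ^ l * column_density q j k x) = 0" if "l < m" for l
      using that X column_density_first_moments(1)[of l q] by (auto simp: m_def split: if_splits)
    have pi0: "2 * of_real pi * \<i> \<noteq> (0 :: complex)" by simp
    have lead: "- (1 / (2 * of_real pi * \<i>) * contour_mass D (\<lambda>k x. x ^ m * column_density q j k x)) = \<epsilon> j"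
    proof (cases "j = 1")
      case True
      then show ?thesis using column_density_first_moments(1)[of "n - 1" q] X1 pi0 by (simp add: m_def)
    next
      case False
      then have "2 \<le> j" using j1 by simp
      then show ?thesis using column_density_first_moments(2)[of j q] T[of j] j pi0 False by (simp add: m_def)
    qed
    obtain M where M: "\<And>z. z \<notin> Sigma_all D \<Longrightarrow> cmod z \<ge> 2 \<Longrightarrow>
       cmod (contour_cauchy D (\<lambda>k x. x ^ Suc m * column_density q j k x) z) \<le> M / cmod z"
      using contour_cauchy_decay[OF rapid_densities_power[OF rd]] by metis
    have "cmod (?r z - \<epsilon> j * col_growth D n j z) \<le> M / cmod z * cmod (col_growth D n j z)"
      if z: "cmod z > 2" "z \<notin> Sigma_all D" for z
    proof -
      have "z ^ Suc m * ?r z - \<epsilon> j = contour_cauchy D (\<lambda>k x. x ^ Suc m * column_density q j k x) z"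
        using contour_cauchy_leading_term[OF rd z(2) van] lead False by simp
      moreover have "z ^ Suc m \<noteq> 0" using z by auto
      ultimately have "?r z - \<epsilon> j * (1 / z ^ Suc m)
         = contour_cauchy D (\<lambda>k x. x ^ Suc m * column_density q j k x) z * (1 / z ^ Suc m)"
        using False by (simp add: field_simps del: power_Suc)
      then show ?thesis
        unfolding gr using mult_right_mono[OF M[OF z(2) less_imp_le[OF z(1)]] norm_ge_zero[of "1 / z ^ Suc m"]]
        by (simp only: norm_mult)
    qed
    then show ?thesis unfolding eventually_far by blast
  qed
  then obtain c where c: "\<forall>\<^sub>F z in far D. cmod (?r z - \<epsilon> j * col_growth D n j z) \<le> c / cmod z * cmod (col_growth D n j z)"
    by blast
  have "\<forall>\<^sub>F z in far D. z \<in> - Sigma_all D" by (auto simp: eventually_inf_principal)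
  with c have "\<forall>\<^sub>F z in far D. cmod (r j z - \<epsilon> j * col_growth D n j z) \<le> c / cmod z * cmod (col_growth D n j z)"
  proof eventually_elim
    case (elim z)
    then show ?case using r[of z j] j by simp
  qed
  then show "\<exists>c. \<forall>\<^sub>F z in far D. cmod (r j z - \<epsilon> j * col_growth D n j z) \<le> c / cmod z * cmod (col_growth D n j z)"
    by blast
next
  define b where "b s j = (if j = 0 then poly q else contour_bdry D (column_density q j) s)" for s j
  have bd: "boundary_data D (r j) (b 1 j) (b (-1) j)" if j: "j < D" for j
  proof (rule boundary_dataI[OF D4, where b = "\<lambda>s. b s j"])
    fix k s assume k: "k < D" and s: "s = 1 \<or> s = (-1 :: real)"
    show "local_extension D k s (r j) (b s j)"
    proof (cases "j = 0")
      case True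
      have "local_extension D k s (poly q) (poly q)" by (intro local_extension_self continuous_intros)
      then show ?thesis
        by (rule local_extension_cong[OF D4 k]) (use r j True in \<open>simp_all add: b_def\<close>)
    next
      case False
      have "local_extension D k s (contour_cauchy D (column_density q j)) (contour_bdry D (column_density q j) s)"
        using contour_cauchy_local_extension[OF D4 rapid_column_density k s] False j by simp
      then show ?thesis
        by (rule local_extension_cong[OF D4 k]) (use r j False in \<open>simp_all add: b_def\<close>)
    qed
  qed
  show "\<exists>bp bm. (\<forall>j<D. boundary_data D (r j) (bp j) (bm j)) \<and>
        (\<forall>x\<in>Sigma_all D - {0}. \<forall>j<D. bp j x =
           (if j = 0 then bm 0 x else bm j x + bm 0 x * jump_matrix D V lam F x $$ (0, j)))"
  proof (rule exI[of _ "b 1"], rule exI[of _ "b (-1)"], intro conjI ballI allI impI bd)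
    fix x j assume "x \<in> Sigma_all D - {0}" "j < D"
    then show "b 1 j x = (if j = 0 then b (-1) 0 x else b (-1) j x + b (-1) 0 x * jump_matrix D V lam F x $$ (0, j))"
      using column_jump[of j x q] by (auto simp: b_def)
  qed
qed

text \<open>Column \<open>0\<close> has no jump, hence is a polynomial. Another column and the Cauchy transform built from this
  polynomial have the same jump, so their difference is entire, and it vanishes at infinity.\<close>

lemma homogeneous_row_structure:
  assumes row: "rhp_row D V lam F n (\<lambda>_. 0) r" and n1: "n \<ge> 1"
  obtains p where "degree p \<le> n + D - 3"
    "\<And>z j. z \<notin> Sigma_all D \<Longrightarrow> j < D \<Longrightarrow> r j z = (if j = 0 then poly p z else contour_cauchy D (column_density p j) z)"
proof -
  have D0: "0 < D" using D4 by simp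
  have hol: "r j holomorphic_on - Sigma_all D" if "j < D" for j
    using row that unfolding rhp_row_def by blast
  obtain bp bm where b: "\<forall>j<D. boundary_data D (r j) (bp j) (bm j)"
    and jump: "\<forall>x\<in>Sigma_all D - {0}. \<forall>j<D. bp j x =
           (if j = 0 then bm 0 x else bm j x + bm 0 x * jump_matrix D V lam F x $$ (0, j))"
    using row unfolding rhp_row_def by (elim conjE exE)
  have asy: "\<exists>c R. \<forall>z. cmod z > R \<longrightarrow> z \<notin> Sigma_all D \<longrightarrow> cmod (r j z) \<le> c / cmod z * cmod (col_growth D n j z)"
    if "j < D" for j
  proof -
    have "\<exists>c. \<forall>\<^sub>F z in far D. cmod (r j z - 0 * col_growth D n j z) \<le> c / cmod z * cmod (col_growth D n j z)"
      using row that unfolding rhp_row_def by blast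
    then show ?thesis unfolding eventually_far by simp
  qed
  have bnd: "\<exists>M. \<forall>\<^sub>F z in at 0 within - Sigma_all D. cmod (r j z) \<le> M" if "j < D" for j
    using row that unfolding rhp_row_def by blast
  obtain p where p: "degree p \<le> n + D - 3" "\<And>z. z \<notin> Sigma_all D \<Longrightarrow> r 0 z = poly p z"
  proof -
    have "boundary_data D (r 0) (bp 0) (bp 0)"
      by (rule boundary_data_no_jump[of D _ _ "bm 0"]) (use b jump D0 in auto)
    moreover obtain M where "\<forall>\<^sub>F z in at 0 within - Sigma_all D. cmod (r 0 z) \<le> M" using bnd[OF D0] by blast
    ultimately obtain G where G: "G holomorphic_on UNIV" "\<And>z. z \<notin> Sigma_all D \<Longrightarrow> G z = r 0 z"
      using paste_boundary_data[OF D4 hol[OF D0]] by blast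
    obtain c R where cR: "\<And>z. cmod z > R \<Longrightarrow> z \<notin> Sigma_all D \<Longrightarrow> cmod (r 0 z) \<le> c / cmod z * cmod (col_growth D n 0 z)"
      using asy[OF D0] by blast
    have "cmod (G z) \<le> c * cmod z ^ (n + D - 3)" if z: "cmod z > max R 1" "z \<notin> Sigma_all D" for z
    proof -
      have N: "n + D - 2 = Suc (n + D - 3)" using D4 n1 by simp
      have "z \<noteq> 0" using z by auto
      then have "c / cmod z * cmod (col_growth D n 0 z) = c * cmod z ^ (n + D - 3)"
        unfolding growth_matrix_diag[OF D0] N by (simp add: norm_mult norm_power)
      then show ?thesis using cR[of z] G(2)[OF z(2)] z by simp
    qed
    then obtain p where "degree p \<le> n + D - 3" "\<And>z. G z = poly p z"
      using entire_polynomial_growth[OF G(1)] by blast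
    then show ?thesis using that[of p] G(2) by metis
  qed
  have bm0: "bm 0 x = poly p x" if x: "x \<in> Sigma_all D - {0}" for x
  proof -
    obtain k where k: "k < D" "x \<in> Sigma_ray D k" "x \<noteq> 0" using x unfolding Sigma_all_def by auto
    have "has_nontangential_values D k (-1) (r 0) (bm 0)" using b k D0 unfolding boundary_data_def by blast
    from nontangential_limit_of_continuous[OF D4 k(1) _ this p(2) k(2,3)] show ?thesis
      by (auto intro!: continuous_intros)
  qed
  have col: "r j z = contour_cauchy D (column_density p j) z" if j: "1 \<le> j" "j < D" and z: "z \<notin> Sigma_all D" for j z
  proof -
    define f where "f z = r j z - contour_cauchy D (column_density p j) z" for z
    have "boundary_data D f (\<lambda>x. bp j x - contour_bdry D (column_density p j) 1 x) (\<lambda>x. bm j x - contour_bdry D (column_density p j) (-1) x)"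
      unfolding f_def[abs_def] using b j by (intro boundary_data_diff contour_cauchy_boundary_data) auto
    then have bd: "boundary_data D f (\<lambda>x. bp j x - contour_bdry D (column_density p j) 1 x) (\<lambda>x. bp j x - contour_bdry D (column_density p j) 1 x)"
    proof (rule boundary_data_no_jump)
      fix x assume x: "x \<in> Sigma_all D - {0}"
      show "bp j x - contour_bdry D (column_density p j) 1 x = bm j x - contour_bdry D (column_density p j) (-1) x"
        using jump[rule_format, OF x j(2)] bm0[OF x] column_jump[OF j x, of p] j by simp
    qed
    have fh: "f holomorphic_on - Sigma_all D"
      unfolding f_def[abs_def] by (intro holomorphic_intros hol[OF j(2)] contour_cauchy_holomorphic[OF rapid_column_density[OF j]])
    obtain M where M: "\<forall>\<^sub>F z in at 0 within - Sigma_all D. cmod (r j z) \<le> M" using bnd[OF j(2)] by blast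
    obtain M' where M': "\<forall>\<^sub>F z in at 0 within - Sigma_all D. cmod (contour_cauchy D (column_density p j) z) \<le> M'"
      using contour_cauchy_near_0[OF j] by blast
    from M M' have fb: "\<forall>\<^sub>F z in at 0 within - Sigma_all D. cmod (f z) \<le> M + M'"
      unfolding f_def by eventually_elim (rule norm_triangle_le_diff, rule add_mono)
    obtain G where G: "G holomorphic_on UNIV" "\<And>z. z \<notin> Sigma_all D \<Longrightarrow> G z = f z"
      using paste_boundary_data[OF D4 fh bd fb] by blast
    obtain c R where cR: "\<And>z. cmod z > R \<Longrightarrow> z \<notin> Sigma_all D \<Longrightarrow> cmod (r j z) \<le> c / cmod z * cmod (col_growth D n j z)"
      using asy[OF j(2)] by blast
    obtain K where K: "\<And>z. z \<notin> Sigma_all D \<Longrightarrow> cmod z \<ge> 2 \<Longrightarrow> cmod (contour_cauchy D (column_density p j) z) \<le> K / cmod z"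
      using contour_cauchy_decay[OF rapid_column_density[OF j]] by blast
    have "G z = 0"
    proof (rule entire_vanishing_at_infinity[OF G(1), where A = "max R 2" and B = "\<bar>c\<bar> + K" and D = D])
      fix z assume z: "max R 2 < cmod z" "z \<notin> Sigma_all D"
      have 1: "cmod (col_growth D n j z) \<le> 1"
        using z j by (auto simp: growth_matrix_diag norm_divide norm_power divide_le_eq one_le_power)
      have "cmod (r j z) \<le> c / cmod z * cmod (col_growth D n j z)" using cR z by simp
      also have "\<dots> \<le> \<bar>c\<bar> / cmod z * cmod (col_growth D n j z)"
        by (intro mult_right_mono divide_right_mono) auto
      also have "\<dots> \<le> \<bar>c\<bar> / cmod z * 1" using 1 by (intro mult_left_mono) auto
      finally have "cmod (r j z) \<le> \<bar>c\<bar> / cmod z" by simp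
      then show "cmod (G z) \<le> (\<bar>c\<bar> + K) / cmod z"
        unfolding G(2)[OF z(2)] f_def using K[OF z(2)] z norm_triangle_ineq4[of "r j z" "contour_cauchy D (column_density p j) z"]
        by (simp add: add_divide_distrib)
    qed
    then show ?thesis using G(2)[OF z] by (simp add: f_def)
  qed
  show ?thesis using that[OF p(1)] p(2) col by simp
qed

end

context rhp_setting
begin

text \<open>The decay of the columns forces all moments of the polynomial in column \<open>0\<close> to vanish.\<close>

lemma homogeneous_row_vanishes:
  assumes row: "rhp_row D V lam F n (\<lambda>_. 0) r" and z: "z \<notin> Sigma_all D" and j: "j < D"
  shows "r j z = 0"
proof -
  obtain p where p: "degree p \<le> n + D - 3"
    "\<And>z j. z \<notin> Sigma_all D \<Longrightarrow> j < D \<Longrightarrow> r j z = (if j = 0 then poly p z else contour_cauchy D (column_density p j) z)"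
    using homogeneous_row_structure[OF row n1] by metis
  \<comment> \<open>The growth of column \<open>j\<close> is \<open>z\<close> to the power \<open>-n\<close> or \<open>-1\<close>; the vanishing of \<open>\<epsilon>\<close> gains one further power.\<close>
  have decay: "\<exists>c R. \<forall>z. cmod z > R \<longrightarrow> z \<notin> Sigma_all D \<longrightarrow>
      cmod (contour_cauchy D (column_density p j) z) \<le> c / cmod z ^ Suc (if j = 1 then n else 1)" if j: "1 \<le> j" "j < D" for j
  proof -
    have "\<exists>c. \<forall>\<^sub>F z in far D. cmod (r j z - 0 * col_growth D n j z) \<le> c / cmod z * cmod (col_growth D n j z)"
      using row that unfolding rhp_row_def by blast
    then obtain c R where cR: "\<And>z. cmod z > R \<Longrightarrow> z \<notin> Sigma_all D \<Longrightarrow> cmod (r j z) \<le> c / cmod z * cmod (col_growth D n j z)"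
      unfolding eventually_far by auto
    have "c / cmod z * cmod (col_growth D n j z) = c / cmod z ^ Suc (if j = 1 then n else 1)" for z
      using j by (simp add: growth_matrix_diag norm_divide norm_power)
    then show ?thesis using cR p(2)[of _ j] j by (intro exI[of _ c] exI[of _ R]) auto
  qed
  have "p = 0"
  proof (rule moments_determine_polynomial[OF p(1)])
    fix k assume k: "k < n"
    obtain c R where "\<And>z. cmod z > R \<Longrightarrow> z \<notin> Sigma_all D \<Longrightarrow> cmod (contour_cauchy D (column_density p 1) z) \<le> c / cmod z ^ Suc n"
      using decay[of 1] D4 by auto
    from moments_vanish_of_decay[OF rapid_column_density this k] show "Xi V k p = 0"
      using column_density_first_moments(1)[of k p] D4 by simp
  next
    fix s assume s: "s \<in> weight_indices D"
    obtain j where j: "2 \<le> j" "j < D" "slot D j = s"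
    proof -
      have "s = slot D (if s < half then s + 1 else s)" "2 \<le> (if s < half then s + 1 else s)" "(if s < half then s + 1 else s) < D"
        using weight_indexD[OF s] half D4 by (auto simp: slot_def half_def)
      then show ?thesis using that by metis
    qed
    obtain c R where bd: "\<And>z. cmod z > R \<Longrightarrow> z \<notin> Sigma_all D \<Longrightarrow> cmod (contour_cauchy D (column_density p j) z) \<le> c / cmod z ^ Suc 1"
      using decay[of j] j by auto
    have r: "rapid_densities D (column_density p j)" using rapid_column_density j by auto
    have "contour_mass D (\<lambda>k x. x ^ 0 * column_density p j k x) = 0"
      by (rule moments_vanish_of_decay[OF r bd]) auto
    then show "Theta D V lam F s p = 0"
      using column_density_first_moments(2)[OF j(1,2), of p] j by simp
  qed
  moreover have "column_density 0 j = (\<lambda>k x. 0)" by (simp add: column_density_def fun_eq_iff real_density_def omega_density_def)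
  ultimately show ?thesis using p(2)[OF z j]
    by (simp add: contour_cauchy_def ray_cauchy_def ray_integral_def set_lebesgue_integral_def)
qed

end

lemma cauchy_real_cmult: "cauchy_real (\<lambda>x. c * f x) z = c * cauchy_real f z"
proof -
  have "(LBINT x. c * f (of_real x) / (of_real x - z)) = (LBINT x. c * (f (of_real x) / (of_real x - z)))"
    by simp
  also have "\<dots> = c * (LBINT x. f (of_real x) / (of_real x - z))" by (rule integral_mult_right_zero)
  finally show ?thesis unfolding cauchy_real_def by simp
qed

lemma cauchy_Sigma_cmult: "cauchy_Sigma D (\<lambda>x. c * f x) z = c * cauchy_Sigma D f z"
  unfolding cauchy_Sigma_def Sigma_integral_def times_divide_eq_right[symmetric] ray_integral_cmult
  by (simp add: sum_distrib_left mult_ac)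

lemma RHP_row_cmult: "RHP_row D V lam F (\<lambda>x. c * f x) j z = c * RHP_row D V lam F f j z"
  using cauchy_real_cmult[of c "\<lambda>x. exp (- cpoly V x) * f x" z]
    cauchy_Sigma_cmult[of D c "\<lambda>x. f x * omega D V lam F (slot D j) x" z]
  by (simp add: RHP_row_def mult_ac)

context rhp_setting
begin

text \<open>The factor \<open>-2 \<pi> i \<lambda> / (\<nu>\<^sub>n\<^sub>-\<^sub>1 h\<^sub>n\<^sub>-\<^sub>1)\<close>, which normalises the moment of order \<open>n - 1\<close> to
  \<open>-2 \<pi> i\<close>.\<close>

definition row_const :: complex where
  "row_const = - (2 * of_real pi * \<i> * of_real lam) / of_real (nu D g lam (n - 1) * h (n - 1))"

definition row_poly :: "nat \<Rightarrow> complex poly" where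
  "row_poly i = (if i = 0 then Psi n
     else if i = 1 then Polynomial.smult row_const (Psi (n - 1))
     else R (slot D i))"

lemma RHP_solution_entries:
  assumes z: "z \<notin> Sigma_all D" and ij: "i < D" "j < D"
  shows "RHP_solution D g V lam P F R n z $$ (i, j) =
     (if j = 0 then poly (row_poly i) z else contour_cauchy D (column_density (row_poly i) j) z)"
proof -
  have "RHP_solution D g V lam P F R n z $$ (i, j) = RHP_row D V lam F (poly (row_poly i)) j z"
  proof (cases "i = 1")
    case True
    have "RHP_solution D g V lam P F R n z $$ (i, j) = row_const * RHP_row D V lam F (poly (Psi (n - 1))) j z"
      using ij True by (simp add: RHP_solution_def row_const_def Psi_def)
    also have "\<dots> = RHP_row D V lam F (poly (row_poly i)) j z"
      unfolding RHP_row_cmult[symmetric] using True by (simp add: row_poly_def poly_smult[abs_def])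
    finally show ?thesis .
  qed (use ij in \<open>simp add: RHP_solution_def row_poly_def Psi_def\<close>)
  then show ?thesis unfolding RHP_row_eq[OF z ij(2)] .
qed

lemma row_poly_coeffs:
  assumes i: "i < D" and k: "k \<ge> n + D - 2"
  shows "coeff (row_poly i) k = (if k = n + D - 2 then if i = 0 then 1 else 0 else 0)"
proof (cases "i = 0")
  case True
  then show ?thesis using degree_Psi(1,2)[OF n1] k by (auto simp: row_poly_def intro: coeff_eq_0)
next
  case False
  have "degree (row_poly i) \<le> n + D - 3"
    using degree_Psi(3)[of "n - 1"] R_properties(1)[OF slot_index, of i] i False n1
    by (auto simp: row_poly_def intro: order_trans[OF degree_smult_le])
  then have "coeff (row_poly i) k = 0" using k n1 D4 by (intro coeff_eq_0) simp
  then show ?thesis using False by simp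
qed

lemma Xi_row_poly:
  assumes i: "i < D"
  shows "k < n - 1 \<Longrightarrow> Xi V k (row_poly i) = 0"
    "Xi V (n - 1) (row_poly i) = - (2 * of_real pi * \<i>) * (if i = 1 then 1 else 0)"
proof -
  have R: "Xi V k (R (slot D i)) = 0" if "i \<noteq> 0" "i \<noteq> 1" "k < n" for k
    using R_properties(2)[OF slot_index, of i k] i that by simp
  show "Xi V k (row_poly i) = 0" if "k < n - 1"
    using Xi_Psi(1)[of k n] Xi_Psi(1)[of k "n - 1"] R[of k] that
    by (simp add: row_poly_def Xi_smult)
  show "Xi V (n - 1) (row_poly i) = - (2 * of_real pi * \<i>) * (if i = 1 then 1 else 0)"
  proof (cases "i = 1")
    case True
    have nz: "complex_of_real (nu D g lam (n - 1)) \<noteq> 0" "complex_of_real (h (n - 1)) \<noteq> 0" "complex_of_real lam \<noteq> 0"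
      using nu_pos[of "n - 1"] h_pos[of "n - 1"] lam_pos by auto
    have "Xi V (n - 1) (row_poly i) = row_const * of_real (nu D g lam (n - 1) * h (n - 1) / lam)"
      using True by (simp add: row_poly_def Xi_smult Xi_Psi(2))
    also have "\<dots> = - (2 * of_real pi * \<i>)" unfolding row_const_def using nz by simp
    finally show ?thesis using True by simp
  next
    case False
    then show ?thesis using Xi_Psi(1)[of "n - 1" n] R[of "n - 1"] n1 by (simp add: row_poly_def)
  qed
qed

lemma Theta_row_poly:
  assumes i: "i < D" and j: "2 \<le> j" "j < D"
  shows "Theta D V lam F (slot D j) (row_poly i) = (if i = j then 1 else 0)"
proof -
  have jw: "slot D j \<in> weight_indices D" using slot_index[of j] j by simp
  show ?thesis
  proof (cases "i \<le> 1")
    case True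
    then show ?thesis using j Theta_Psi[OF weight_indexD(1)[OF jw]] by (auto simp: row_poly_def Theta_smult)
  next
    case False
    then show ?thesis
      using R_properties(3)[OF slot_index jw, of i] slot_properties(2)[OF D4 even_D, of j i] i j
      by (auto simp: row_poly_def)
  qed
qed

lemma RHP_solution_solves: "solves_RHP D V lam F n (RHP_solution D g V lam P F R n)"
proof (rule rows_imp_solves_RHP)
  show "RHP_solution D g V lam P F R n z \<in> carrier_mat D D" for z by (simp add: RHP_solution_def)
  fix i assume i: "i < D"
  show "rhp_row D V lam F n (\<lambda>j. if i = j then 1 else 0) (\<lambda>j z. RHP_solution D g V lam P F R n z $$ (i, j))"
    by (rule polynomial_row[OF n1 RHP_solution_entries[OF _ i]])
       (use row_poly_coeffs[OF i] Xi_row_poly[OF i] Theta_row_poly[OF i] in simp_all)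
qed

lemma RHP_solution_unique:
  assumes A: "solves_RHP D V lam F n A" and B: "solves_RHP D V lam F n B" and z: "z \<notin> Sigma_all D"
  shows "A z = B z"
proof (rule eq_matI)
  have c: "A z \<in> carrier_mat D D" "B z \<in> carrier_mat D D"
    using solves_RHP_carrier[OF A z] solves_RHP_carrier[OF B z] .
  then show "dim_row (A z) = dim_row (B z)" "dim_col (A z) = dim_col (B z)" by auto
  fix i j assume "i < dim_row (B z)" "j < dim_col (B z)"
  then have ij: "i < D" "j < D" using c by auto
  have "rhp_row D V lam F n (\<lambda>_. 0) (\<lambda>j z. A z $$ (i, j) - B z $$ (i, j))"
    using rhp_row_diff[OF solves_RHP_imp_row[OF A ij(1)] solves_RHP_imp_row[OF B ij(1)]] by simp
  from homogeneous_row_vanishes[OF this z ij(2)] show "A z $$ (i, j) = B z $$ (i, j)" by simp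
qed

end

theorem theorem2p37:
  fixes D n :: nat and lam g rho :: real
    and V :: "real poly"
    and P :: "nat \<Rightarrow> real poly"
    and phi psi :: "complex \<Rightarrow> complex"
    and F :: "nat \<Rightarrow> complex \<Rightarrow> complex"
    and R :: "nat \<Rightarrow> complex poly"
  assumes "D \<ge> 4" and "even D" and "lam > 0"
    and "degree V = D" and "lead_coeff V = g" and "g > 0"
    and "is_monic_sobolev_op V lam P"
    and "sibuya_chart D g V rho phi psi"
    and "\<And>k. k < 2 * D \<Longrightarrow> is_sibuya_solution D V lam rho psi k (F k)"
    and "n \<ge> 1"
    and "\<And>s. s \<in> weight_indices D \<Longrightarrow> is_R_poly D V lam F n s (R s)"
  shows "solves_RHP D V lam F n (RHP_solution D g V lam P F R n)
       \<and> (\<forall>A. solves_RHP D V lam F n A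
              \<longrightarrow> (\<forall>z\<in>- Sigma_all D. A z = RHP_solution D g V lam P F R n z))"
proof -
  interpret rhp_setting D lam g rho V phi psi F P n R
    by unfold_locales (fact assms)+
  show ?thesis
    using RHP_solution_solves RHP_solution_unique[OF _ RHP_solution_solves] by blast
qed

end
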